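(* Let $\lambda\vdash n$ and $p=2$. Then $\nu_2(\lambda)\ge 3$ if and only if one of the following holds: (1) $\lambda$ is triply $2$-singular; (2) there exist $i,j$ with $\{i,i+1,i+2\}\cap\{j,j+1\}=\emptyset$ such that $\lambda_i\le\lambda_{i+2}+1$, $\lambda_{i+1}\ge 2$ and $\lambda_j=\lambda_{j+1}>0$; (3) $\lambda$ is $4$-singular, i.e. there exists $i$ with $\lambda_i=\lambda_{i+3}>0$; (4) there exist $i,j$ such that $\lambda_i=\lambda_{i+1}=\lambda_j+2=\lambda_{j+1}+2\ge 4$; (5) there exists $i$ such that $\lambda_i\le\lambda_{i+2}+1$ and $\lambda_{i+1}\ge 3$.
   Context: Partitions are written $\lambda=(\lambda_1\ge\lambda_2\ge\cdots)$ with $\lambda_i=0$ beyond the last part. $\lambda$ is triply $2$-singular if there exist $i_1,i_2,i_3$ with $i_2\ge i_1+2$, $i_3\ge i_2+2$ and $\lambda_{i_r}=\lambda_{i_r+1}>0$ for $r=1,2,3$. For $\lambda\vdash n$, $S^\lambda_{\mathbb Z}$ is the integral Specht module spanned by polytabloids $e_t$ in the permutation module on $\lambda$-tabloids with the bilinear form making tabloids orthonormal. The $p$-Schaper number $\nu_p(\lambda)$ is the least $k$ such that $\overline{S^\lambda_k}/\overline{S^\lambda_{k+1}}\ne 0$, where $S^\lambda_i=\{x\in S^\lambda_{\mathbb Z}:p^i\mid\langle x,y\rangle\ \forall y\}$ and the bar is reduction mod $p$; equivalently, the largest $k$ with $p^k\mid\langle e_s,e_t\rangle$ for all $\lambda$-tableaux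 $s,t$. *)

theory Defs
  imports "HOL-Combinatorics.Permutations"
begin

text \<open>Partitions are functions lam :: nat => nat, 1-indexed: lam i is the i-th part (i >= 1),
  weakly decreasing, zero beyond the last part. The value lam 0 is irrelevant.\<close>

definition young :: "(nat \<Rightarrow> nat) \<Rightarrow> (nat \<times> nat) set" where
  "young lam = {(i, j). 1 \<le> i \<and> 1 \<le> j \<and> j \<le> lam i}"

definition is_partition :: "nat \<Rightarrow> (nat \<Rightarrow> nat) \<Rightarrow> bool" where
  "is_partition n lam \<longleftrightarrow> (\<forall>i\<ge>1. lam (Suc i) \<le> lam i) \<and> (\<exists>N. \<forall>i>N. lam i = 0)
     \<and> card (young lam) = n"

definition tableau :: "(nat \<Rightarrow> nat) \<Rightarrow> nat \<Rightarrow> (nat \<times> nat \<Rightarrow> nat) \<Rightarrow> bool" where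
  "tableau lam n t \<longleftrightarrow> bij_betw t (young lam) {1..n}"

text \<open>The tabloid of a tableau, encoded as the map sending each entry to its row.\<close>
definition tabloid :: "(nat \<Rightarrow> nat) \<Rightarrow> nat \<Rightarrow> (nat \<times> nat \<Rightarrow> nat) \<Rightarrow> nat \<Rightarrow> nat" where
  "tabloid lam n t = (\<lambda>k. if k \<in> {1..n} then (THE i. \<exists>j. (i, j) \<in> young lam \<and> t (i, j) = k) else 0)"

definition col_of :: "(nat \<Rightarrow> nat) \<Rightarrow> (nat \<times> nat \<Rightarrow> nat) \<Rightarrow> nat \<Rightarrow> nat" where
  "col_of lam t k = (THE j. \<exists>i. (i, j) \<in> young lam \<and> t (i, j) = k)"

definition col_group :: "(nat \<Rightarrow> nat) \<Rightarrow> nat \<Rightarrow> (nat \<times> nat \<Rightarrow> nat) \<Rightarrow> (nat \<Rightarrow> nat) set" where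
  "col_group lam n t = {\<sigma>. \<sigma> permutes {1..n} \<and> (\<forall>k\<in>{1..n}. col_of lam t (\<sigma> k) = col_of lam t k)}"

text \<open>Polytabloid e_t = sum over sigma in C_t of sgn(sigma) {sigma t}, as an integer-valued
  function on tabloids (coefficient vector in the permutation module).\<close>
definition polytabloid :: "(nat \<Rightarrow> nat) \<Rightarrow> nat \<Rightarrow> (nat \<times> nat \<Rightarrow> nat) \<Rightarrow> (nat \<Rightarrow> nat) \<Rightarrow> int" where
  "polytabloid lam n t R = (\<Sum>\<sigma>\<in>col_group lam n t. sign \<sigma> * (if tabloid lam n (\<sigma> \<circ> t) = R then 1 else 0))"

definition tabloids :: "(nat \<Rightarrow> nat) \<Rightarrow> nat \<Rightarrow> (nat \<Rightarrow> nat) set" where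
  "tabloids lam n = {tabloid lam n t | t. tableau lam n t}"

definition form :: "(nat \<Rightarrow> nat) \<Rightarrow> nat \<Rightarrow> ((nat \<Rightarrow> nat) \<Rightarrow> int) \<Rightarrow> ((nat \<Rightarrow> nat) \<Rightarrow> int) \<Rightarrow> int" where
  "form lam n f g = (\<Sum>R\<in>tabloids lam n. f R * g R)"

definition schaper_nu :: "nat \<Rightarrow> (nat \<Rightarrow> nat) \<Rightarrow> nat \<Rightarrow> nat" where
  "schaper_nu p lam n = (GREATEST k. \<forall>s t. tableau lam n s \<and> tableau lam n t \<longrightarrow>
      (int p) ^ k dvd form lam n (polytabloid lam n s) (polytabloid lam n t))"

definition triply_2_singular :: "(nat \<Rightarrow> nat) \<Rightarrow> bool" where
  "triply_2_singular lam \<longleftrightarrow> (\<exists>i1 i2 i3. 1 \<le> i1 \<and> i1 + 2 \<le> i2 \<and> i2 + 2 \<le> i3 \<and>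
     lam i1 = lam (i1 + 1) \<and> lam i1 > 0 \<and> lam i2 = lam (i2 + 1) \<and> lam i2 > 0 \<and>
     lam i3 = lam (i3 + 1) \<and> lam i3 > 0)"

end

(* Read a number k as an edge joining its column in s to its column in t. Then <e_s, e_t> is, up to
   sign, the signed number of edge colourings of a bipartite multigraph in which a vertex of degree d
   sees the colours 1, ..., d once each; the colours are the rows of the common tabloids.

   Divisibility. Colours of rows of equal length can be permuted freely without changing the sign,
   which settles (1) and (3). Three almost equal rows give a cubic bipartite graph, whose signed count
   is a contraction of alternating tensors; contracting one vertex after another shows that it is
   divisible by 12 with two vertices on each side, and by 24 with at least three. In (4) all counts
   are multiples of 4, and the remaining parity is that of a number of decompositions of a 4-regular
   graph into two Hamiltonian cycles, which is even by an argument of Thomason.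

   Sharpness. Let row i join column j to column lam i + 1 - j. A weight argument shows that every
   colouring preserves row lengths, so the sum is known exactly; only shapes ending in 2, 2, 1, 1 need
   separate treatment. Doubling a row of length m >= 3 would give m double edges; two such rows are
   rearranged into a single cycle, which is possible exactly when the neighbouring rows are at
   distance at least two. *)

theory Submission
  imports Defs "HOL-Library.FuncSet" "HOL-Library.Multiset"
begin

section \<open>Inversions inside columns as signs of edge colourings\<close>

section \<open>Signs of colourings\<close>

text \<open>In (4) the colours fall into two types, one for each pair of equal rows. A decomposition
  of a 4-regular bipartite graph into two 2-factors with a and b cycles carries 2^(a+b) colourings,
  because the two colours of a type alternate along each cycle in two ways. Modulo 8 only a = b = 1
  survives: this is where the Hamiltonian cycles come from, and why every statement about them is
  phrased as divisibility by 8 of a number of colourings.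

  In the cubic case divisibility by 12 alone would not suffice. Contracting a vertex with three
  distinct neighbours gives a difference of two smaller values, and it gains a factor 2 because two
  vertices on each side give an odd multiple of 12.

  The weight of an edge is the sum of its two column numbers, which is lam i + 1 in row i; joining
  two equal rows into a cycle displaces it by at most one. So a joined pair needs distance two from
  an unjoined row and distance three from another joined pair. Two pairs at distance exactly two are
  the exception (4).\<close>

definition samecol :: "nat set \<Rightarrow> (nat \<Rightarrow> nat) \<Rightarrow> (nat \<times> nat) set" where
  "samecol E A = {(x, y). x \<in> E \<and> y \<in> E \<and> x < y \<and> A x = A y}"

text \<open>The parity of the inversions of \<open>R\<close> within the fibres of \<open>A\<close>.
  For finite \<open>E\<close> it is 1 or -1 if \<open>R\<close> is injective on each fibre, and 0
  otherwise.\<close>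

definition vsgn :: "nat set \<Rightarrow> (nat \<Rightarrow> nat) \<Rightarrow> (nat \<Rightarrow> nat) \<Rightarrow> int" where
  "vsgn E A R = (\<Prod>(x, y)\<in>samecol E A. sgn (int (R y) - int (R x)))"

text \<open>A label \<open>k\<close> is an edge joining the vertices \<open>A k\<close> and \<open>B k\<close>, and \<open>R k\<close> is its colour; \<open>cs j\<close> is the set of
  colours at vertex \<open>j\<close>, that is, of rows meeting column \<open>j\<close>.\<close>

definition colvalid :: "nat set \<Rightarrow> (nat \<Rightarrow> nat set) \<Rightarrow> (nat \<Rightarrow> nat) \<Rightarrow> (nat \<Rightarrow> nat) \<Rightarrow> bool" where
  "colvalid E cs A R \<longleftrightarrow> (\<forall>j. bij_betw R {k \<in> E. A k = j} (cs j))"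

definition colorings :: "nat set \<Rightarrow> (nat \<Rightarrow> nat set) \<Rightarrow> (nat \<Rightarrow> nat) \<Rightarrow> (nat \<Rightarrow> nat) \<Rightarrow> (nat \<Rightarrow> nat) set" where
  "colorings E cs A B = {R. (\<forall>k. k \<notin> E \<longrightarrow> R k = 0) \<and> colvalid E cs A R \<and> colvalid E cs B R}"

definition wt :: "nat set \<Rightarrow> (nat \<Rightarrow> nat) \<Rightarrow> (nat \<Rightarrow> nat) \<Rightarrow> (nat \<Rightarrow> nat) \<Rightarrow> int" where
  "wt E A B R = vsgn E A R * vsgn E B R"

lemma finite_samecol [simp]: "finite E \<Longrightarrow> finite (samecol E A)"
  by (rule finite_subset[of _ "E \<times> E"]) (auto simp: samecol_def)

text \<open>A column-preserving permutation permutes the unordered pairs of edges within columns;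
  \<open>h\<close> is this action with every pair written in increasing order. Reindexing the
  product for \<open>R\<close> along \<open>h\<close> leaves, pair by pair, the cocycle identity for
  inversions.\<close>

lemma vsgn_comp:
  assumes fin: "finite E" and p: "\<sigma> permutes E" and A: "\<forall>x\<in>E. A (\<sigma> x) = A x"
  shows "vsgn E A (R \<circ> \<sigma>) = vsgn E A R * vsgn E A \<sigma>"
proof -
  define h where "h = (\<lambda>(x, y). if \<sigma> x < \<sigma> y then (\<sigma> x, \<sigma> y) else (\<sigma> y, \<sigma> x))"
  have inj: "inj \<sigma>" using p permutes_inj by blast
  have hin: "h ` samecol E A \<subseteq> samecol E A"
  proof clarify
    fix x y u v assume *: "(x, y) \<in> samecol E A" "(u, v) = h (x, y)"
    then have "\<sigma> x \<noteq> \<sigma> y" "\<sigma> x \<in> E" "\<sigma> y \<in> E" "A (\<sigma> x) = A (\<sigma> y)"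
      using A permutes_in_image[OF p] by (auto simp: samecol_def inj_eq[OF inj])
    then show "(u, v) \<in> samecol E A" using *(2) by (auto simp: h_def samecol_def split: if_splits)
  qed
  have hinj: "inj_on h (samecol E A)"
  proof (rule inj_onI, clarify)
    fix x y x' y' assume *: "(x, y) \<in> samecol E A" "(x', y') \<in> samecol E A" "h (x, y) = h (x', y')"
    from *(3) have "\<sigma> x = \<sigma> x' \<and> \<sigma> y = \<sigma> y' \<or> \<sigma> x = \<sigma> y' \<and> \<sigma> y = \<sigma> x'"
      unfolding h_def prod.case by (metis prod.inject)
    then have "x = x' \<and> y = y' \<or> x = y' \<and> y = x'" using inj by (metis injD)
    then show "x = x' \<and> y = y'" using *(1,2) by (auto simp: samecol_def)
  qed
  have bij: "bij_betw h (samecol E A) (samecol E A)"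
    using endo_inj_surj[OF finite_samecol[OF fin] hin hinj] hinj by (simp add: bij_betw_def)
  have "vsgn E A R = (\<Prod>p\<in>samecol E A. (\<lambda>(x, y). sgn (int (R y) - int (R x))) (h p))"
    unfolding vsgn_def by (rule prod.reindex_bij_betw[OF bij, symmetric])
  then have "vsgn E A R * vsgn E A \<sigma> = (\<Prod>p\<in>samecol E A.
      (\<lambda>(x, y). sgn (int (R y) - int (R x))) (h p) * (\<lambda>(x, y). sgn (int (\<sigma> y) - int (\<sigma> x))) p)"
    by (simp add: vsgn_def prod.distrib)
  also have "\<dots> = vsgn E A (R \<circ> \<sigma>)"
    unfolding vsgn_def
  proof (rule prod.cong[OF refl], clarify)
    fix x y assume "(x, y) \<in> samecol E A"
    then have "\<sigma> x \<noteq> \<sigma> y" using inj by (auto simp: samecol_def inj_eq)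
    then show "(case h (x, y) of (x, y) \<Rightarrow> sgn (int (R y) - int (R x))) * sgn (int (\<sigma> y) - int (\<sigma> x))
       = sgn (int ((R \<circ> \<sigma>) y) - int ((R \<circ> \<sigma>) x))"
      by (auto simp: h_def sgn_if)
  qed
  finally show ?thesis by simp
qed

lemma vsgn_id: "vsgn E A id = 1"
  unfolding vsgn_def by (rule prod.neutral) (auto simp: samecol_def)

text \<open>The inverted pairs are (a, b) and, for each x of the column strictly between them, both
  (a, x) and (x, b); their number is odd.\<close>

lemma vsgn_transpose_less:
  assumes fin: "finite E" and "a \<in> E" "b \<in> E" "a < b" "A a = A b"
  shows "vsgn E A (transpose a b) = -1"
proof -
  define M where "M = {x \<in> E. a < x \<and> x < b \<and> A x = A a}"
  define f :: "nat \<times> nat \<Rightarrow> int"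
    where "f = (\<lambda>(x, y). sgn (int (transpose a b y) - int (transpose a b x)))"
  have finM: "finite M" using fin by (simp add: M_def)
  define S1 where "S1 = Pair a ` M"
  define S2 where "S2 = (\<lambda>x. (x, b)) ` M"
  have sub: "{(a, b)} \<union> (S1 \<union> S2) \<subseteq> samecol E A"
    using assms by (auto simp: samecol_def M_def S1_def S2_def)
  have "vsgn E A (transpose a b) = prod f (samecol E A)" by (simp add: vsgn_def f_def)
  also have "\<dots> = prod f ({(a, b)} \<union> (S1 \<union> S2))"
  proof (rule prod.mono_neutral_right[OF finite_samecol[OF fin] sub], rule ballI)
    fix p assume p: "p \<in> samecol E A - ({(a, b)} \<union> (S1 \<union> S2))"
    obtain x y where xy: "p = (x, y)" by fastforce
    have *: "(x, y) \<in> samecol E A" "(x, y) \<notin> {(a, b)} \<union> (S1 \<union> S2)" using p xy by auto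
    have "transpose a b x < transpose a b y"
      using * assms(4,5) by (auto simp: samecol_def M_def S1_def S2_def transpose_def split: if_splits)
    then show "f p = 1" by (simp add: f_def xy)
  qed
  also have "\<dots> = prod f {(a, b)} * (prod f S1 * prod f S2)"
  proof -
    have "finite S1" "finite S2" "S1 \<inter> S2 = {}" "(a, b) \<notin> S1 \<union> S2"
      using finM by (auto simp: S1_def S2_def M_def)
    then show ?thesis by (simp add: prod.union_disjoint)
  qed
  also have "prod f S1 = (-1) ^ card M"
  proof -
    have "prod f S1 = (\<Prod>x\<in>M. f (a, x))" by (simp add: S1_def prod.reindex inj_on_def)
    also have "\<dots> = (\<Prod>x\<in>M. -1)"
      using assms(4) by (intro prod.cong) (auto simp: f_def M_def transpose_def)
    finally show ?thesis by simp
  qed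
  also have "prod f S2 = (-1) ^ card M"
  proof -
    have "prod f S2 = (\<Prod>x\<in>M. f (x, b))" by (simp add: S2_def prod.reindex inj_on_def)
    also have "\<dots> = (\<Prod>x\<in>M. -1)"
      using assms(4) by (intro prod.cong) (auto simp: f_def M_def transpose_def)
    finally show ?thesis by simp
  qed
  also have "prod f {(a, b)} = -1" using assms(4) by (simp add: f_def)
  finally show ?thesis by (simp add: power_mult_distrib[symmetric])
qed

lemma vsgn_transpose:
  assumes "finite E" and "a \<in> E" "b \<in> E" "a \<noteq> b" "A a = A b"
  shows "vsgn E A (transpose a b) = -1"
  using vsgn_transpose_less[of E a b A] vsgn_transpose_less[of E b a A] assms
  by (metis nat_neq_iff transpose_commute)

text \<open>Only inversions inside columns are counted, yet the full sign comes out: composing with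
  the transposition of a and \<sigma> a, which stays inside a column, lowers the number of moved
  points and negates both sides.\<close>

lemma vsgn_sign:
  assumes fin: "finite E" and "\<sigma> permutes E" and "\<forall>x\<in>E. A (\<sigma> x) = A x"
  shows "vsgn E A \<sigma> = sign \<sigma>"
  using assms(2,3)
proof (induction "card {x \<in> E. \<sigma> x \<noteq> x}" arbitrary: \<sigma> rule: less_induct)
  case less
  show ?case
  proof (cases "\<exists>a \<in> E. \<sigma> a \<noteq> a")
    case False
    then have "\<sigma> = id" using less.prems(1) by (auto simp: permutes_def fun_eq_iff)
    then show ?thesis by (simp add: vsgn_id sign_id)
  next
    case True
    then obtain a where a: "a \<in> E" "\<sigma> a \<noteq> a" by blast
    define T where "T = transpose a (\<sigma> a)"
    define s where "s = T \<circ> \<sigma>"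
    have inj: "inj \<sigma>" using less.prems(1) permutes_inj by blast
    have sa: "\<sigma> a \<in> E" using a permutes_in_image[OF less.prems(1)] by blast
    have Tp: "T permutes E" unfolding T_def using a sa by (rule_tac permutes_swap_id)
    have sp: "s permutes E" unfolding s_def using less.prems(1) Tp by (rule permutes_compose)
    have TA: "A (T x) = A x" if "x \<in> E" for x
      using less.prems(2) a(1) by (auto simp: T_def transpose_def)
    have sA: "\<forall>x\<in>E. A (s x) = A x"
      using TA less.prems(2) permutes_in_image[OF less.prems(1)] by (auto simp: s_def)
    have "{x \<in> E. s x \<noteq> x} \<subset> {x \<in> E. \<sigma> x \<noteq> x}"
    proof
      show "{x \<in> E. s x \<noteq> x} \<subseteq> {x \<in> E. \<sigma> x \<noteq> x}"
        using inj by (auto simp: s_def T_def transpose_def inj_eq split: if_splits)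
      show "{x \<in> E. s x \<noteq> x} \<noteq> {x \<in> E. \<sigma> x \<noteq> x}"
      proof
        assume "{x \<in> E. s x \<noteq> x} = {x \<in> E. \<sigma> x \<noteq> x}"
        moreover have "s a = a" by (simp add: s_def T_def)
        ultimately show False using a by blast
      qed
    qed
    then have "card {x \<in> E. s x \<noteq> x} < card {x \<in> E. \<sigma> x \<noteq> x}"
      using fin by (intro psubset_card_mono) auto
    from less.hyps[OF this sp sA] have IH: "vsgn E A s = sign s" by simp
    have eq: "\<sigma> = T \<circ> s" by (simp add: s_def T_def fun_eq_iff)
    have "vsgn E A \<sigma> = vsgn E A T * vsgn E A s"
      by (subst eq, rule vsgn_comp[OF fin sp sA])
    also have "vsgn E A T = -1" unfolding T_def
      using vsgn_transpose[OF fin a(1) sa] a less.prems(2) by metis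
    also have "sign \<sigma> = sign T * sign s"
      by (subst eq, rule sign_compose) (use fin sp Tp in \<open>auto simp: permutation_permutes\<close>)
    ultimately show ?thesis using IH a(2) by (simp add: T_def sign_swap_id)
  qed
qed

lemma vsgn_permute:
  assumes "finite E" and "\<sigma> permutes E" and "\<forall>x\<in>E. A (\<sigma> x) = A x"
  shows "vsgn E A (R \<circ> \<sigma>) = sign \<sigma> * vsgn E A R"
  using vsgn_comp[OF assms] vsgn_sign[OF assms] by simp

lemma colvalid_inj: "colvalid E cs A R \<Longrightarrow> x \<in> E \<Longrightarrow> y \<in> E \<Longrightarrow> A x = A y \<Longrightarrow> R x = R y \<Longrightarrow> x = y"
  unfolding colvalid_def bij_betw_def inj_on_def by blast

lemma colvalid_in: "colvalid E cs A R \<Longrightarrow> x \<in> E \<Longrightarrow> R x \<in> cs (A x)"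
  unfolding colvalid_def bij_betw_def by blast

lemma colvalid_ex: "colvalid E cs A R \<Longrightarrow> i \<in> cs j \<Longrightarrow> \<exists>x\<in>E. A x = j \<and> R x = i"
proof -
  assume "colvalid E cs A R" "i \<in> cs j"
  then have "i \<in> R ` {k \<in> E. A k = j}" by (simp add: colvalid_def bij_betw_def)
  then show ?thesis by auto
qed

lemma vsgn_square:
  assumes "finite E" "colvalid E cs A R" shows "vsgn E A R * vsgn E A R = 1"
  unfolding vsgn_def prod.distrib[symmetric]
proof (rule prod.neutral, clarify)
  fix x y assume "(x, y) \<in> samecol E A"
  then have "R x \<noteq> R y" using colvalid_inj[OF assms(2), of x y] by (auto simp: samecol_def)
  then show "sgn (int (R y) - int (R x)) * sgn (int (R y) - int (R x)) = 1" by (simp add: sgn_if)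
qed

text \<open>Naming a pair of edges in a column by its two colours turns the product over edges into
  a product over colours. The result depends on \<open>p\<close> and \<open>cs\<close> only, hence
  is the same for the two sides of the graph.\<close>

lemma vsgn_color:
  assumes fin: "finite E" and v: "colvalid E cs A R"
  shows "vsgn E A (p \<circ> R) * vsgn E A R =
    (\<Prod>(j, i1, i2)\<in>{(j, i1, i2). i1 \<in> cs j \<and> i2 \<in> cs j \<and> i1 < i2}. sgn (int (p i2) - int (p i1)))"
proof -
  let ?T = "{(j, i1, i2). i1 \<in> cs j \<and> i2 \<in> cs j \<and> i1 < i2}"
  define h where "h = (\<lambda>(x, y). (A x, min (R x) (R y), max (R x) (R y)))"
  have ne: "R x \<noteq> R y" if "(x, y) \<in> samecol E A" for x y
    using that colvalid_inj[OF v, of x y] by (auto simp: samecol_def)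
  have bij: "bij_betw h (samecol E A) ?T"
    unfolding bij_betw_def
  proof
    show "inj_on h (samecol E A)"
    proof (rule inj_onI, clarify)
      fix x y x' y' assume *: "(x, y) \<in> samecol E A" "(x', y') \<in> samecol E A" "h (x, y) = h (x', y')"
      then have "A x = A x'" "R x = R x' \<and> R y = R y' \<or> R x = R y' \<and> R y = R x'"
        by (auto simp: h_def min_def max_def split: if_splits)
      moreover have "x \<in> E" "y \<in> E" "x' \<in> E" "y' \<in> E" "x < y" "x' < y'" "A x = A y" "A x' = A y'"
        using * by (simp_all add: samecol_def)
      ultimately show "x = x' \<and> y = y'"
        using colvalid_inj[OF v, of x x'] colvalid_inj[OF v, of y y'] colvalid_inj[OF v, of x y'] colvalid_inj[OF v, of y x']
        by auto
    qed
    show "h ` samecol E A = ?T"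
    proof
      show "h ` samecol E A \<subseteq> ?T"
      proof clarify
        fix x y j i1 i2 assume *: "(x, y) \<in> samecol E A" "(j, i1, i2) = h (x, y)"
        then have "R x \<in> cs j" "R y \<in> cs j" using colvalid_in[OF v, of x] colvalid_in[OF v, of y]
          by (auto simp: samecol_def h_def)
        then show "i1 \<in> cs j \<and> i2 \<in> cs j \<and> i1 < i2" using * ne[OF *(1)]
          by (auto simp: h_def min_def max_def split: if_splits)
      qed
      show "?T \<subseteq> h ` samecol E A"
      proof clarify
        fix j i1 i2 assume *: "i1 \<in> cs j" "i2 \<in> cs j" "i1 < i2"
        obtain x y where xy: "x \<in> E" "A x = j" "R x = i1" "y \<in> E" "A y = j" "R y = i2"
          using colvalid_ex[OF v *(1)] colvalid_ex[OF v *(2)] by blast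
        then have "x \<noteq> y" using * by auto
        then have "(min x y, max x y) \<in> samecol E A" "h (min x y, max x y) = (j, i1, i2)"
          using xy * by (auto simp: samecol_def h_def min_def max_def)
        then show "(j, i1, i2) \<in> h ` samecol E A" by (metis imageI)
      qed
    qed
  qed
  have "(\<Prod>(j, i1, i2)\<in>?T. sgn (int (p i2) - int (p i1)))
      = (\<Prod>q\<in>samecol E A. (\<lambda>(j, i1, i2). sgn (int (p i2) - int (p i1))) (h q))"
    by (rule prod.reindex_bij_betw[OF bij, symmetric])
  also have "\<dots> = vsgn E A (p \<circ> R) * vsgn E A R"
    unfolding vsgn_def prod.distrib[symmetric]
  proof (rule prod.cong[OF refl], clarify)
    fix x y assume "(x, y) \<in> samecol E A"
    from ne[OF this] show "(case h (x, y) of (j, i1, i2) \<Rightarrow> sgn (int (p i2) - int (p i1)))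
       = sgn (int ((p \<circ> R) y) - int ((p \<circ> R) x)) * sgn (int (R y) - int (R x))"
      by (auto simp: h_def min_def max_def sgn_if)
  qed
  finally show ?thesis by simp
qed

lemma colvalid_recolor:
  assumes v: "colvalid E cs A R" and inj: "inj p" and p: "\<And>j. p ` cs j = cs j"
  shows "colvalid E cs A (p \<circ> R)"
  unfolding colvalid_def
proof
  fix j
  have "bij_betw p (cs j) (cs j)" using p inj by (auto simp: bij_betw_def intro: inj_on_subset)
  then show "bij_betw (p \<circ> R) {k \<in> E. A k = j} (cs j)"
    using v unfolding colvalid_def by (blast intro: bij_betw_trans)
qed

text \<open>Both sides have the same colour sets, so by \<open>vsgn_color\<close> recolouring
  multiplies the two factors of the weight by the same sign.\<close>

lemma wt_recolor:
  assumes fin: "finite E" and A: "colvalid E cs A R" and B: "colvalid E cs B R"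
    and inj: "inj p" and p: "\<And>j. p ` cs j = cs j"
  shows "wt E A B (p \<circ> R) = wt E A B R"
proof -
  note 1 = vsgn_color[OF fin A, of p] and 2 = vsgn_color[OF fin B, of p]
  note sq = vsgn_square[OF fin A] vsgn_square[OF fin B]
    vsgn_square[OF fin colvalid_recolor[OF A inj p]]  vsgn_square[OF fin colvalid_recolor[OF B inj p]]
  have pm: "a = 1 \<or> a = -1" if "a * a = 1" for a :: int using that by (metis zmult_eq_1_iff)
  have "vsgn E A (p \<circ> R) * vsgn E A R = vsgn E B (p \<circ> R) * vsgn E B R" using 1 2 by simp
  then show ?thesis unfolding wt_def
    using pm[OF sq(1)] pm[OF sq(2)] pm[OF sq(3)] pm[OF sq(4)] by auto
qed

lemma wt_pm: "finite E \<Longrightarrow> colvalid E cs A R \<Longrightarrow> colvalid E cs B R \<Longrightarrow> wt E A B R = 1 \<or> wt E A B R = -1"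
proof -
  assume "finite E" "colvalid E cs A R" "colvalid E cs B R"
  then have "wt E A B R * wt E A B R = 1"
    using vsgn_square[of E cs A R] vsgn_square[of E cs B R] unfolding wt_def
    by (simp add: mult.assoc mult.left_commute)
  then show ?thesis by (simp add: zmult_eq_1_iff)
qed

text \<open>A permutation of parallel edges contributes its sign once for each side.\<close>

lemma wt_relabel:
  assumes fin: "finite E" and p: "\<sigma> permutes E" and A: "\<forall>x\<in>E. A (\<sigma> x) = A x"
    and B: "\<forall>x\<in>E. B (\<sigma> x) = B x"
  shows "wt E A B (R \<circ> \<sigma>) = wt E A B R"
proof -
  have "sign \<sigma> * sign \<sigma> = (1::int)" using sign_cases[of \<sigma>] by auto
  then show ?thesis
    using vsgn_permute[OF fin p A, of R] vsgn_permute[OF fin p B, of R]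
    unfolding wt_def by (metis (no_types, opaque_lifting) mult.assoc mult.commute mult_1)
qed

section \<open>The bilinear form on polytabloids as a signed count of colourings\<close>

section \<open>Polytabloids and colourings\<close>

definition cset :: "(nat \<Rightarrow> nat) \<Rightarrow> nat \<Rightarrow> nat set" where
  "cset lam j = {i. (i, j) \<in> young lam}"

lemma finite_young: assumes "is_partition n lam" shows "finite (young lam)"
proof -
  obtain N where N: "\<forall>i>N. lam i = 0" using assms by (auto simp: is_partition_def)
  have "lam i \<le> lam 1" if "1 \<le> i" for i
    using that by (induction i rule: dec_induct) (use assms in \<open>auto simp: is_partition_def intro: le_trans\<close>)
  moreover have "i \<le> N" if "1 \<le> j" "j \<le> lam i" for i j
    using N that by (metis le_zero_eq linorder_not_le not_one_le_zero)
  ultimately have "young lam \<subseteq> {..N} \<times> {..lam 1}"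
    by (auto simp: young_def intro: order_trans)
  then show ?thesis using finite_subset by blast
qed

lemma tabloid_outside: "k \<notin> {1..n} \<Longrightarrow> tabloid lam n t k = 0"
  by (simp only: tabloid_def if_False)

context
  fixes n :: nat and lam :: "nat \<Rightarrow> nat" and t :: "nat \<times> nat \<Rightarrow> nat"
  assumes t: "tableau lam n t"
begin

lemma tab_inj: "a \<in> young lam \<Longrightarrow> b \<in> young lam \<Longrightarrow> t a = t b \<Longrightarrow> a = b"
  using t by (auto simp: tableau_def bij_betw_def inj_on_def)

lemma tab_in: "a \<in> young lam \<Longrightarrow> t a \<in> {1..n}"
  using t by (auto simp: tableau_def bij_betw_def)

lemma tab_ex: "k \<in> {1..n} \<Longrightarrow> \<exists>i j. (i, j) \<in> young lam \<and> t (i, j) = k"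
  using t unfolding tableau_def bij_betw_def by (metis imageE surj_pair)

lemma col_of_tab: "(i, j) \<in> young lam \<Longrightarrow> col_of lam t (t (i, j)) = j"
  unfolding col_of_def by (rule the_equality) (auto dest: tab_inj)

lemma tabloid_tab: "(i, j) \<in> young lam \<Longrightarrow> tabloid lam n t (t (i, j)) = i"
proof -
  assume *: "(i, j) \<in> young lam"
  have "(THE i'. \<exists>j'. (i', j') \<in> young lam \<and> t (i', j') = t (i, j)) = i"
    using * by (intro the_equality) (auto dest: tab_inj[OF _ *])
  then show ?thesis using tab_in[OF *] by (simp add: tabloid_def)
qed

lemma tableau_permute: "\<sigma> permutes {1..n} \<Longrightarrow> tableau lam n (\<sigma> \<circ> t)"
  using t unfolding tableau_def by (blast intro: bij_betw_trans permutes_imp_bij)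

end

lemma col_group_tab:
  assumes t: "tableau lam n t" and s: "\<sigma> \<in> col_group lam n t" and "(i, j) \<in> young lam"
  shows "tabloid lam n (\<sigma> \<circ> t) (\<sigma> (t (i, j))) = i" "col_of lam t (\<sigma> (t (i, j))) = j"
    "\<sigma> (t (i, j)) \<in> {1..n}"
proof -
  have p: "\<sigma> permutes {1..n}" and c: "\<forall>k\<in>{1..n}. col_of lam t (\<sigma> k) = col_of lam t k"
    using s by (auto simp: col_group_def)
  show "tabloid lam n (\<sigma> \<circ> t) (\<sigma> (t (i, j))) = i"
    using tabloid_tab[OF tableau_permute[OF t p] assms(3)] by simp
  show "col_of lam t (\<sigma> (t (i, j))) = j"
    using c tab_in[OF t assms(3)] col_of_tab[OF t assms(3)] by simp
  show "\<sigma> (t (i, j)) \<in> {1..n}"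
    using permutes_in_image[OF p] tab_in[OF t assms(3)] by simp
qed

lemma tabloid_valid:
  assumes t: "tableau lam n t" and s: "\<sigma> \<in> col_group lam n t"
  shows "colvalid {1..n} (cset lam) (col_of lam t) (tabloid lam n (\<sigma> \<circ> t))"
  unfolding colvalid_def
proof
  fix j
  have p: "\<sigma> permutes {1..n}" using s by (auto simp: col_group_def)
  have *: "\<exists>i. (i, j) \<in> young lam \<and> k = \<sigma> (t (i, j))" if kn: "k \<in> {1..n}" and kj: "col_of lam t k = j" for k
  proof -
    obtain i j' where ij: "(i, j') \<in> young lam" "k = \<sigma> (t (i, j'))"
      using tab_ex[OF tableau_permute[OF t p] kn] by auto
    then show ?thesis using col_group_tab(2)[OF t s ij(1)] kj by auto
  qed
  show "bij_betw (tabloid lam n (\<sigma> \<circ> t)) {k \<in> {1..n}. col_of lam t k = j} (cset lam j)"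
    by (rule bij_betw_byWitness[where f' = "\<lambda>i. \<sigma> (t (i, j))"])
      (use * col_group_tab[OF t s] in \<open>fastforce simp: cset_def\<close>)+
qed

text \<open>A colouring of the columns of \<open>t\<close> assigns a label to every box: column and
  colour are its coordinates. This is a tableau \<open>u\<close> with the same column sets as
  \<open>t\<close>, and the column permutation carrying \<open>t\<close> to \<open>u\<close> is the
  only one with tabloid \<open>R\<close>. Tabloids vanish off {1..n}, so colourings have to as
  well.\<close>

lemma valid_tabloid:
  assumes t: "tableau lam n t" and R: "colvalid {1..n} (cset lam) (col_of lam t) R"
    and R0: "\<forall>k. k \<notin> {1..n} \<longrightarrow> R k = 0"
  obtains \<sigma> where "\<sigma> \<in> col_group lam n t" "\<And>\<tau>. \<tau> \<in> col_group lam n t \<Longrightarrow> tabloid lam n (\<tau> \<circ> t) = R \<longleftrightarrow> \<tau> = \<sigma>"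
proof -
  have "\<exists>x. x \<in> {1..n} \<and> col_of lam t x = snd b \<and> R x = fst b" if "b \<in> young lam" for b
    using colvalid_ex[OF R, of "fst b" "snd b"] that by (auto simp: cset_def)
  then obtain u where u: "\<And>b. b \<in> young lam \<Longrightarrow> u b \<in> {1..n} \<and> col_of lam t (u b) = snd b \<and> R (u b) = fst b"
    by metis
  have uu: "u b = x" if "b \<in> young lam" "x \<in> {1..n}" "col_of lam t x = snd b" "R x = fst b" for b x
    using u[OF that(1)] colvalid_inj[OF R] that by metis
  have ub: "tableau lam n u"
    unfolding tableau_def bij_betw_def
  proof
    show "inj_on u (young lam)" using u by (metis inj_onI prod.expand)
    show "u ` young lam = {1..n}"
    proof
      show "u ` young lam \<subseteq> {1..n}" using u by blast
      show "{1..n} \<subseteq> u ` young lam"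
      proof
        fix x assume x: "x \<in> {1..n}"
        have "(R x, col_of lam t x) \<in> young lam"
          using colvalid_in[OF R x] by (simp add: cset_def)
        from uu[OF this x] this show "x \<in> u ` young lam" by (metis fst_conv imageI snd_conv)
      qed
    qed
  qed
  define \<sigma> where "\<sigma> = (\<lambda>k. if k \<in> {1..n} then u (inv_into (young lam) t k) else k)"
  have st: "\<sigma> (t b) = u b" if "b \<in> young lam" for b
    using that t tab_in[OF t that] by (simp add: \<sigma>_def tableau_def bij_betw_def)
  have bt: "bij_betw (inv_into (young lam) t) {1..n} (young lam)"
    using t unfolding tableau_def by (rule bij_betw_inv_into)
  have "bij_betw (u \<circ> inv_into (young lam) t) {1..n} {1..n}"
    using bt ub unfolding tableau_def by (rule bij_betw_trans)
  then have "bij_betw \<sigma> {1..n} {1..n}"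
    by (rule bij_betw_cong[THEN iffD1, rotated]) (simp add: \<sigma>_def)
  then have p: "\<sigma> permutes {1..n}" by (rule bij_imp_permutes) (auto simp: \<sigma>_def)
  have cg: "\<sigma> \<in> col_group lam n t"
    unfolding col_group_def
  proof (intro CollectI conjI p ballI)
    fix k assume "k \<in> {1..n}"
    then obtain i j where "(i, j) \<in> young lam" "t (i, j) = k" using tab_ex[OF t] by blast
    then show "col_of lam t (\<sigma> k) = col_of lam t k" using st u col_of_tab[OF t] by fastforce
  qed
  have "tabloid lam n (\<tau> \<circ> t) = R \<longleftrightarrow> \<tau> = \<sigma>" if tau: "\<tau> \<in> col_group lam n t" for \<tau>
  proof
    assume *: "tabloid lam n (\<tau> \<circ> t) = R"
    have tp: "\<tau> permutes {1..n}" using tau by (auto simp: col_group_def)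
    show "\<tau> = \<sigma>"
    proof
      fix k show "\<tau> k = \<sigma> k"
      proof (cases "k \<in> {1..n}")
        case False then show ?thesis using tp p by (simp add: permutes_def)
      next
        case True
        then obtain i j where ij: "(i, j) \<in> young lam" "t (i, j) = k" using tab_ex[OF t] by blast
        then show ?thesis using uu[OF ij(1), of "\<tau> k"] col_group_tab[OF t tau ij(1)] * st[OF ij(1)] by simp
      qed
    qed
  next
    assume eq: "\<tau> = \<sigma>"
    show "tabloid lam n (\<tau> \<circ> t) = R"
    proof
      fix k show "tabloid lam n (\<tau> \<circ> t) k = R k"
      proof (cases "k \<in> {1..n}")
        case False then show ?thesis using R0 tabloid_outside by metis
      next
        case True
        then obtain i j where ij: "(i, j) \<in> young lam" "u (i, j) = k" using tab_ex[OF ub] by blast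
        then show ?thesis using col_group_tab(1)[OF t cg ij(1)] st[OF ij(1)] u[OF ij(1)] eq by auto
      qed
    qed
  qed
  with cg show thesis using that by blast
qed

lemma finite_col_group: "finite (col_group lam n t)"
  by (rule finite_subset[OF _ finite_permutations[of "{1..n}"]]) (auto simp: col_group_def)

lemma tabloid_id_valid:
  assumes "tableau lam n t"
  shows "colvalid {1..n} (cset lam) (col_of lam t) (tabloid lam n t)"
  using tabloid_valid[OF assms, of id] by (simp add: col_group_def permutes_id)

text \<open>At most one \<sigma> contributes to a coefficient. For it,
  \<open>R \<circ> \<sigma>\<close> is the tabloid of \<open>t\<close>, so
  \<open>vsgn_permute\<close> expresses sign \<sigma> by the column signs of \<open>R\<close> and of
  that tabloid; the latter is a constant of \<open>t\<close>.\<close>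

lemma polytabloid_eq:
  assumes t: "tableau lam n t"
  shows "polytabloid lam n t R =
    (if (\<forall>k. k \<notin> {1..n} \<longrightarrow> R k = 0) \<and> colvalid {1..n} (cset lam) (col_of lam t) R
     then vsgn {1..n} (col_of lam t) (tabloid lam n t) * vsgn {1..n} (col_of lam t) R else 0)"
proof (cases "(\<forall>k. k \<notin> {1..n} \<longrightarrow> R k = 0) \<and> colvalid {1..n} (cset lam) (col_of lam t) R")
  case False
  have "tabloid lam n (\<sigma> \<circ> t) \<noteq> R" if "\<sigma> \<in> col_group lam n t" for \<sigma>
    using False tabloid_valid[OF t that] by (auto simp: tabloid_def)
  then have "polytabloid lam n t R = 0" unfolding polytabloid_def by (intro sum.neutral) auto
  then show ?thesis using False by (simp only: if_False)
next
  case True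
  then obtain \<sigma> where s: "\<sigma> \<in> col_group lam n t"
    "\<And>\<tau>. \<tau> \<in> col_group lam n t \<Longrightarrow> tabloid lam n (\<tau> \<circ> t) = R \<longleftrightarrow> \<tau> = \<sigma>"
    using valid_tabloid[OF t] by metis
  have p: "\<sigma> permutes {1..n}" and c: "\<forall>k\<in>{1..n}. col_of lam t (\<sigma> k) = col_of lam t k"
    using s(1) by (auto simp: col_group_def)
  have "polytabloid lam n t R = (\<Sum>\<tau>\<in>col_group lam n t. if \<tau> = \<sigma> then sign \<tau> else 0)"
    unfolding polytabloid_def by (rule sum.cong) (auto simp: s(2))
  also have "\<dots> = sign \<sigma>" using s(1) finite_col_group by (simp add: sum.delta)
  finally have 1: "polytabloid lam n t R = sign \<sigma>" .
  have "R \<circ> \<sigma> = tabloid lam n t"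
  proof
    fix k show "(R \<circ> \<sigma>) k = tabloid lam n t k"
    proof (cases "k \<in> {1..n}")
      case False
      then show ?thesis using permutes_not_in[OF p False] True tabloid_outside by (metis comp_apply)
    next
      case True
      then obtain i j where ij: "(i, j) \<in> young lam" "t (i, j) = k" using tab_ex[OF t] by blast
      then show ?thesis using col_group_tab(1)[OF t s(1) ij(1)] s tabloid_tab[OF t ij(1)] by auto
    qed
  qed
  then have 2: "vsgn {1..n} (col_of lam t) (tabloid lam n t) = sign \<sigma> * vsgn {1..n} (col_of lam t) R"
    using vsgn_permute[OF _ p c, of R] by simp
  have sq: "vsgn {1..n} (col_of lam t) R * vsgn {1..n} (col_of lam t) R = 1"
    using True by (intro vsgn_square) auto
  show ?thesis using True 1 2 sq by (simp add: mult.assoc)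
qed

lemma colorings_subset_tabloids:
  assumes t: "tableau lam n t"
  shows "colorings {1..n} (cset lam) (col_of lam t) B \<subseteq> tabloids lam n"
proof
  fix R assume "R \<in> colorings {1..n} (cset lam) (col_of lam t) B"
  then have R: "colvalid {1..n} (cset lam) (col_of lam t) R" "\<forall>k. k \<notin> {1..n} \<longrightarrow> R k = 0"
    by (auto simp: colorings_def)
  obtain \<sigma> where s: "\<sigma> \<in> col_group lam n t" "tabloid lam n (\<sigma> \<circ> t) = R"
    using valid_tabloid[OF t R] by metis
  then have "tableau lam n (\<sigma> \<circ> t)" using tableau_permute[OF t] by (auto simp: col_group_def)
  then show "R \<in> tabloids lam n" using s(2) by (auto simp: tabloids_def)
qed

lemma finite_tabloids: assumes "finite (young lam)" shows "finite (tabloids lam n)"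
proof (rule finite_subset)
  show "tabloids lam n \<subseteq> {f. \<forall>x. (x \<in> {1..n} \<longrightarrow> f x \<in> fst ` young lam) \<and> (x \<notin> {1..n} \<longrightarrow> f x = 0)}"
  proof
    fix R assume "R \<in> tabloids lam n"
    then obtain t where t: "tableau lam n t" "R = tabloid lam n t" by (auto simp: tabloids_def)
    have "R x \<in> fst ` young lam" if "x \<in> {1..n}" for x
      using tab_ex[OF t(1) that] tabloid_tab[OF t(1)] t(2) by (metis fst_conv image_eqI)
    then show "R \<in> {f. \<forall>x. (x \<in> {1..n} \<longrightarrow> f x \<in> fst ` young lam) \<and> (x \<notin> {1..n} \<longrightarrow> f x = 0)}"
      using t by (auto simp: tabloid_def)
  qed
  show "finite {f. \<forall>x. (x \<in> {1..n} \<longrightarrow> f x \<in> fst ` young lam) \<and> (x \<notin> {1..n} \<longrightarrow> f x = (0::nat))}"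
    using assms by (intro finite_set_of_finite_funs) auto
qed

lemma form_eq:
  assumes fin: "finite (young lam)" and s: "tableau lam n s" and t: "tableau lam n t"
  shows "form lam n (polytabloid lam n s) (polytabloid lam n t) =
    vsgn {1..n} (col_of lam s) (tabloid lam n s) * vsgn {1..n} (col_of lam t) (tabloid lam n t) *
    (\<Sum>R\<in>colorings {1..n} (cset lam) (col_of lam s) (col_of lam t). wt {1..n} (col_of lam s) (col_of lam t) R)"
proof -
  let ?X = "colorings {1..n} (cset lam) (col_of lam s) (col_of lam t)"
  let ?k = "vsgn {1..n} (col_of lam s) (tabloid lam n s) * vsgn {1..n} (col_of lam t) (tabloid lam n t)"
  have "form lam n (polytabloid lam n s) (polytabloid lam n t)
      = (\<Sum>R\<in>?X. polytabloid lam n s R * polytabloid lam n t R)"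
    unfolding form_def
  proof (rule sum.mono_neutral_right[OF finite_tabloids[OF fin] colorings_subset_tabloids[OF s]], rule ballI)
    fix R assume "R \<in> tabloids lam n - ?X"
    then have "R \<notin> ?X" by blast
    then show "polytabloid lam n s R * polytabloid lam n t R = 0"
      unfolding polytabloid_eq[OF s] polytabloid_eq[OF t] colorings_def by auto
  qed
  also have "\<dots> = (\<Sum>R\<in>?X. ?k * wt {1..n} (col_of lam s) (col_of lam t) R)"
    by (rule sum.cong[OF refl]) (simp add: polytabloid_eq[OF s] polytabloid_eq[OF t] colorings_def wt_def)
  finally show ?thesis by (simp add: sum_distrib_left)
qed

lemma form_dvd_iff:
  assumes fin: "finite (young lam)" and s: "tableau lam n s" and t: "tableau lam n t"
  shows "d dvd form lam n (polytabloid lam n s) (polytabloid lam n t) \<longleftrightarrow>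
    d dvd (\<Sum>R\<in>colorings {1..n} (cset lam) (col_of lam s) (col_of lam t). wt {1..n} (col_of lam s) (col_of lam t) R)"
proof -
  have "vsgn {1..n} (col_of lam s) (tabloid lam n s) = 1 \<or> vsgn {1..n} (col_of lam s) (tabloid lam n s) = -1"
    "vsgn {1..n} (col_of lam t) (tabloid lam n t) = 1 \<or> vsgn {1..n} (col_of lam t) (tabloid lam n t) = -1"
    using vsgn_square[OF _ tabloid_id_valid[OF s]] vsgn_square[OF _ tabloid_id_valid[OF t]]
    by (simp_all add: zmult_eq_1_iff)
  then show ?thesis unfolding form_eq[OF assms] by auto
qed

text \<open>\<open>GREATEST\<close> is meaningful because the exponents are bounded: for s = t all
  weights are 1, so the form takes the positive value \<open>card ?X\<close>.\<close>

lemma schaper_ge_iff: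
  assumes part: "is_partition n lam"
  shows "m \<le> schaper_nu 2 lam n \<longleftrightarrow> (\<forall>s t. tableau lam n s \<and> tableau lam n t \<longrightarrow>
    2 ^ m dvd (\<Sum>R\<in>colorings {1..n} (cset lam) (col_of lam s) (col_of lam t). wt {1..n} (col_of lam s) (col_of lam t) R))"
proof -
  note fin = finite_young[OF part]
  define P where "P = (\<lambda>k. \<forall>s t. tableau lam n s \<and> tableau lam n t \<longrightarrow>
      (int 2) ^ k dvd form lam n (polytabloid lam n s) (polytabloid lam n t))"
  have "card (young lam) = n" using part by (simp add: is_partition_def)
  then obtain t where t: "tableau lam n t"
    unfolding tableau_def using finite_same_card_bij[OF fin, of "{1..n}"] by auto
  let ?X = "colorings {1..n} (cset lam) (col_of lam t) (col_of lam t)"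
  have finX: "finite ?X"
    using colorings_subset_tabloids[OF t] finite_tabloids[OF fin] finite_subset by blast
  have "tabloid lam n t \<in> ?X"
    using tabloid_id_valid[OF t] by (auto simp: colorings_def tabloid_def)
  then have pos: "card ?X > 0" using finX card_gt_0_iff by blast
  have "(\<Sum>R\<in>?X. wt {1..n} (col_of lam t) (col_of lam t) R) = (\<Sum>R\<in>?X. 1)"
    by (rule sum.cong) (auto simp: colorings_def wt_def vsgn_square)
  then have cX: "(\<Sum>R\<in>?X. wt {1..n} (col_of lam t) (col_of lam t) R) = int (card ?X)" by simp
  have bound: "k \<le> card ?X" if "P k" for k
  proof -
    have "int 2 ^ k dvd int (card ?X)"
      using that t unfolding P_def form_dvd_iff[OF fin t t, symmetric] cX[symmetric] by blast
    then have "int 2 ^ k \<le> int (card ?X)" using pos by (intro zdvd_imp_le) auto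
    then have "2 ^ k \<le> card ?X" by (metis of_nat_le_iff of_nat_power)
    then show ?thesis using less_exp[of k] by linarith
  qed
  have P0: "P 0" by (simp add: P_def)
  have nu: "schaper_nu 2 lam n = (GREATEST k. P k)" by (simp add: schaper_nu_def P_def)
  have "m \<le> schaper_nu 2 lam n \<longleftrightarrow> P m"
  proof
    assume "P m" then show "m \<le> schaper_nu 2 lam n"
      unfolding nu using bound by (rule Greatest_le_nat)
  next
    assume m: "m \<le> schaper_nu 2 lam n"
    have "P (schaper_nu 2 lam n)" unfolding nu using P0 bound by (rule GreatestI_nat)
    then show "P m" using m unfolding P_def by (meson dvd_trans le_imp_power_dvd)
  qed
  also have "P m \<longleftrightarrow> (\<forall>s t. tableau lam n s \<and> tableau lam n t \<longrightarrow>
    2 ^ m dvd (\<Sum>R\<in>colorings {1..n} (cset lam) (col_of lam s) (col_of lam t). wt {1..n} (col_of lam s) (col_of lam t) R))"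
    unfolding P_def using form_dvd_iff[OF fin] by (metis of_nat_numeral)
  finally show ?thesis .
qed

section \<open>Cubic bipartite networks of sign tensors\<close>

section \<open>Contraction of alternating tensors\<close>

text \<open>The Levi-Civita symbol, written with \<open>sgn\<close> so that it makes sense for
  arbitrary colours and is invariant under shifting them.\<close>

definition eps :: "nat \<Rightarrow> nat \<Rightarrow> nat \<Rightarrow> int" where
  "eps a b c = sgn (int b - int a) * sgn (int c - int a) * sgn (int c - int b)"

lemma eps_swap: "eps b a c = - eps a b c" "eps a c b = - eps a b c"
proof -
  have "sgn (int a - int b) = - sgn (int b - int a)" for a b by (auto simp: sgn_if)
  note s = this[of a b] this[of b c]
  show "eps b a c = - eps a b c" unfolding eps_def s(1) by (simp add: mult_ac)
  show "eps a c b = - eps a b c" unfolding eps_def s(2) by (simp add: mult_ac)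
qed

lemma lessThan3: "{..<3::nat} = {0, 1, 2}" by auto

lemma eps_contract:
  assumes "i < 3" "j < 3" "u < 3" "v < 3"
  shows "(\<Sum>k<3. eps i j k * eps k u v) = (if i = u \<and> j = v then 1 else 0) - (if i = v \<and> j = u then 1 else (0::int))"
proof -
  have "i \<in> {0,1,2}" "j \<in> {0,1,2}" "u \<in> {0,1,2}" "v \<in> {0,1,2}" using assms by auto
  then show ?thesis unfolding lessThan3 by (elim insertE emptyE) (simp_all add: eps_def)
qed

lemma eps_contract2:
  assumes u: "u < 3" and v: "v < 3"
  shows "(\<Sum>i<3. \<Sum>j<3. f i j * (\<Sum>k<3. eps i j k * eps k u v)) = f u v - (f v u :: int)"
proof -
  have "(\<Sum>i<3. \<Sum>j<3. f i j * (\<Sum>k<3. eps i j k * eps k u v)) =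
     (\<Sum>i<3. \<Sum>j<3. (if i = u then if j = v then f i j else 0 else 0) - (if i = v then if j = u then f i j else 0 else 0))"
    using u v by (intro sum.cong refl) (simp add: eps_contract algebra_simps)
  also have "\<dots> = (\<Sum>i<3. (if i = u then f i v else 0) - (if i = v then f i u else 0))"
    using u v by (intro sum.cong refl) (auto simp: sum_subtractf)
  also have "\<dots> = f u v - f v u" using u v by (simp add: sum_subtractf)
  finally show ?thesis .
qed

lemma eps_square: "(\<Sum>i<3. \<Sum>j<3. \<Sum>k<3. eps i j k * eps i j k) = 6"
  unfolding lessThan3 by (simp add: eps_def)

type_synonym triple = "nat \<times> nat \<times> nat"

definition labs :: "triple list \<Rightarrow> nat list" where
  "labs al = concat (map (\<lambda>(x, y, z). [x, y, z]) al)"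

definition wprod :: "triple list \<Rightarrow> (nat \<Rightarrow> nat) \<Rightarrow> int" where
  "wprod al c = prod_list (map (\<lambda>(x, y, z). eps (c x) (c y) (c z)) al)"

text \<open>Full contraction of a bipartite network: the triples are the vertices, and under
  \<open>wff\<close> a label is an edge between the two sides. The sum runs over all maps to three
  colours, since improper ones contribute 0.\<close>

definition ncub :: "triple list \<Rightarrow> triple list \<Rightarrow> int" where
  "ncub al bl = (\<Sum>c\<in>set (labs bl) \<rightarrow>\<^sub>E {..<3}. wprod al c * wprod bl c)"

definition wff :: "triple list \<Rightarrow> triple list \<Rightarrow> bool" where
  "wff al bl \<longleftrightarrow> mset (labs al) = mset (labs bl) \<and> distinct (labs bl)"

lemma labs_simps [simp]: "labs [] = []" "labs ((x, y, z) # al) = x # y # z # labs al" "labs (al @ bl) = labs al @ labs bl"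
  by (simp_all add: labs_def)

lemma wprod_simps [simp]: "wprod [] c = 1" "wprod ((x, y, z) # al) c = eps (c x) (c y) (c z) * wprod al c"
  "wprod (al @ bl) c = wprod al c * wprod bl c"
  by (simp_all add: wprod_def)

lemma length_labs: "length (labs al) = 3 * length al"
  by (induction al) auto

lemma wprod_cong: "(\<And>x. x \<in> set (labs al) \<Longrightarrow> c x = d x) \<Longrightarrow> wprod al c = wprod al d"
  by (induction al) auto

lemma wff_length: "wff al bl \<Longrightarrow> length al = length bl"
  using length_labs[of al] length_labs[of bl] by (metis wff_def mset_eq_length mult_cancel1 zero_neq_numeral)

text \<open>The symbol is alternating, so the triple through a given edge can be brought to the
  front with that edge as its first entry, at the cost of a sign. This is the normal form in which
  the contraction rules apply.\<close>

lemma extract_triple: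
  assumes "x \<in> set (labs al)"
  obtains p q al' \<sigma> where "\<sigma> = 1 \<or> \<sigma> = -1" "\<And>c. wprod al c = \<sigma> * wprod ((x, p, q) # al') c"
    "mset (labs al) = mset (labs ((x, p, q) # al'))"
proof -
  have "\<exists>p q al' \<sigma>. (\<sigma> = 1 \<or> \<sigma> = -1) \<and> (\<forall>c. wprod al c = \<sigma> * wprod ((x, p, q) # al') c) \<and>
    mset (labs al) = mset (labs ((x, p, q) # al'))"
    using assms
  proof (induction al)
    case (Cons t al)
    obtain a b d where t: "t = (a, b, d)" by (cases t)
    consider "x = a" | "x = b" | "x = d" | "x \<in> set (labs al)" using Cons.prems t by auto
    then show ?case
    proof cases
      case 1 then show ?thesis using t by (intro exI[of _ b] exI[of _ d] exI[of _ al] exI[of _ 1]) simp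
    next
      case 2
      have e: "eps (c a) (c b) (c d) = - eps (c b) (c a) (c d)" for c :: "nat \<Rightarrow> nat"
        using eps_swap(1)[of "c b" "c a" "c d"] by linarith
      show ?thesis
        by (rule exI[of _ a], rule exI[of _ d], rule exI[of _ al], rule exI[of _ "-1"], simp add: e t 2 add_mset_commute)
    next
      case 3
      have e: "eps (c a) (c b) (c d) = eps (c d) (c a) (c b)" for c :: "nat \<Rightarrow> nat"
        using eps_swap(1)[of "c d" "c a" "c b"] eps_swap(2)[of "c a" "c d" "c b"] by linarith
      show ?thesis unfolding t 3
        by (rule exI[of _ a], rule exI[of _ b], rule exI[of _ al], rule exI[of _ 1]) (auto simp: add_mset_commute e[symmetric])
    next
      case 4
      then obtain p q al' \<sigma> where *: "\<sigma> = 1 \<or> \<sigma> = -1" "\<forall>c. wprod al c = \<sigma> * wprod ((x, p, q) # al') c"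
        "mset (labs al) = mset (labs ((x, p, q) # al'))" using Cons.IH by blast
      show ?thesis
        by (rule exI[of _ p], rule exI[of _ q], rule exI[of _ "t # al'"], rule exI[of _ \<sigma>]) (use * in \<open>simp add: t algebra_simps\<close>)
    qed
  qed simp
  then show thesis using that by blast
qed

lemma sum_PiE_insert:
  assumes "x \<notin> L"
  shows "(\<Sum>c\<in>insert x L \<rightarrow>\<^sub>E S. f c) = (\<Sum>c\<in>L \<rightarrow>\<^sub>E S. \<Sum>i\<in>S. f (c(x := i)))"
proof -
  have "(\<Sum>c\<in>insert x L \<rightarrow>\<^sub>E S. f c) = (\<Sum>(i, c)\<in>S \<times> (L \<rightarrow>\<^sub>E S). f (c(x := i)))"
    unfolding PiE_insert_eq using inj_combinator[OF assms, of "\<lambda>_. S"]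
    by (subst sum.reindex) (auto simp: case_prod_unfold)
  also have "\<dots> = (\<Sum>i\<in>S. \<Sum>c\<in>L \<rightarrow>\<^sub>E S. f (c(x := i)))" by (simp add: sum.cartesian_product)
  also have "\<dots> = (\<Sum>c\<in>L \<rightarrow>\<^sub>E S. \<Sum>i\<in>S. f (c(x := i)))" by (rule sum.swap)
  finally show ?thesis .
qed

lemma sum_swap3: "(\<Sum>k\<in>S. \<Sum>j\<in>S. \<Sum>i\<in>S. g i j k) = (\<Sum>i\<in>S. \<Sum>j\<in>S. \<Sum>k\<in>S. g i j k)"
proof -
  have "(\<Sum>k\<in>S. \<Sum>j\<in>S. \<Sum>i\<in>S. g i j k) = (\<Sum>k\<in>S. \<Sum>i\<in>S. \<Sum>j\<in>S. g i j k)"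
    by (rule sum.cong[OF refl]) (rule sum.swap)
  also have "\<dots> = (\<Sum>i\<in>S. \<Sum>k\<in>S. \<Sum>j\<in>S. g i j k)" by (rule sum.swap)
  also have "\<dots> = (\<Sum>i\<in>S. \<Sum>j\<in>S. \<Sum>k\<in>S. g i j k)"
    by (rule sum.cong[OF refl]) (rule sum.swap)
  finally show ?thesis .
qed

text \<open>Summing out the three edges at one vertex of the second side first isolates the place
  where the local identities for \<open>eps\<close> act.\<close>

lemma ncub_Cons:
  assumes d: "distinct (labs ((x, y, z) # bl))"
  shows "ncub al ((x, y, z) # bl) = (\<Sum>c\<in>set (labs bl) \<rightarrow>\<^sub>E {..<3}.
    wprod bl c * (\<Sum>i<3. \<Sum>j<3. \<Sum>k<3. eps i j k * wprod al (c(z := k, y := j, x := i))))"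
proof -
  have "ncub al ((x, y, z) # bl) = (\<Sum>c\<in>set (labs bl) \<rightarrow>\<^sub>E {..<3}. \<Sum>k<3. \<Sum>j<3. \<Sum>i<3.
      wprod al (c(z := k, y := j, x := i)) * wprod ((x, y, z) # bl) (c(z := k, y := j, x := i)))"
    unfolding ncub_def using d by (simp add: sum_PiE_insert)
  also have "\<dots> = (\<Sum>c\<in>set (labs bl) \<rightarrow>\<^sub>E {..<3}. \<Sum>k<3. \<Sum>j<3. \<Sum>i<3.
      wprod bl c * (eps i j k * wprod al (c(z := k, y := j, x := i))))"
  proof (intro sum.cong refl)
    fix c :: "nat \<Rightarrow> nat" and i j k
    have "wprod bl (c(z := k, y := j, x := i)) = wprod bl c" using d by (intro wprod_cong) auto
    then show "wprod al (c(z := k, y := j, x := i)) * wprod ((x, y, z) # bl) (c(z := k, y := j, x := i))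
      = wprod bl c * (eps i j k * wprod al (c(z := k, y := j, x := i)))" using d by simp
  qed
  also have "\<dots> = (\<Sum>c\<in>set (labs bl) \<rightarrow>\<^sub>E {..<3}. \<Sum>i<3. \<Sum>j<3. \<Sum>k<3.
      wprod bl c * (eps i j k * wprod al (c(z := k, y := j, x := i))))"
    by (rule sum.cong[OF refl]) (rule sum_swap3)
  finally show ?thesis by (simp add: sum_distrib_left)
qed

lemma ncub_scale: "(\<And>c. wprod al c = \<sigma> * wprod al' c) \<Longrightarrow> ncub al bl = \<sigma> * ncub al' bl"
  unfolding ncub_def by (simp add: sum_distrib_left mult.assoc)

text \<open>A triple edge is a component of its own; its 6 proper colourings all have weight
  1.\<close>

lemma ncub_same:
  assumes w: "wff ((x, y, z) # al) ((x, y, z) # bl)"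
  shows "ncub ((x, y, z) # al) ((x, y, z) # bl) = 6 * ncub al bl" "wff al bl"
proof -
  have d: "distinct (labs ((x, y, z) # bl))" "distinct (labs ((x, y, z) # al))"
    using w unfolding wff_def by (metis mset_eq_imp_distinct_iff)+
  have "ncub ((x, y, z) # al) ((x, y, z) # bl) = (\<Sum>c\<in>set (labs bl) \<rightarrow>\<^sub>E {..<3}.
    wprod bl c * (\<Sum>i<3. \<Sum>j<3. \<Sum>k<3. (eps i j k * eps i j k) * wprod al c))"
    unfolding ncub_Cons[OF d(1)] sum_distrib_left
  proof (intro sum.cong refl)
    fix c :: "nat \<Rightarrow> nat" and i j k
    have "wprod al (c(z := k, y := j, x := i)) = wprod al c" using d by (intro wprod_cong) auto
    then show "wprod bl c * (eps i j k * wprod ((x, y, z) # al) (c(z := k, y := j, x := i))) =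
      wprod bl c * ((eps i j k * eps i j k) * wprod al c)" using d(1) by simp
  qed
  also have "\<dots> = 6 * ncub al bl"
    unfolding sum_distrib_right[symmetric] eps_square ncub_def sum_distrib_left by (simp add: mult_ac)
  finally show "ncub ((x, y, z) # al) ((x, y, z) # bl) = 6 * ncub al bl" .
  show "wff al bl" using w by (simp add: wff_def)
qed

text \<open>\<open>eps_contract2\<close> antisymmetrises \<open>eps i j (c p)\<close> in its first
  two indices. It is antisymmetric already, hence the factor 2; the double edge disappears and u, v,
  p meet in one new vertex.\<close>

lemma ncub_pair:
  assumes w: "wff ((x, y, p) # (z, u, v) # al) ((x, y, z) # bl)"
  shows "ncub ((x, y, p) # (z, u, v) # al) ((x, y, z) # bl) = 2 * ncub ((u, v, p) # al) bl"
    "wff ((u, v, p) # al) bl"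
proof -
  have d: "distinct (labs ((x, y, z) # bl))" "distinct (labs ((x, y, p) # (z, u, v) # al))"
    using w unfolding wff_def by (metis mset_eq_imp_distinct_iff)+
  show w': "wff ((u, v, p) # al) bl" using w by (simp add: wff_def add_mset_commute)
  then have sub: "{u, v, p} \<subseteq> set (labs bl)"
    unfolding wff_def by (metis insert_subset labs_simps(2) list.set_intros set_mset_mset set_subset_Cons subset_code(1) mset_eq_setD list.simps(15) empty_subsetI)
  have "ncub ((x, y, p) # (z, u, v) # al) ((x, y, z) # bl) = (\<Sum>c\<in>set (labs bl) \<rightarrow>\<^sub>E {..<3}.
    wprod bl c * (\<Sum>i<3. \<Sum>j<3. (eps i j (c p) * wprod al c) * (\<Sum>k<3. eps i j k * eps k (c u) (c v))))"
    unfolding ncub_Cons[OF d(1)] sum_distrib_left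
  proof (intro sum.cong refl)
    fix c :: "nat \<Rightarrow> nat" and i j k
    have "wprod al (c(z := k, y := j, x := i)) = wprod al c" using d by (intro wprod_cong) auto
    moreover define c' where "c' = c(z := k, y := j, x := i)"
    moreover have "x \<noteq> y" "x \<noteq> z" "y \<noteq> z" using d(1) by simp_all
    moreover have "a \<noteq> x \<and> a \<noteq> y \<and> a \<noteq> z" if "a \<in> {p, u, v}" for a using d(2) that by auto
    ultimately have "c' x = i" "c' y = j" "c' z = k" "c' p = c p" "c' u = c u" "c' v = c v"
      "wprod al c' = wprod al c" by simp_all
    then have v: "wprod ((x, y, p) # (z, u, v) # al) (c(z := k, y := j, x := i)) =
      eps i j (c p) * (eps k (c u) (c v) * wprod al c)"
      unfolding c'_def[symmetric] by (simp only: wprod_simps)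
    show "wprod bl c * (eps i j k * wprod ((x, y, p) # (z, u, v) # al) (c(z := k, y := j, x := i))) =
      wprod bl c * ((eps i j (c p) * wprod al c) * (eps i j k * eps k (c u) (c v)))"
      unfolding v by (simp only: mult_ac)
  qed
  also have "\<dots> = (\<Sum>c\<in>set (labs bl) \<rightarrow>\<^sub>E {..<3}. wprod bl c * (2 * wprod ((u, v, p) # al) c))"
  proof (rule sum.cong[OF refl], rule arg_cong[where f = "\<lambda>s. wprod bl _ * s"])
    fix c assume "c \<in> set (labs bl) \<rightarrow>\<^sub>E {..<3::nat}"
    then have "c u < 3" "c v < 3" using sub by auto
    then show "(\<Sum>i<3. \<Sum>j<3. (eps i j (c p) * wprod al c) * (\<Sum>k<3. eps i j k * eps k (c u) (c v)))
       = 2 * wprod ((u, v, p) # al) c"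
      by (simp add: eps_contract2 eps_swap(1)[of "c v" "c u"])
  qed
  also have "\<dots> = 2 * ncub ((u, v, p) # al) bl"
    unfolding ncub_def sum_distrib_left by (simp add: mult_ac)
  finally show "ncub ((x, y, p) # (z, u, v) # al) ((x, y, z) # bl) = 2 * ncub ((u, v, p) # al) bl" .
qed

text \<open>Summing over the colour of z substitutes u, v for x, y in the two possible orders with
  opposite signs, so the vertices (x, y, z) and (z, u, v) disappear.\<close>

lemma ncub_three:
  assumes w: "wff ((x, p, q) # (y, r, s) # (z, u, v) # al) ((x, y, z) # bl)"
  shows "ncub ((x, p, q) # (y, r, s) # (z, u, v) # al) ((x, y, z) # bl) =
      ncub ((u, p, q) # (v, r, s) # al) bl - ncub ((v, p, q) # (u, r, s) # al) bl"
    "wff ((u, p, q) # (v, r, s) # al) bl" "wff ((v, p, q) # (u, r, s) # al) bl"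
proof -
  have d: "distinct (labs ((x, y, z) # bl))" "distinct (labs ((x, p, q) # (y, r, s) # (z, u, v) # al))"
    using w unfolding wff_def by (metis mset_eq_imp_distinct_iff)+
  show w': "wff ((u, p, q) # (v, r, s) # al) bl" "wff ((v, p, q) # (u, r, s) # al) bl"
    using w by (simp_all add: wff_def add_mset_commute)
  have "mset (labs ((u, p, q) # (v, r, s) # al)) = mset (labs bl)" using w' by (simp only: wff_def)
  then have "set (labs ((u, p, q) # (v, r, s) # al)) = set (labs bl)" by (rule mset_eq_setD)
  then have sub: "u \<in> set (labs bl)" "v \<in> set (labs bl)" by auto
  have "ncub ((x, p, q) # (y, r, s) # (z, u, v) # al) ((x, y, z) # bl) = (\<Sum>c\<in>set (labs bl) \<rightarrow>\<^sub>E {..<3}.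
    wprod bl c * (\<Sum>i<3. \<Sum>j<3. (eps i (c p) (c q) * eps j (c r) (c s) * wprod al c) * (\<Sum>k<3. eps i j k * eps k (c u) (c v))))"
    unfolding ncub_Cons[OF d(1)] sum_distrib_left
  proof (intro sum.cong refl)
    fix c :: "nat \<Rightarrow> nat" and i j k
    have "wprod al (c(z := k, y := j, x := i)) = wprod al c" using d by (intro wprod_cong) auto
    moreover define c' where "c' = c(z := k, y := j, x := i)"
    moreover have "x \<noteq> y" "x \<noteq> z" "y \<noteq> z" using d(1) by simp_all
    moreover have "a \<noteq> x \<and> a \<noteq> y \<and> a \<noteq> z" if "a \<in> {p, q, r, s, u, v}" for a using d(2) that by auto
    ultimately have "c' x = i" "c' y = j" "c' z = k" "c' p = c p" "c' q = c q" "c' r = c r" "c' s = c s" "c' u = c u" "c' v = c v"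
      "wprod al c' = wprod al c" by simp_all
    then have v: "wprod ((x, p, q) # (y, r, s) # (z, u, v) # al) (c(z := k, y := j, x := i)) =
      eps i (c p) (c q) * (eps j (c r) (c s) * (eps k (c u) (c v) * wprod al c))"
      unfolding c'_def[symmetric] by (simp only: wprod_simps)
    show "wprod bl c * (eps i j k * wprod ((x, p, q) # (y, r, s) # (z, u, v) # al) (c(z := k, y := j, x := i))) =
      wprod bl c * ((eps i (c p) (c q) * eps j (c r) (c s) * wprod al c) * (eps i j k * eps k (c u) (c v)))"
      unfolding v by (simp only: mult_ac)
  qed
  also have "\<dots> = (\<Sum>c\<in>set (labs bl) \<rightarrow>\<^sub>E {..<3}. wprod bl c * (wprod ((u, p, q) # (v, r, s) # al) c - wprod ((v, p, q) # (u, r, s) # al) c))"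
  proof (rule sum.cong[OF refl], rule arg_cong[where f = "\<lambda>s. wprod bl _ * s"])
    fix c assume "c \<in> set (labs bl) \<rightarrow>\<^sub>E {..<3::nat}"
    then have "c u < 3" "c v < 3" using sub by auto
    then show "(\<Sum>i<3. \<Sum>j<3. (eps i (c p) (c q) * eps j (c r) (c s) * wprod al c) * (\<Sum>k<3. eps i j k * eps k (c u) (c v)))
       = wprod ((u, p, q) # (v, r, s) # al) c - wprod ((v, p, q) # (u, r, s) # al) c"
      by (simp add: eps_contract2)
  qed
  also have "\<dots> = ncub ((u, p, q) # (v, r, s) # al) bl - ncub ((v, p, q) # (u, r, s) # al) bl"
    unfolding ncub_def sum_subtractf[symmetric] by (simp add: algebra_simps)
  finally show "ncub ((x, p, q) # (y, r, s) # (z, u, v) # al) ((x, y, z) # bl) =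
      ncub ((u, p, q) # (v, r, s) # al) bl - ncub ((v, p, q) # (u, r, s) # al) bl" .
qed

text \<open>Odd cofactors on small networks carry the induction: odd multiples of 6 double to odd
  multiples of 12, and two odd multiples of 12 differ by a multiple of 24.\<close>

definition cubic_dvd :: "triple list \<Rightarrow> triple list \<Rightarrow> bool" where
  "cubic_dvd al bl \<longleftrightarrow> (length bl = 0 \<longrightarrow> ncub al bl = 1) \<and> (length bl = 1 \<longrightarrow> (\<exists>k. odd k \<and> ncub al bl = 6 * k)) \<and>
     (length bl = 2 \<longrightarrow> (\<exists>k. odd k \<and> ncub al bl = 12 * k)) \<and> (length bl \<ge> 3 \<longrightarrow> 24 dvd ncub al bl)"

text \<open>Nonempty networks only: the empty one has the value 1, which a sign would
  change.\<close>

lemma cubic_dvd_neg: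
  assumes "\<sigma> = 1 \<or> \<sigma> = -1" "ncub al bl = \<sigma> * ncub al' bl'" "length bl = length bl'" "length bl > 0" "cubic_dvd al' bl'"
  shows "cubic_dvd al bl"
proof -
  have 1: "\<exists>k. odd k \<and> ncub al bl = d * k" if n: "\<exists>k. odd k \<and> ncub al' bl' = d * k" for d
  proof -
    obtain k where k: "odd k" "ncub al' bl' = d * k" using n by blast
    then have "odd (\<sigma> * k)" "ncub al bl = d * (\<sigma> * k)" using assms(1,2) by auto
    then show ?thesis by blast
  qed
  have 2: "24 dvd ncub al bl" if "24 dvd ncub al' bl'" using that unfolding assms(2) by (rule dvd_mult)
  show ?thesis using assms(4,5) 1 2 unfolding cubic_dvd_def assms(3) by blast
qed

lemma cubic_step_same:
  assumes w: "wff ((x, y, z) # al) ((x, y, z) # bl)" and IH: "\<And>al. wff al bl \<Longrightarrow> cubic_dvd al bl"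
  shows "cubic_dvd ((x, y, z) # al) ((x, y, z) # bl)"
proof -
  note n = ncub_same[OF w]
  have c: "cubic_dvd al bl" using IH n(2) .
  consider "length bl = 0" | "length bl = 1" | "length bl = 2" | "length bl \<ge> 3" by linarith
  then show ?thesis
  proof cases
    case 1 then show ?thesis using c unfolding cubic_dvd_def n(1) by (auto intro: exI[of _ 1])
  next
    case 2
    then obtain k where "odd k" "ncub al bl = 6 * k" using c by (auto simp: cubic_dvd_def)
    then show ?thesis using 2 unfolding cubic_dvd_def n(1) by (auto intro: exI[of _ "3 * k"])
  next
    case 3
    then obtain k where "odd k" "ncub al bl = 12 * k" using c by (auto simp: cubic_dvd_def)
    then show ?thesis using 3 unfolding cubic_dvd_def n(1) by auto
  next
    case 4
    then show ?thesis using c unfolding cubic_dvd_def n(1) by (auto intro: dvd_mult)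
  qed
qed

lemma cubic_step_pair:
  assumes w: "wff ((x, y, p) # (z, u, v) # al) ((x, y, z) # bl)" and IH: "\<And>al. wff al bl \<Longrightarrow> cubic_dvd al bl"
  shows "cubic_dvd ((x, y, p) # (z, u, v) # al) ((x, y, z) # bl)"
proof -
  note n = ncub_pair[OF w]
  have c: "cubic_dvd ((u, v, p) # al) bl" using IH n(2) .
  have "length bl = Suc (length al)" using wff_length[OF n(2)] by simp
  then consider "length bl = 1" | "length bl = 2" | "length bl \<ge> 3" by linarith
  then show ?thesis
  proof cases
    case 1
    then obtain k where "odd k" "ncub ((u, v, p) # al) bl = 6 * k" using c by (auto simp: cubic_dvd_def)
    then show ?thesis using 1 unfolding cubic_dvd_def n(1) by (auto intro: exI[of _ k])
  next
    case 2
    then obtain k where "odd k" "ncub ((u, v, p) # al) bl = 12 * k" using c by (auto simp: cubic_dvd_def)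
    then show ?thesis using 2 unfolding cubic_dvd_def n(1) by auto
  next
    case 3
    then show ?thesis using c unfolding cubic_dvd_def n(1) by (auto intro: dvd_mult)
  qed
qed

text \<open>At least two triples remain after the contraction, so the smallest case is already a
  difference of two odd multiples of 12.\<close>

lemma cubic_step_three:
  assumes w: "wff ((x, p, q) # (y, r, s) # (z, u, v) # al) ((x, y, z) # bl)" and IH: "\<And>al. wff al bl \<Longrightarrow> cubic_dvd al bl"
  shows "cubic_dvd ((x, p, q) # (y, r, s) # (z, u, v) # al) ((x, y, z) # bl)"
proof -
  note n = ncub_three[OF w]
  have c: "cubic_dvd ((u, p, q) # (v, r, s) # al) bl" "cubic_dvd ((v, p, q) # (u, r, s) # al) bl"
    using IH n(2,3) by blast+
  have "length bl = Suc (Suc (length al))" using wff_length[OF n(2)] by simp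
  then consider "length bl = 2" | "length bl \<ge> 3" by linarith
  then show ?thesis
  proof cases
    case 1
    then obtain k l where "odd k" "ncub ((u, p, q) # (v, r, s) # al) bl = 12 * k"
       "odd l" "ncub ((v, p, q) # (u, r, s) # al) bl = 12 * l" using c by (auto simp: cubic_dvd_def)
    moreover from this have "24 dvd 12 * k - 12 * l" by presburger
    ultimately show ?thesis using 1 unfolding cubic_dvd_def n(1) by (auto simp: algebra_simps)
  next
    case 2
    then show ?thesis using c unfolding cubic_dvd_def n(1) by (auto intro: dvd_diff)
  qed
qed

lemma cubic_dvd_scale:
  assumes "\<sigma> = 1 \<or> \<sigma> = -1" "\<And>c. wprod al c = \<sigma> * wprod al' c" "length bl > 0" "cubic_dvd al' bl"
  shows "cubic_dvd al bl"
  using cubic_dvd_neg[OF assms(1) ncub_scale[OF assms(2)] refl assms(3,4)] .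

text \<open>A triple of the second side meets one, two or three triples of the first side; contracting
  the tensors \<open>eps\<close> there gives 6, 2 or a difference of two terms with one triple less on each side.\<close>

theorem cubic_divisibility: "wff al bl \<Longrightarrow> cubic_dvd al bl"
proof (induction bl arbitrary: al)
  case Nil
  then have "labs al = []" by (simp add: wff_def)
  then have "al = []" by (metis length_labs list.size(3) mult_eq_0_iff length_0_conv zero_neq_numeral)
  then show ?case by (simp add: cubic_dvd_def ncub_def)
next
  case (Cons t bl)
  obtain x y z where t: "t = (x, y, z)" by (cases t)
  note w = Cons.prems[unfolded t]
  have xyz: "x \<in> set (labs al)" "y \<in> set (labs al)" "z \<in> set (labs al)"
    using w mset_eq_setD[of "labs al" "labs ((x, y, z) # bl)"] by (auto simp: wff_def)
  have ne: "x \<noteq> y" "x \<noteq> z" "y \<noteq> z" using w by (auto simp: wff_def)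
  have pos: "length ((x, y, z) # bl) > 0" for x y z :: nat by simp
  \<comment> \<open>Reordering the labels of the contracted vertex only changes a sign, so it does
    not matter which of its edges are parallel.\<close>
  have perm: "cubic_dvd al ((x, y, z) # bl)" if "cubic_dvd al ((x', y', z') # bl)"
    "\<And>c. eps (c x) (c y) (c z) = \<sigma> * eps (c x') (c y') (c z')" "\<sigma> = 1 \<or> \<sigma> = -1" "{x', y', z'} = {x, y, z}" for x' y' z' \<sigma>
  proof -
    have s: "set (labs ((x, y, z) # bl)) = set (labs ((x', y', z') # bl))" using that(4) by auto
    have "ncub al ((x, y, z) # bl) = \<sigma> * ncub al ((x', y', z') # bl)"
      unfolding ncub_def s sum_distrib_left by (rule sum.cong[OF refl]) (simp add: that(2) algebra_simps)
    from cubic_dvd_neg[OF that(3) this _ _ that(1)] show ?thesis by simp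
  qed
  have wfp: "wff al ((x, z, y) # bl)" "wff al ((y, z, x) # bl)"
    using w by (auto simp: wff_def add_mset_commute)
  obtain p q al1 \<sigma>1 where 1: "\<sigma>1 = 1 \<or> \<sigma>1 = -1" "\<And>c. wprod al c = \<sigma>1 * wprod ((x, p, q) # al1) c"
    "mset (labs al) = mset (labs ((x, p, q) # al1))" using extract_triple[OF xyz(1)] by metis
  \<comment> \<open>The edges a and b of the contracted vertex are parallel; d either completes a
    triple edge or leads to another vertex.\<close>
  have two: "cubic_dvd al ((a, b, d) # bl)"
    if abd: "wff al ((a, b, d) # bl)" "\<sigma> = 1 \<or> \<sigma> = -1" "\<And>c. wprod al c = \<sigma> * wprod ((a, p, q) # al1) c"
      "mset (labs al) = mset (labs ((a, p, q) # al1))" "b = p \<or> b = q" for a b d p q al1 \<sigma>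
  proof -
    obtain r al2 \<sigma>2 where 2: "\<sigma>2 = 1 \<or> \<sigma>2 = -1" "\<And>c. wprod al c = \<sigma>2 * wprod ((a, b, r) # al2) c"
      "mset (labs al) = mset (labs ((a, b, r) # al2))"
    proof (cases "b = p")
      case True then show thesis using that[of \<sigma> q al1] abd by blast
    next
      case False
      then have b: "b = q" using abd(5) by blast
      show thesis
      proof (rule that[of "-\<sigma>" p al1])
        show "- \<sigma> = 1 \<or> - \<sigma> = - 1" using abd(2) by auto
        show "wprod al c = - \<sigma> * wprod ((a, b, p) # al1) c" for c
          using abd(3)[of c] by (simp add: b eps_swap(2)[of "c a" "c q" "c p"])
        show "mset (labs al) = mset (labs ((a, b, p) # al1))" using abd(4) by (simp add: b add_mset_commute)
      qed
    qed
    have d: "d \<in> set (labs al)" "d \<noteq> a" "d \<noteq> b"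
      using abd(1) mset_eq_setD[of "labs al" "labs ((a, b, d) # bl)"] by (auto simp: wff_def)
    have w2: "wff ((a, b, r) # al2) ((a, b, d) # bl)" using abd(1) 2(3) by (simp add: wff_def)
    show ?thesis
    proof (cases "d = r")
      case True
      then show ?thesis using cubic_dvd_scale[OF 2(1,2) pos cubic_step_same] w2 Cons.IH by blast
    next
      case False
      have "d \<in> set (labs al2)" using d False mset_eq_setD[OF 2(3)] by auto
      then obtain u v al3 \<sigma>3 where 3: "\<sigma>3 = 1 \<or> \<sigma>3 = -1" "\<And>c. wprod al2 c = \<sigma>3 * wprod ((d, u, v) # al3) c"
        "mset (labs al2) = mset (labs ((d, u, v) # al3))" using extract_triple by metis
      have w3: "wff ((a, b, r) # (d, u, v) # al3) ((a, b, d) # bl)" using w2 3(3) by (simp add: wff_def)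
      have "\<sigma>2 * \<sigma>3 = 1 \<or> \<sigma>2 * \<sigma>3 = -1" using 2(1) 3(1) by auto
      moreover have "wprod al c = \<sigma>2 * \<sigma>3 * wprod ((a, b, r) # (d, u, v) # al3) c" for c
        using 2(2) 3(2) by (simp add: algebra_simps)
      ultimately show ?thesis using cubic_dvd_scale[OF _ _ pos cubic_step_pair[OF w3 Cons.IH]] by blast
    qed
  qed
  have "cubic_dvd al ((x, y, z) # bl)"
  proof -
    consider "y = p \<or> y = q" | "z = p \<or> z = q" | "y \<noteq> p" "y \<noteq> q" "z \<noteq> p" "z \<noteq> q" by blast
    then show ?thesis
    proof cases
      case 1 then show ?thesis using two[OF w] 1 \<open>\<And>c. wprod al c = _\<close> \<open>mset (labs al) = _\<close> \<open>\<sigma>1 = 1 \<or> _\<close> by blast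
    next
      case 2
      have "cubic_dvd al ((x, z, y) # bl)" using two[OF wfp(1) 1 2] .
      then show ?thesis
      proof (rule perm[where \<sigma> = "-1"])
        show "eps (c x) (c y) (c z) = - 1 * eps (c x) (c z) (c y)" for c
          using eps_swap(2)[of "c x" "c z" "c y"] by linarith
      qed auto
    next
      case 3
      have "y \<in> set (labs al1)" using xyz ne 3 mset_eq_setD[OF 1(3)] by auto
      then obtain r s al2 \<sigma>2 where 2: "\<sigma>2 = 1 \<or> \<sigma>2 = -1" "\<And>c. wprod al1 c = \<sigma>2 * wprod ((y, r, s) # al2) c"
        "mset (labs al1) = mset (labs ((y, r, s) # al2))" using extract_triple by metis
      show ?thesis
      proof (cases "z = r \<or> z = s")
        case True
        \<comment> \<open>Here y and z are the parallel edges, so the contracted triple is rotated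
          to (y, z, x).\<close>
        have s: "\<sigma>1 * \<sigma>2 = 1 \<or> \<sigma>1 * \<sigma>2 = -1" using 1(1) 2(1) by auto
        have "wprod al c = \<sigma>1 * \<sigma>2 * wprod ((y, r, s) # (x, p, q) # al2) c" for c
          using 1(2) 2(2) by (simp add: algebra_simps)
        moreover have "mset (labs al) = mset (labs ((y, r, s) # (x, p, q) # al2))"
          using 1(3) 2(3) by (simp add: add_mset_commute)
        ultimately have "cubic_dvd al ((y, z, x) # bl)" using two[OF wfp(2) s _ _ True] by blast
        then show ?thesis
        proof (rule perm[where \<sigma> = 1])
          show "eps (c x) (c y) (c z) = 1 * eps (c y) (c z) (c x)" for c
            using eps_swap(2)[of "c y" "c z" "c x"] eps_swap(1)[of "c y" "c x" "c z"] by linarith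
        qed auto
      next
        case False
        have "z \<in> set (labs al2)" using xyz ne 3 False mset_eq_setD[OF 1(3)] mset_eq_setD[OF 2(3)] by auto
        then obtain u v al3 \<sigma>3 where 3: "\<sigma>3 = 1 \<or> \<sigma>3 = -1" "\<And>c. wprod al2 c = \<sigma>3 * wprod ((z, u, v) # al3) c"
          "mset (labs al2) = mset (labs ((z, u, v) # al3))" using extract_triple by metis
        have s: "\<sigma>1 * \<sigma>2 * \<sigma>3 = 1 \<or> \<sigma>1 * \<sigma>2 * \<sigma>3 = -1" using 1(1) 2(1) 3(1) by auto
        have p: "wprod al c = \<sigma>1 * \<sigma>2 * \<sigma>3 * wprod ((x, p, q) # (y, r, s) # (z, u, v) # al3) c" for c
          using 1(2) 2(2) 3(2) by (simp add: algebra_simps)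
        have "mset (labs al) = mset (labs ((x, p, q) # (y, r, s) # (z, u, v) # al3))"
          using 1(3) 2(3) 3(3) by simp
        then have "wff ((x, p, q) # (y, r, s) # (z, u, v) # al3) ((x, y, z) # bl)" using w by (simp add: wff_def)
        from cubic_dvd_scale[OF s p pos cubic_step_three[OF this Cons.IH]] show ?thesis .
      qed
    qed
  qed
  then show ?case using t by simp
qed

text \<open>The cyclic rotation \<open>cyc\<close> of the three colours is even and preserves every
  \<open>eps\<close>, so the three possible colours of \<open>l\<close> contribute equally.\<close>

lemma ncub_fixed_color:
  assumes l: "l \<in> set (labs bl)" and a: "a < 3" and ab: "set (labs al) = set (labs bl)"
  shows "ncub al bl = 3 * (\<Sum>c\<in>{c \<in> set (labs bl) \<rightarrow>\<^sub>E {..<3}. c l = a}. wprod al c * wprod bl c)"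
proof -
  let ?L = "set (labs bl)" and ?w = "\<lambda>c. wprod al c * wprod bl c"
  define cyc where "cyc = (\<lambda>a::nat. if a = 0 then 1 else if a = 1 then 2 else 0 :: nat)"
  define f where "f = (\<lambda>(c :: nat \<Rightarrow> nat) x. if x \<in> ?L then cyc (c x) else undefined)"
  define S where "S = (\<lambda>a. \<Sum>c\<in>{c \<in> ?L \<rightarrow>\<^sub>E {..<3}. c l = a}. ?w c)"
  have ec: "eps (cyc a) (cyc b) (cyc d) = eps a b d" if "a < 3" "b < 3" "d < 3" for a b d
  proof -
    have "a \<in> {0,1,2}" "b \<in> {0,1,2}" "d \<in> {0,1,2}" using that by auto
    then show ?thesis by (elim insertE emptyE) (simp_all add: eps_def cyc_def)
  qed
  have wpf: "wprod ml (f c) = wprod ml c" if "c \<in> ?L \<rightarrow>\<^sub>E {..<3}" "set (labs ml) \<subseteq> ?L" for ml c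
    using that(2)
  proof (induction ml)
    case (Cons t ml)
    obtain x y z where t: "t = (x, y, z)" by (cases t)
    then have "c x < 3" "c y < 3" "c z < 3" using that(1) Cons.prems by auto
    then show ?case using Cons t ec by (simp add: f_def)
  qed simp
  have fin: "finite (?L \<rightarrow>\<^sub>E {..<3::nat})" by (intro finite_PiE) auto
  have step: "S (cyc a) = S a" if "a < 3" for a
  proof -
    have lt: "cyc b < 3" for b by (simp add: cyc_def)
    have cl: "cyc (cyc (cyc b)) = b" if "b < 3" for b using that by (auto simp: cyc_def)
    have "bij_betw f {c \<in> ?L \<rightarrow>\<^sub>E {..<3}. c l = a} {c \<in> ?L \<rightarrow>\<^sub>E {..<3}. c l = cyc a}"
      by (rule bij_betw_byWitness[where f' = "\<lambda>c. f (f c)"])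
        (use that l lt cl in \<open>auto simp: f_def PiE_iff extensional_def fun_eq_iff\<close>)
    then have "S (cyc a) = (\<Sum>c\<in>{c \<in> ?L \<rightarrow>\<^sub>E {..<3}. c l = a}. ?w (f c))"
      unfolding S_def by (rule sum.reindex_bij_betw[symmetric])
    also have "\<dots> = S a" unfolding S_def using wpf[of _ al] wpf[of _ bl] that ab
      by (intro sum.cong) auto
    finally show ?thesis .
  qed
  have S12: "S 1 = S 0" "S 2 = S 1" using step[of 0] step[of 1] by (simp_all add: cyc_def)
  have "ncub al bl = (\<Sum>b<3. S b)"
    unfolding ncub_def S_def
    by (rule sum.group[OF fin, symmetric]) (use l in auto)
  also have "\<dots> = 3 * S a" using S12 a unfolding lessThan3
  proof -
    have "a = 0 \<or> a = 1 \<or> a = 2" using a by arith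
    then show "sum S {0, 1, 2} = 3 * S a" using S12 by auto
  qed
  finally show ?thesis by (simp add: S_def)
qed

section \<open>Divisibility of counts by free group actions, and its use for two-coloured
  cycles\<close>

section \<open>Parity of Hamiltonian decompositions\<close>

text \<open>Passing to the orbits of a free involution halves the sum and leaves a weight on the
  quotient, where a further involution can be used.\<close>

lemma involution_sum:
  fixes w :: "'a \<Rightarrow> int"
  assumes fin: "finite X" and f: "\<And>x. x \<in> X \<Longrightarrow> f x \<in> X" "\<And>x. x \<in> X \<Longrightarrow> f (f x) = x"
    "\<And>x. x \<in> X \<Longrightarrow> f x \<noteq> x" "\<And>x. x \<in> X \<Longrightarrow> w (f x) = w x"
  obtains w' where "\<And>x. x \<in> X \<Longrightarrow> w' {x, f x} = w x"
    "sum w X = 2 * sum w' ((\<lambda>x. {x, f x}) ` X)"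
proof -
  define w' where "w' = (\<lambda>Y. w (SOME y. y \<in> Y))"
  have w': "w' {x, f x} = w x" if "x \<in> X" for x
    unfolding w'_def using someI[of "\<lambda>y. y \<in> {x, f x}" x] f(4)[OF that] by auto
  have "sum w X = (\<Sum>Y\<in>(\<lambda>x. {x, f x}) ` X. \<Sum>x\<in>{x \<in> X. {x, f x} = Y}. w x)"
    by (rule sum.image_gen[OF fin])
  also have "\<dots> = (\<Sum>Y\<in>(\<lambda>x. {x, f x}) ` X. 2 * w' Y)"
  proof (rule sum.cong[OF refl])
    fix Y assume "Y \<in> (\<lambda>x. {x, f x}) ` X"
    then obtain x where x: "x \<in> X" "Y = {x, f x}" by blast
    then have "{y \<in> X. {y, f y} = Y} = {x, f x}" using f(1,2) by fastforce
    then show "sum w {y \<in> X. {y, f y} = Y} = 2 * w' Y"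
      using x f(3,4) w' by (auto simp: eq_commute[of x])
  qed
  finally show thesis using that[of w'] w' by (simp add: sum_distrib_left)
qed

lemma involution_dvd2:
  fixes w :: "'a \<Rightarrow> int"
  assumes "finite X" "\<And>x. x \<in> X \<Longrightarrow> f x \<in> X" "\<And>x. x \<in> X \<Longrightarrow> f (f x) = x"
    "\<And>x. x \<in> X \<Longrightarrow> f x \<noteq> x" "\<And>x. x \<in> X \<Longrightarrow> w (f x) = w x"
  shows "2 dvd sum w X"
  using involution_sum[where f = f and w = w, OF assms] by (metis dvd_triv_left)

text \<open>\<open>g\<close> is used as an involution on the orbits of \<open>f\<close>, so its
  square only has to be the identity up to \<open>f\<close>.\<close>

lemma involution_dvd4:
  fixes w :: "'a \<Rightarrow> int"
  assumes fin: "finite X"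
    and f: "\<And>x. x \<in> X \<Longrightarrow> f x \<in> X" "\<And>x. x \<in> X \<Longrightarrow> f (f x) = x"
      "\<And>x. x \<in> X \<Longrightarrow> f x \<noteq> x" "\<And>x. x \<in> X \<Longrightarrow> w (f x) = w x"
    and g: "\<And>x. x \<in> X \<Longrightarrow> g x \<in> X" "\<And>x. x \<in> X \<Longrightarrow> g (g x) \<in> {x, f x}"
      "\<And>x. x \<in> X \<Longrightarrow> g x \<notin> {x, f x}" "\<And>x. x \<in> X \<Longrightarrow> w (g x) = w x"
    and gf: "\<And>x. x \<in> X \<Longrightarrow> g (f x) = f (g x)"
  shows "4 dvd sum w X"
proof -
  obtain w' where w': "\<And>x. x \<in> X \<Longrightarrow> w' {x, f x} = w x"
    and s: "sum w X = 2 * sum w' ((\<lambda>x. {x, f x}) ` X)"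
    using involution_sum[where f = f and w = w, OF fin f] by blast
  have img: "g ` {x, f x} = {g x, f (g x)}" if "x \<in> X" for x using gf that by auto
  have "2 dvd sum w' ((\<lambda>x. {x, f x}) ` X)"
  proof (rule involution_dvd2[where f = "image g"])
    show "finite ((\<lambda>x. {x, f x}) ` X)" using fin by simp
    fix Y assume "Y \<in> (\<lambda>x. {x, f x}) ` X"
    then obtain x where x: "x \<in> X" "Y = {x, f x}" by blast
    show "g ` Y \<in> (\<lambda>x. {x, f x}) ` X" using x g img by auto
    have "g ` g ` Y = {g (g x), f (g (g x))}" using x g(1) img by simp
    then show "g ` g ` Y = Y" using x f g(2)[OF x(1)] by auto
    show "g ` Y \<noteq> Y" using x img g(3)[OF x(1)] by auto
    show "w' (g ` Y) = w' Y" using x img w' g(1,4) by simp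
  qed
  then show ?thesis unfolding s by auto
qed

text \<open>\<open>g\<close> and \<open>h\<close> commute only modulo the central \<open>f\<close>.
  Besides the elementary abelian group this admits the dihedral group of order 8, which occurs for
  four equal rows.\<close>

lemma involution_dvd8:
  fixes w :: "'a \<Rightarrow> int"
  assumes fin: "finite X"
    and f: "\<And>x. x \<in> X \<Longrightarrow> f x \<in> X" "\<And>x. x \<in> X \<Longrightarrow> f (f x) = x"
      "\<And>x. x \<in> X \<Longrightarrow> f x \<noteq> x" "\<And>x. x \<in> X \<Longrightarrow> w (f x) = w x"
    and g: "\<And>x. x \<in> X \<Longrightarrow> g x \<in> X" "\<And>x. x \<in> X \<Longrightarrow> g (g x) = x"
      "\<And>x. x \<in> X \<Longrightarrow> g x \<notin> {x, f x}" "\<And>x. x \<in> X \<Longrightarrow> w (g x) = w x"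
    and h: "\<And>x. x \<in> X \<Longrightarrow> h x \<in> X" "\<And>x. x \<in> X \<Longrightarrow> h (h x) = x"
      "\<And>x. x \<in> X \<Longrightarrow> h x \<notin> {x, f x, g x, f (g x)}" "\<And>x. x \<in> X \<Longrightarrow> w (h x) = w x"
    and gf: "\<And>x. x \<in> X \<Longrightarrow> g (f x) = f (g x)"
    and hf: "\<And>x. x \<in> X \<Longrightarrow> h (f x) = f (h x)"
    and hg: "\<And>x. x \<in> X \<Longrightarrow> h (g x) \<in> {g (h x), f (g (h x))}"
  shows "8 dvd sum w X"
proof -
  obtain w' where w': "\<And>x. x \<in> X \<Longrightarrow> w' {x, f x} = w x"
    and s: "sum w X = 2 * sum w' ((\<lambda>x. {x, f x}) ` X)"
    using involution_sum[where f = f and w = w, OF fin f] by blast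
  have img: "g ` {x, f x} = {g x, f (g x)}" if "x \<in> X" for x using gf that by auto
  have imh: "h ` {x, f x} = {h x, f (h x)}" if "x \<in> X" for x using hf that by auto
  have "4 dvd sum w' ((\<lambda>x. {x, f x}) ` X)"
  proof (rule involution_dvd4[where f = "image g" and g = "image h"])
    show "finite ((\<lambda>x. {x, f x}) ` X)" using fin by simp
    fix Y assume "Y \<in> (\<lambda>x. {x, f x}) ` X"
    then obtain x where x: "x \<in> X" "Y = {x, f x}" by blast
    show "g ` Y \<in> (\<lambda>x. {x, f x}) ` X" using x g img by auto
    show "h ` Y \<in> (\<lambda>x. {x, f x}) ` X" using x h imh by auto
    have "g ` g ` Y = {g (g x), f (g (g x))}" using x g(1) img by simp
    then show "g ` g ` Y = Y" using x f g(2)[OF x(1)] by auto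
    have "h ` h ` Y = {h (h x), f (h (h x))}" using x h(1) imh by simp
    then show "h ` h ` Y \<in> {Y, g ` Y}" using x f h(2)[OF x(1)] by auto
    show "g ` Y \<noteq> Y" using x img g(3)[OF x(1)] by auto
    show "h ` Y \<notin> {Y, g ` Y}" using x img imh h(3)[OF x(1)] by auto
    show "w' (g ` Y) = w' Y" using x img w' g(1,4) by simp
    show "w' (h ` Y) = w' Y" using x imh w' h(1,4) by simp
    have "h ` g ` Y = {h (g x), f (h (g x))}" "g ` h ` Y = {g (h x), f (g (h x))}"
      using x g(1) h(1) img imh by auto
    then show "h ` g ` Y = g ` h ` Y" using hg[OF x(1)] f(2) g(1) h(1) x by auto
  qed
  then show ?thesis unfolding s by auto
qed

lemma involution_card:
  assumes "finite X" "\<And>x. x \<in> X \<Longrightarrow> f x \<in> X" "\<And>x. x \<in> X \<Longrightarrow> f (f x) = x" "\<And>x. x \<in> X \<Longrightarrow> f x \<noteq> x"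
  shows "even (card X)"
  using involution_dvd2[where w = "\<lambda>_. 1", OF assms(1), of f] assms(2-) by simp

section \<open>Thomason's parity argument for colourings with two types of colours\<close>

definition tau :: "nat \<Rightarrow> nat" where
  "tau a = (if a = 0 then 1 else if a = 1 then 0 else if a = 2 then 3 else if a = 3 then 2 else a)"
definition swap01 :: "nat \<Rightarrow> nat" where
  "swap01 a = (if a = 0 then 1 else if a = 1 then 0 else a)"
definition swap23 :: "nat \<Rightarrow> nat" where
  "swap23 a = (if a = 2 then 3 else if a = 3 then 2 else a)"
definition rho :: "nat \<Rightarrow> nat" where
  "rho a = (if a = 0 then 2 else if a = 1 then 3 else if a = 2 then 0 else if a = 3 then 1 else a)"

lemma color_invol [simp]: "tau (tau a) = a" "swap01 (swap01 a) = a" "swap23 (swap23 a) = a" "rho (rho a) = a"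
  by (auto simp: tau_def swap01_def swap23_def rho_def)

lemma less4: "(a::nat) < 4 \<longleftrightarrow> a = 0 \<or> a = 1 \<or> a = 2 \<or> a = 3" by auto

text \<open>The stabiliser of the partition of the colours into the types {0, 1} and {2, 3};
  membership in the first type is always tested by \<open>< 2\<close>.\<close>

definition typed :: "(nat \<Rightarrow> nat) \<Rightarrow> bool" where
  "typed p \<longleftrightarrow> (\<forall>a<4. p a < 4) \<and> (\<forall>a<4. \<forall>b<4. p a = p b \<longrightarrow> a = b) \<and>
     (\<forall>a<4. \<forall>b<4. (p a < 2 \<longleftrightarrow> p b < 2) = (a < 2 \<longleftrightarrow> b < 2))"

lemma typed_colors: "typed tau" "typed swap01" "typed swap23" "typed rho"
  unfolding typed_def tau_def swap01_def swap23_def rho_def by auto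

text \<open>Colourings of a bipartite graph whose vertices, on the sides \<open>P\<close> and \<open>Q\<close>, are given by their sets of
  edges: all four colours occur at a vertex of degree 4, while a vertex of degree 2 subdivides an edge and
  sees the colours 0, 1 or 2, 3. The colours 0, 1 (and likewise 2, 3) alternate along a family of cycles.\<close>

definition good :: "(nat \<Rightarrow> nat) \<Rightarrow> nat set \<Rightarrow> bool" where
  "good c B \<longleftrightarrow> inj_on c B \<and> (card B = 2 \<longrightarrow> (\<forall>x\<in>B. \<forall>y\<in>B. c x < 2 \<longrightarrow> c y < 2))"

definition val :: "nat set \<Rightarrow> nat set set \<Rightarrow> nat set set \<Rightarrow> (nat \<Rightarrow> nat) set" where
  "val E P Q = {c \<in> E \<rightarrow>\<^sub>E {..<4}. \<forall>B\<in>P \<union> Q. good c B}"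

definition side :: "nat set \<Rightarrow> nat set set \<Rightarrow> bool" where
  "side E P \<longleftrightarrow> \<Union>P = E \<and> (\<forall>B\<in>P. \<forall>C\<in>P. B \<noteq> C \<longrightarrow> B \<inter> C = {}) \<and> (\<forall>B\<in>P. card B = 2 \<or> card B = 4)"

definition quads :: "nat set set \<Rightarrow> nat set set" where
  "quads P = {B \<in> P. card B = 4}"

definition recol :: "nat set \<Rightarrow> (nat \<Rightarrow> nat) \<Rightarrow> (nat \<Rightarrow> nat) \<Rightarrow> nat \<Rightarrow> nat" where
  "recol K p c = (\<lambda>x. if x \<in> K then p (c x) else c x)"

lemma val_commute: "val E P Q = val E Q P" by (simp add: val_def Un_commute)

lemma val_good: "c \<in> val E P Q \<Longrightarrow> B \<in> P \<union> Q \<Longrightarrow> good c B" by (simp add: val_def)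

lemma val_less4: "c \<in> val E P Q \<Longrightarrow> x \<in> E \<Longrightarrow> c x < 4" by (auto simp: val_def)

lemma finite_val: "finite E \<Longrightarrow> finite (val E P Q)"
  by (rule finite_subset[of _ "E \<rightarrow>\<^sub>E {..<4}"]) (auto simp: val_def intro: finite_PiE)

lemma side_in: "side E P \<Longrightarrow> B \<in> P \<Longrightarrow> B \<subseteq> E" by (auto simp: side_def)

lemma recol_good:
  assumes c: "c \<in> val E P Q" and p: "typed p" and B: "B \<in> P \<union> Q" "B \<subseteq> E" "B \<subseteq> K \<or> B \<inter> K = {}"
  shows "good (recol K p c) B"
proof -
  have g: "good c B" using val_good[OF c B(1)] .
  have l: "\<And>x. x \<in> B \<Longrightarrow> c x < 4" using val_less4[OF c] B(2) by blast
  show ?thesis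
  proof (cases "B \<inter> K = {}")
    case True
    then have *: "recol K p c x = c x" if "x \<in> B" for x using that by (auto simp: recol_def)
    have "inj_on (recol K p c) B \<longleftrightarrow> inj_on c B" by (rule inj_on_cong) (rule *)
    then show ?thesis using g * unfolding good_def by metis
  next
    case False
    then have *: "recol K p c x = p (c x)" if "x \<in> B" for x using that B(3) by (auto simp: recol_def)
    have "inj_on (recol K p c) B"
    proof (rule inj_onI)
      fix x y assume xy: "x \<in> B" "y \<in> B" "recol K p c x = recol K p c y"
      then have "c x = c y" using * l p unfolding typed_def by metis
      then show "x = y" using g xy by (auto simp: good_def inj_on_def)
    qed
    moreover have "recol K p c x < 2 \<longleftrightarrow> recol K p c y < 2" if "card B = 2" "x \<in> B" "y \<in> B" for x y
    proof -
      have "c x < 2 \<longleftrightarrow> c y < 2" using g that unfolding good_def by metis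
      then show ?thesis using p l[OF that(2)] l[OF that(3)] *[OF that(2)] *[OF that(3)]
        unfolding typed_def by metis
    qed
    ultimately show ?thesis unfolding good_def by metis
  qed
qed

lemma recol_val:
  assumes c: "c \<in> val E P Q" and p: "typed p" and K: "K \<subseteq> E"
    and g: "\<And>B. B \<in> P \<union> Q \<Longrightarrow> good (recol K p c) B"
  shows "recol K p c \<in> val E P Q"
  using assms unfolding val_def typed_def recol_def by (auto simp: PiE_iff extensional_def)

lemma recol_closed:
  assumes c: "c \<in> val E P Q" and p: "typed p" and K: "K \<subseteq> E" and s: "side E P" "side E Q"
    and cl: "\<And>B. B \<in> P \<union> Q \<Longrightarrow> B \<subseteq> K \<or> B \<inter> K = {}"
  shows "recol K p c \<in> val E P Q"
proof (rule recol_val[OF c p K])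
  fix B assume B: "B \<in> P \<union> Q"
  then have "B \<subseteq> E" using side_in s by blast
  then show "good (recol K p c) B" using recol_good[OF c p B _ cl[OF B]] by blast
qed

lemma recol_all:
  assumes c: "c \<in> val E P Q" and p: "typed p" and s: "side E P" "side E Q"
  shows "recol E p c \<in> val E P Q"
  by (rule recol_closed[OF c p _ s]) (use s side_in in blast)+

lemma quad_surj:
  assumes c: "c \<in> val E P Q" and s: "side E P" "side E Q" and v: "v \<in> quads P \<union> quads Q" and a: "a < 4"
  shows "\<exists>x\<in>v. c x = a"
proof -
  have v': "v \<in> P \<union> Q" "card v = 4" "v \<subseteq> E" using v s side_in by (auto simp: quads_def)
  have inj: "inj_on c v" using val_good[OF c v'(1)] by (simp add: good_def)
  have "c ` v \<subseteq> {..<4}" using val_less4[OF c] v' by auto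
  moreover have "card (c ` v) = card {..<4::nat}" using inj v' by (simp add: card_image)
  ultimately have "c ` v = {..<4}" by (simp add: card_subset_eq)
  then show ?thesis using a by (metis imageE lessThan_iff)
qed

text \<open>\<open>\<phi>\<close> speaks of the decomposition of the edges into types and not of
  colours within a type, so swaps within a type preserve it.\<close>

definition typed_count :: "nat set \<Rightarrow> nat set set \<Rightarrow> nat set set \<Rightarrow> (nat set \<Rightarrow> bool) \<Rightarrow> (nat \<Rightarrow> nat) set" where
  "typed_count E P Q \<phi> = {c \<in> val E P Q. \<phi> {x \<in> E. c x < 2}}"

text \<open>A vertex of degree 4 sees all colours, so the swap of 0, 1 and the swap of 2, 3 generate
  a freely acting group of order 4.\<close>

lemma typed_count_dvd4:
  assumes fin: "finite E" and s: "side E P" "side E Q" and v: "v \<in> quads P \<union> quads Q"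
  shows "4 dvd card (typed_count E P Q \<phi>)"
proof -
  let ?X = "typed_count E P Q \<phi>"
  have "4 dvd sum (\<lambda>_. 1::int) ?X"
  proof (rule involution_dvd4[where f = "recol E swap01" and g = "recol E swap23"])
    show "finite ?X" using finite_val[OF fin] by (simp add: typed_count_def)
    fix c assume "c \<in> ?X"
    then have c: "c \<in> val E P Q" "\<phi> {x \<in> E. c x < 2}" by (auto simp: typed_count_def)
    have vE: "v \<subseteq> E" using v s side_in by (auto simp: quads_def)
    have t: "{x \<in> E. recol E swap01 c x < 2} = {x \<in> E. c x < 2}"
      "{x \<in> E. recol E swap23 c x < 2} = {x \<in> E. c x < 2}"
      using val_less4[OF c(1)] by (auto simp: recol_def swap01_def swap23_def less4)
    show "recol E swap01 c \<in> ?X" "recol E swap23 c \<in> ?X"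
      unfolding typed_count_def using t c recol_all[OF c(1) _ s] typed_colors by auto
    show "recol E swap01 (recol E swap01 c) = c" by (auto simp: recol_def)
    show "recol E swap23 (recol E swap23 c) \<in> {c, recol E swap01 c}" by (auto simp: recol_def)
    obtain x where x: "x \<in> v" "c x = 0" using quad_surj[OF c(1) s v, of 0] by auto
    obtain y where y: "y \<in> v" "c y = 2" using quad_surj[OF c(1) s v, of 2] by auto
    have 1: "recol E swap01 c x = 1" "recol E swap23 c y = 3" "recol E swap01 c y = 2" using x y vE
      by (auto simp: recol_def swap01_def swap23_def)
    show "recol E swap01 c \<noteq> c" using 1 x by auto
    show "recol E swap23 c \<notin> {c, recol E swap01 c}" using 1 y by auto
    show "recol E swap23 (recol E swap01 c) = recol E swap01 (recol E swap23 c)"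
      by (auto simp: recol_def swap01_def swap23_def)
  qed auto
  then have "int 4 dvd int (card ?X)" by simp
  then show ?thesis by (simp only: int_dvd_int_iff)
qed

text \<open>On the union of components \<open>R\<close> the swaps are independent of those
  elsewhere. The complement may lack a vertex of degree 4, and even one of the types;
  \<open>tau\<close> is taken there because it moves every colour.\<close>

lemma typed_count_disconnected:
  assumes fin: "finite E" and s: "side E P" "side E Q" and v: "v \<in> quads P \<union> quads Q"
    and R: "R \<subseteq> E" "v \<subseteq> R" "R \<noteq> E" and cl: "\<And>B. B \<in> P \<union> Q \<Longrightarrow> B \<subseteq> R \<or> B \<inter> R = {}"
  shows "8 dvd card (typed_count E P Q \<phi>)"
proof -
  let ?X = "typed_count E P Q \<phi>"
  have cl': "B \<subseteq> E - R \<or> B \<inter> (E - R) = {}" if "B \<in> P \<union> Q" for B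
    using cl[OF that] that s side_in by blast
  have "8 dvd sum (\<lambda>_. 1::int) ?X"
  proof (rule involution_dvd8[where f = "recol R swap01" and g = "recol R swap23" and h = "recol (E - R) tau"])
    show "finite ?X" using finite_val[OF fin] by (simp add: typed_count_def)
    fix c assume "c \<in> ?X"
    then have c: "c \<in> val E P Q" "\<phi> {x \<in> E. c x < 2}" by (auto simp: typed_count_def)
    have t: "{x \<in> E. recol R swap01 c x < 2} = {x \<in> E. c x < 2}"
      "{x \<in> E. recol R swap23 c x < 2} = {x \<in> E. c x < 2}"
      "{x \<in> E. recol (E - R) tau c x < 2} = {x \<in> E. c x < 2}"
      using val_less4[OF c(1)] by (auto simp: recol_def swap01_def swap23_def tau_def less4)
    show "recol R swap01 c \<in> ?X" "recol R swap23 c \<in> ?X"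
      unfolding typed_count_def using t c recol_closed[OF c(1) _ R(1) s cl] typed_colors by auto
    show "recol (E - R) tau c \<in> ?X"
      unfolding typed_count_def using t c recol_closed[OF c(1) _ _ s cl', of tau] typed_colors by auto
    show "recol R swap01 (recol R swap01 c) = c" "recol R swap23 (recol R swap23 c) = c"
      "recol (E - R) tau (recol (E - R) tau c) = c" by (auto simp: recol_def)
    obtain x where x: "x \<in> v" "c x = 0" using quad_surj[OF c(1) s v, of 0] by auto
    obtain y where y: "y \<in> v" "c y = 2" using quad_surj[OF c(1) s v, of 2] by auto
    obtain z where z: "z \<in> E" "z \<notin> R" using R by blast
    have 1: "recol R swap01 c x = 1" "recol R swap23 c y = 3" "recol R swap01 c y = 2" using x y R
      by (auto simp: recol_def swap01_def swap23_def)
    have 2: "recol (E - R) tau c z = tau (c z)" "recol R swap01 c z = c z" "recol R swap23 c z = c z"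
       "recol R swap01 (recol R swap23 c) z = c z" "tau (c z) \<noteq> c z"
      using z val_less4[OF c(1) z(1)] by (auto simp: recol_def less4 tau_def)
    show "recol R swap01 c \<noteq> c" using 1 x by auto
    show "recol R swap23 c \<notin> {c, recol R swap01 c}" using 1 y by auto
    show "recol (E - R) tau c \<notin> {c, recol R swap01 c, recol R swap23 c, recol R swap01 (recol R swap23 c)}"
      using 2 by auto
    show "recol R swap23 (recol R swap01 c) = recol R swap01 (recol R swap23 c)"
      "recol (E - R) tau (recol R swap01 c) = recol R swap01 (recol (E - R) tau c)"
      "recol (E - R) tau (recol R swap23 c) \<in>
        {recol R swap23 (recol (E - R) tau c), recol R swap01 (recol R swap23 (recol (E - R) tau c))}"
      by (auto simp: recol_def swap01_def swap23_def)
  qed auto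
  then have "int 8 dvd int (card ?X)" by simp
  then show ?thesis by (simp only: int_dvd_int_iff)
qed

text \<open>If there is a vertex of degree 4, this is, modulo 8, four times the number of
  decompositions into two cycles that put \<open>e\<close> and \<open>f\<close> on different
  cycles.\<close>

definition diffc :: "nat set \<Rightarrow> nat set set \<Rightarrow> nat set set \<Rightarrow> nat \<Rightarrow> nat \<Rightarrow> nat" where
  "diffc E P Q e f = card {c \<in> val E P Q. c e < 2 \<and> \<not> c f < 2}"
definition samec :: "nat set \<Rightarrow> nat set set \<Rightarrow> nat set set \<Rightarrow> nat \<Rightarrow> nat \<Rightarrow> nat" where
  "samec E P Q e f = card {c \<in> val E P Q. c e < 2 \<and> c f < 2}"

lemma card_rho:
  assumes fin: "finite E" and s: "side E P" "side E Q"
  shows "card (typed_count E P Q \<phi>) = card (typed_count E P Q (\<lambda>R. \<phi> (E - R)))"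
proof -
  have *: "recol E rho c \<in> typed_count E P Q \<psi>"
    if "c \<in> typed_count E P Q (\<lambda>R. \<psi> (E - R))" for \<psi> c
  proof -
    have c: "c \<in> val E P Q" "\<psi> (E - {x \<in> E. c x < 2})" using that by (auto simp: typed_count_def)
    have "{x \<in> E. recol E rho c x < 2} = E - {x \<in> E. c x < 2}"
      using val_less4[OF c(1)] by (auto simp: recol_def rho_def less4)
    then show ?thesis using c recol_all[OF c(1) typed_colors(4) s] by (simp add: typed_count_def)
  qed
  have **: "typed_count E P Q (\<lambda>R. \<phi> (E - (E - R))) = typed_count E P Q \<phi>"
  proof -
    have "E - (E - {x \<in> E. c x < 2}) = {x \<in> E. c x < 2}" for c :: "nat \<Rightarrow> nat" by blast
    then show ?thesis by (simp add: typed_count_def)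
  qed
  have "bij_betw (recol E rho) (typed_count E P Q \<phi>) (typed_count E P Q (\<lambda>R. \<phi> (E - R)))"
    by (rule bij_betw_byWitness[where f' = "recol E rho"])
      (use *[of _ \<phi>] *[of _ "\<lambda>R. \<phi> (E - R)"] ** in \<open>auto simp: recol_def\<close>)
  then show ?thesis by (rule bij_betw_same_card)
qed

lemma typed_count_eq:
  "e \<in> E \<Longrightarrow> f \<in> E \<Longrightarrow> {c \<in> val E P Q. c e < 2 \<and> \<not> c f < 2} = typed_count E P Q (\<lambda>R. e \<in> R \<and> f \<notin> R)"
  "e \<in> E \<Longrightarrow> f \<in> E \<Longrightarrow> {c \<in> val E P Q. c e < 2 \<and> c f < 2} = typed_count E P Q (\<lambda>R. e \<in> R \<and> f \<in> R)"
  by (auto simp: typed_count_def)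

lemma card_split:
  assumes fin: "finite E"
  shows "card (typed_count E P Q \<phi>) = card (typed_count E P Q (\<lambda>R. \<phi> R \<and> g \<in> R)) + card (typed_count E P Q (\<lambda>R. \<phi> R \<and> g \<notin> R))"
proof -
  have "typed_count E P Q \<phi> = typed_count E P Q (\<lambda>R. \<phi> R \<and> g \<in> R) \<union> typed_count E P Q (\<lambda>R. \<phi> R \<and> g \<notin> R)"
    by (auto simp: typed_count_def)
  then show ?thesis
    using finite_val[OF fin, of P Q]
    by (subst card_Un_disjoint[symmetric]) (auto simp: typed_count_def)
qed

text \<open>Let x, y, z count the colourings that separate b, a, c respectively from the other two
  edges, with the type of one edge prescribed. The three counts are x + y, z + x and z + y, and z +
  y = (x + y) + (z + x) - 2x, where 4 divides x.\<close>

lemma diff_triple: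
  assumes fin: "finite E" and s: "side E P" "side E Q" and v: "v \<in> quads P \<union> quads Q"
    and abc: "a \<in> E" "b \<in> E" "c \<in> E" and 8: "8 dvd diffc E P Q a b" "8 dvd diffc E P Q b c"
  shows "8 dvd diffc E P Q a c"
proof -
  let ?N = "\<lambda>\<phi>. card (typed_count E P Q \<phi>)"
  note cs = card_split[OF fin, of P Q]
  let ?x = "?N (\<lambda>R. (a \<in> R \<and> b \<notin> R) \<and> c \<in> R)" let ?y = "?N (\<lambda>R. (a \<in> R \<and> b \<notin> R) \<and> c \<notin> R)"
  let ?z = "?N (\<lambda>R. (a \<in> R \<and> c \<notin> R) \<and> b \<in> R)"
  have 1: "diffc E P Q a b = ?x + ?y"
    unfolding diffc_def typed_count_eq(1)[OF abc(1,2)] by (rule cs)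
  have eq: "\<phi> = \<psi> \<Longrightarrow> ?N \<phi> = ?N \<psi>" for \<phi> \<psi> by simp
  have "?N (\<lambda>R. (a \<in> R \<and> c \<notin> R) \<and> b \<notin> R) = ?y" by (rule eq) (simp add: fun_eq_iff conj_ac)
  then have 2: "diffc E P Q a c = ?z + ?y"
    unfolding diffc_def typed_count_eq(1)[OF abc(1,3)] using cs[of "\<lambda>R. a \<in> R \<and> c \<notin> R" b] by simp
  have "?N (\<lambda>R. (b \<in> R \<and> c \<notin> R) \<and> a \<in> R) = ?z + 0" by (simp add: conj_ac)
  moreover have "?N (\<lambda>R. (b \<in> R \<and> c \<notin> R) \<and> a \<notin> R) = ?x"
    unfolding card_rho[OF fin s, of "\<lambda>R. (b \<in> R \<and> c \<notin> R) \<and> a \<notin> R"]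
    using abc by (simp add: conj_ac)
  ultimately have 3: "diffc E P Q b c = ?z + ?x"
    unfolding diffc_def typed_count_eq(1)[OF abc(2,3)] using cs[of "\<lambda>R. b \<in> R \<and> c \<notin> R" a] by simp
  have 4: "4 dvd ?x" "4 dvd ?y" "4 dvd ?z" using typed_count_dvd4[OF fin s v] by blast+
  have arith: "8 dvd z + y" if "4 dvd x" "4 dvd y" "4 dvd z" "8 dvd x + y" "8 dvd z + x" for x y z :: nat
    using that by presburger
  show ?thesis using arith[OF 4] 8 unfolding 1 2 3 by blast
qed

text \<open>\<open>diff_triple\<close> is a transitivity law, so the divisibility spreads from
  adjacent edges through a component. If the class \<open>R\<close> of an edge is not everything,
  the graph is disconnected and \<open>typed_count_disconnected\<close> applies.\<close>

lemma diff_all: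
  assumes fin: "finite E" and s: "side E P" "side E Q" and v: "v \<in> quads P \<union> quads Q"
    and adj: "\<And>u x y. u \<in> quads P \<union> quads Q \<Longrightarrow> x \<in> u \<Longrightarrow> y \<in> u \<Longrightarrow> x \<noteq> y \<Longrightarrow> 8 dvd diffc E P Q x y"
    and ef: "e \<in> E" "f \<in> E"
  shows "8 dvd diffc E P Q e f"
proof -
  have vE: "v \<subseteq> E" "card v = 4" using v s side_in by (auto simp: quads_def)
  then obtain x where x: "x \<in> v" by fastforce
  have refl: "8 dvd diffc E P Q g g" for g by (simp add: diffc_def)
  have sym: "8 dvd diffc E P Q b a" if "8 dvd diffc E P Q a b" "a \<in> E" "b \<in> E" for a b
  proof -
    have "card (typed_count E P Q (\<lambda>R. b \<in> R \<and> a \<notin> R)) = card (typed_count E P Q (\<lambda>R. a \<in> R \<and> b \<notin> R))"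
      unfolding card_rho[OF fin s, of "\<lambda>R. b \<in> R \<and> a \<notin> R"]
      using that by (simp add: conj_ac)
    then show ?thesis using that unfolding diffc_def typed_count_eq(1)[OF that(2,3)] typed_count_eq(1)[OF that(3,2)] by simp
  qed
  note tri = diff_triple[OF fin s v]
  define R where "R = {g \<in> E. 8 dvd diffc E P Q x g}"
  have clo: "h \<in> R" if "g \<in> R" "B \<in> P \<union> Q" "g \<in> B" "h \<in> B" for g h B
  proof (cases "g = h")
    case False
    have hE: "h \<in> E" "g \<in> E" "x \<in> E" using that s side_in x vE by blast+
    have "card B = 2 \<or> card B = 4" using that s by (auto simp: side_def)
    then have "8 dvd diffc E P Q g h"
    proof
      assume "card B = 4"
      then show ?thesis using adj[of B g h] that False by (auto simp: quads_def)
    next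
      assume B2: "card B = 2"
      then have "{c \<in> val E P Q. c g < 2 \<and> \<not> c h < 2} = {}"
        using val_good[OF _ that(2)] that(3,4) unfolding good_def by blast
      then show ?thesis by (simp only: diffc_def card.empty dvd_0_right)
    qed
    then show ?thesis using tri[of x g h] hE that(1) by (auto simp: R_def)
  qed (use that in simp)
  have xR: "x \<in> R" using refl x vE by (auto simp: R_def)
  show ?thesis
  proof (cases "R = E")
    case True
    then have "8 dvd diffc E P Q x e" "8 dvd diffc E P Q x f" using ef by (auto simp: R_def)
    then show ?thesis using tri[of e x f] sym[of x e] ef x vE by blast
  next
    case False
    have cl: "B \<subseteq> R \<or> B \<inter> R = {}" if "B \<in> P \<union> Q" for B using clo that by blast
    have "v \<in> P \<union> Q" using v by (auto simp: quads_def)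
    then have "v \<subseteq> R" using cl xR x by blast
    moreover have "R \<subseteq> E" by (auto simp: R_def)
    ultimately show ?thesis unfolding diffc_def typed_count_eq(1)[OF ef]
      using typed_count_disconnected[OF fin s v _ _ False cl] by blast
  qed
qed


text \<open>Replacing a vertex of degree 4 by two subdivision vertices forces x, y to share a type,
  and likewise z, w.\<close>

lemma side_split:
  assumes s: "side E P" and v: "v \<in> quads P" and xyzw: "v = {x, y, z, w}" "distinct [x, y, z, w]"
  defines "P' \<equiv> insert {x, y} (insert {z, w} (P - {v}))"
  shows "side E P'" "quads P' = quads P - {v}"
proof -
  have vP: "v \<in> P" using v by (auto simp: quads_def)
  have dis: "B \<inter> v = {}" if "B \<in> P - {v}" for B using s vP that unfolding side_def by blast
  have c2: "card {x, y} = 2" "card {z, w} = 2" using xyzw by auto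
  have "\<Union>P' = v \<union> \<Union>(P - {v})" unfolding P'_def xyzw(1) by auto
  also have "\<dots> = \<Union>P" using vP by blast
  finally have "\<Union>P' = E" using s by (simp add: side_def)
  moreover have "B \<inter> C = {}" if BC: "B \<in> P'" "C \<in> P'" "B \<noteq> C" for B C
  proof -
    have d: "{x, y} \<inter> D = {}" "{z, w} \<inter> D = {}" if "D \<in> P - {v}" for D using dis[OF that] xyzw by auto
    have e: "{x, y} \<inter> {z, w} = {}" using xyzw by auto
    have f: "B \<inter> C = {}" if "B \<in> P - {v}" "C \<in> P - {v}" using that BC(3) s unfolding side_def by blast
    have B: "B = {x, y} \<or> B = {z, w} \<or> B \<in> P - {v}" and C: "C = {x, y} \<or> C = {z, w} \<or> C \<in> P - {v}"
      using BC unfolding P'_def by blast+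
    have d': "D \<inter> {x, y} = {}" "D \<inter> {z, w} = {}" if "D \<in> P - {v}" for D
      using d[OF that] by (simp_all only: inf_commute)
    have e': "{z, w} \<inter> {x, y} = {}" using e by (simp only: inf_commute)
    from B C show ?thesis
      by (elim disjE) (use BC(3) d d' e e' f in \<open>simp_all only: not_True_eq_False\<close>)
  qed
  moreover have "card B = 2 \<or> card B = 4" if "B \<in> P'" for B
    using that c2 s unfolding P'_def side_def by blast
  ultimately show "side E P'" unfolding side_def by blast
  show "quads P' = quads P - {v}" using c2 unfolding quads_def P'_def by auto
qed

text \<open>Each type occurs on exactly two edges at \<open>v\<close>. So x, y of the first type
  means z, w of the second, which is what the two subdivision vertices express once their types
  differ.\<close>

lemma val_split:
  assumes s: "side E P" and v: "v \<in> quads P" and xyzw: "v = {x, y, z, w}" "distinct [x, y, z, w]"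
  shows "{c \<in> val E P Q. c x < 2 \<and> c y < 2} =
    {c \<in> val E (insert {x, y} (insert {z, w} (P - {v}))) Q. c x < 2 \<and> \<not> c z < 2}" (is "?l = ?r")
proof (rule set_eqI)
  fix c
  have vP: "v \<in> P" using v by (auto simp: quads_def)
  have vE: "x \<in> E" "y \<in> E" "z \<in> E" "w \<in> E" using vP s xyzw by (auto simp: side_def)
  have c2: "card {x, y} = 2" "card {z, w} = 2" "card v = 4" using xyzw by auto
  show "c \<in> ?l \<longleftrightarrow> c \<in> ?r"
  proof (cases "c \<in> E \<rightarrow>\<^sub>E {..<4}")
    case True
    then have l: "c x < 4" "c y < 4" "c z < 4" "c w < 4" using vE by auto
    have gv: "good c v \<longleftrightarrow> distinct [c x, c y, c z, c w]"
      unfolding good_def using c2(3) xyzw by auto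
    have g2: "good c {x, y} \<longleftrightarrow> c x \<noteq> c y \<and> (c x < 2 \<longleftrightarrow> c y < 2)"
      "good c {z, w} \<longleftrightarrow> c z \<noteq> c w \<and> (c z < 2 \<longleftrightarrow> c w < 2)"
      unfolding good_def c2 using xyzw by auto
    have key: "good c v \<and> c x < 2 \<and> c y < 2 \<longleftrightarrow> good c {x, y} \<and> good c {z, w} \<and> c x < 2 \<and> \<not> c z < 2"
      unfolding gv g2 using l unfolding less4 by (elim disjE) simp_all
    have "c \<in> ?l \<longleftrightarrow> (\<forall>B\<in>(P - {v}) \<union> Q. good c B) \<and> (good c v \<and> c x < 2 \<and> c y < 2)"
      using True vP unfolding val_def by blast
    also have "\<dots> \<longleftrightarrow> c \<in> ?r" unfolding key using True unfolding val_def by blast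
    finally show ?thesis .
  qed (simp add: val_def)
qed

lemma same_adj:
  assumes s: "side E P" and v: "v \<in> quads P" and xyzw: "v = {x, y, z, w}" "distinct [x, y, z, w]"
  shows "samec E P Q x y = diffc E (insert {x, y} (insert {z, w} (P - {v}))) Q x z"
  unfolding samec_def diffc_def val_split[OF assms] ..

text \<open>If x and y have different types, the partner of x at \<open>v\<close> is z or w; each
  possibility is a split.\<close>

lemma diff_adj:
  assumes fin: "finite E" and s: "side E P" and v: "v \<in> quads P" and xyzw: "v = {x, y, z, w}" "distinct [x, y, z, w]"
  shows "diffc E P Q x y = diffc E (insert {x, z} (insert {y, w} (P - {v}))) Q x y
     + diffc E (insert {x, w} (insert {y, z} (P - {v}))) Q x y"
proof -
  have vP: "v \<in> P" using v by (auto simp: quads_def)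
  have vE: "x \<in> E" "y \<in> E" "z \<in> E" "w \<in> E" using vP s xyzw by (auto simp: side_def)
  have t: "\<not> c y < 2 \<longleftrightarrow> (c x < 2 \<and> c z < 2 \<and> \<not> c y < 2 \<and> \<not> c w < 2) \<or> (c x < 2 \<and> c w < 2 \<and> \<not> c y < 2 \<and> \<not> c z < 2)"
    if "c \<in> val E P Q" "c x < 2" for c
  proof -
    have "good c v" using val_good[OF that(1)] vP by blast
    then have "distinct [c x, c y, c z, c w]" unfolding good_def using xyzw by auto
    moreover have "c x < 4" "c y < 4" "c z < 4" "c w < 4" using val_less4[OF that(1)] vE by blast+
    ultimately show ?thesis using that(2) unfolding less4 by (elim disjE) simp_all
  qed
  have t2: "c x < 2 \<and> c z < 2 \<longrightarrow> \<not> c y < 2 \<and> \<not> c w < 2" "c x < 2 \<and> c w < 2 \<longrightarrow> \<not> c y < 2 \<and> \<not> c z < 2"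
    if "c \<in> val E P Q" for c
  proof -
    have "good c v" using val_good[OF that(1)] vP by blast
    then have "distinct [c x, c y, c z, c w]" unfolding good_def using xyzw by auto
    then show "c x < 2 \<and> c z < 2 \<longrightarrow> \<not> c y < 2 \<and> \<not> c w < 2" "c x < 2 \<and> c w < 2 \<longrightarrow> \<not> c y < 2 \<and> \<not> c z < 2"
      by auto
  qed
  have "{c \<in> val E P Q. c x < 2 \<and> \<not> c y < 2} = {c \<in> val E P Q. c x < 2 \<and> c z < 2} \<union> {c \<in> val E P Q. c x < 2 \<and> c w < 2}"
    using t t2 by blast
  moreover have "{c \<in> val E P Q. c x < 2 \<and> c z < 2} \<inter> {c \<in> val E P Q. c x < 2 \<and> c w < 2} = {}"
    using t2 by blast
  ultimately have "diffc E P Q x y = samec E P Q x z + samec E P Q x w"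
    unfolding diffc_def samec_def using finite_val[OF fin] by (simp add: card_Un_disjoint)
  moreover have "v = {x, z, y, w}" "distinct [x, z, y, w]" "v = {x, w, y, z}" "distinct [x, w, y, z]"
    using xyzw by auto
  ultimately show ?thesis using same_adj[OF s v, of x z y w Q] same_adj[OF s v, of x w y z Q] by simp
qed

definition num_quads :: "nat set set \<Rightarrow> nat set set \<Rightarrow> nat" where
  "num_quads P Q = card (quads P) + card (quads Q)"

lemma quad_list:
  assumes "card v = 4" "x \<in> v" "y \<in> v" "x \<noteq> y"
  obtains z w where "v = {x, y, z, w}" "distinct [x, y, z, w]"
proof -
  have "finite v" using assms(1) card.infinite by fastforce
  then have "card (v - {x, y}) = 2" using assms by (simp add: card_Diff_subset)
  then obtain z w where "v - {x, y} = {z, w}" "z \<noteq> w" by (meson card_2_iff)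
  then show thesis using that[of z w] assms by auto
qed

lemma finite_side: "finite E \<Longrightarrow> side E P \<Longrightarrow> finite P"
  by (metis finite_UnionD side_def)

lemma num_quads_split:
  assumes fin: "finite E" and s: "side E P" and v: "v \<in> quads P" and "v = {x, y, z, w}" "distinct [x, y, z, w]"
  shows "num_quads (insert {x, y} (insert {z, w} (P - {v}))) Q + 1 = num_quads P Q"
proof -
  have "finite (quads P)" using finite_side[OF fin s] by (simp add: quads_def)
  then have "card (quads P - {v}) + 1 = card (quads P)"
    using v by (metis card_Suc_Diff1 Suc_eq_plus1)
  then show ?thesis using side_split(2)[OF s v assms(4,5)] by (simp add: num_quads_def)
qed

lemma num_quads_ex: "num_quads P Q > 0 \<Longrightarrow> \<exists>v. v \<in> quads P \<union> quads Q"
  unfolding num_quads_def by (metis Un_iff add_eq_0_iff_both_eq_0 card.empty equals0I less_numeral_extra(3))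

lemma diffc_commute: "diffc E P Q = diffc E Q P" and samec_commute: "samec E P Q = samec E Q P"
  by (auto simp: diffc_def samec_def val_commute fun_eq_iff)

text \<open>Closure under passing through subdivision vertices of one side: a set closed for both
  sides is a union of whole chains.\<close>

definition pclosed :: "nat set set \<Rightarrow> nat set \<Rightarrow> bool" where
  "pclosed P K \<longleftrightarrow> (\<forall>B\<in>P. card B = 2 \<longrightarrow> B \<subseteq> K \<or> B \<inter> K = {})"

text \<open>Every edge lies at exactly one vertex of the side, and a closed \<open>K\<close>
  contains a subdivision vertex completely or misses it.\<close>

lemma side_sum:
  fixes f :: "nat \<Rightarrow> 'b::comm_monoid_add"
  assumes fin: "finite E" and s: "side E P" and K: "K \<subseteq> E" "pclosed P K"
  shows "sum f K = (\<Sum>B\<in>{B \<in> P. card B = 2 \<and> B \<subseteq> K}. sum f B) + (\<Sum>B\<in>quads P. sum f (B \<inter> K))"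
proof -
  have finP: "finite P" using finite_side[OF fin s] .
  have finB: "finite B" if "B \<in> P" for B using that side_in[OF s] fin finite_subset by blast
  have U: "K = (\<Union>B\<in>P. B \<inter> K)" using s K by (auto simp: side_def)
  have "sum f K = (\<Sum>B\<in>P. sum f (B \<inter> K))"
  proof (subst U, rule sum.UNION_disjoint[OF finP])
    show "\<forall>B\<in>P. finite (B \<inter> K)" using finB by blast
    show "\<forall>B\<in>P. \<forall>C\<in>P. B \<noteq> C \<longrightarrow> B \<inter> K \<inter> (C \<inter> K) = {}" using s unfolding side_def by blast
  qed
  also have "P = {B \<in> P. card B = 2} \<union> quads P" using s unfolding side_def quads_def by blast
  also have "(\<Sum>B\<in>{B \<in> P. card B = 2} \<union> quads P. sum f (B \<inter> K)) =
      (\<Sum>B\<in>{B \<in> P. card B = 2}. sum f (B \<inter> K)) + (\<Sum>B\<in>quads P. sum f (B \<inter> K))"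
    by (rule sum.union_disjoint) (use finP in \<open>auto simp: quads_def\<close>)
  also have "(\<Sum>B\<in>{B \<in> P. card B = 2}. sum f (B \<inter> K)) = (\<Sum>B\<in>{B \<in> P. card B = 2 \<and> B \<subseteq> K}. sum f (B \<inter> K))"
    using K(2) finP unfolding pclosed_def by (intro sum.mono_neutral_right) auto
  also have "\<dots> = (\<Sum>B\<in>{B \<in> P. card B = 2 \<and> B \<subseteq> K}. sum f B)"
    by (rule sum.cong) (auto simp: Int_absorb2)
  finally show ?thesis .
qed

lemma side_card:
  assumes "finite E" "side E P" "K \<subseteq> E" "pclosed P K"
  shows "card K = 2 * card {B \<in> P. card B = 2 \<and> B \<subseteq> K} + (\<Sum>B\<in>quads P. card (B \<inter> K))"
proof -
  have "card K = sum (\<lambda>_. 1) K" by simp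
  also have "\<dots> = (\<Sum>B\<in>{B \<in> P. card B = 2 \<and> B \<subseteq> K}. 2) + (\<Sum>B\<in>quads P. card (B \<inter> K))"
    unfolding side_sum[OF assms] by (intro arg_cong2[where f = "(+)"] sum.cong) auto
  finally show ?thesis by simp
qed

text \<open>A largest set of edges with as many subdivision vertices as a tree on it needs is a whole chain, and
  counting incidences leaves at most two ends.\<close>

lemma chain_exists:
  assumes fin: "finite E" and s: "side E P" "side E Q" and x: "x \<in> E"
  obtains K i where "x \<in> K" "K \<subseteq> E" "pclosed P K" "pclosed Q K" "\<not> i x"
    "\<And>c g. c \<in> val E P Q \<Longrightarrow> g \<in> K \<Longrightarrow> c g = (if i g then tau (c x) else c x)"
    "(\<Sum>B\<in>quads P. card (B \<inter> K)) + (\<Sum>B\<in>quads Q. card (B \<inter> K)) \<le> 2"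
proof -
  define pin where "pin = (\<lambda>P S. card {B \<in> P. card (B :: nat set) = 2 \<and> B \<subseteq> S})"
  \<comment> \<open>The bound on \<open>card S\<close> asks for as many inner vertices as a tree on
    \<open>S\<close> has. \<open>i\<close> records where the colour is the other one of its type:
    along a chain the colours alternate between \<open>c x\<close> and
    \<open>tau (c x)\<close>.\<close>
  define G where "G = (\<lambda>S. x \<in> S \<and> S \<subseteq> E \<and> card S \<le> 1 + pin P S + pin Q S \<and>
    (\<exists>i. \<not> i x \<and> (\<forall>c\<in>val E P Q. \<forall>g\<in>S. c g = (if i g then tau (c x) else c x))))"
  have G0: "G {x}" unfolding G_def using x by (auto intro!: exI[of _ "\<lambda>_. False"])
  have b: "card S \<le> card E" if "G S" for S
    using that fin by (auto simp: G_def intro: card_mono)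
  have "\<exists>K. G K \<and> (\<forall>S. G S \<longrightarrow> card S \<le> card K)"
    by (rule Lattices_Big.ex_has_greatest_nat[of G "{x}" card "Suc (card E)"]) (use G0 b in \<open>auto simp: less_Suc_eq_le\<close>)
  then obtain K where K1: "G K \<and> (\<forall>S. G S \<longrightarrow> card S \<le> card K)" ..
  then have K: "G K" "\<And>S. G S \<Longrightarrow> card S \<le> card K" by simp_all
  then obtain i where i: "\<not> i x" "\<forall>c\<in>val E P Q. \<forall>g\<in>K. c g = (if i g then tau (c x) else c x)"
    by (auto simp: G_def)
  have KE: "K \<subseteq> E" "x \<in> K" and cK: "card K \<le> 1 + pin P K + pin Q K" using K(1) by (auto simp: G_def)
  have finK: "finite K" using KE fin finite_subset by blast
  have cl: "B \<subseteq> K \<or> B \<inter> K = {}" if B: "B \<in> P \<union> Q" "card B = 2" for B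
  proof (rule ccontr)
    assume "\<not> ?thesis"
    then obtain p q where pq: "p \<in> B" "p \<in> K" "q \<in> B" "q \<notin> K" by blast
    obtain a b where ab: "B = {a, b}" using B(2) by (meson card_2_iff)
    have Beq: "B = {p, q}" using pq unfolding ab by auto
    have BE: "B \<subseteq> E" using B s side_in by blast
    define i' where "i' = i(q := \<not> i p)"
    have ins: "\<forall>c\<in>val E P Q. \<forall>g\<in>insert q K. c g = (if i' g then tau (c x) else c x)"
    proof (intro ballI)
      fix c g assume c: "c \<in> val E P Q" and g: "g \<in> insert q K"
      show "c g = (if i' g then tau (c x) else c x)"
      proof (cases "g = q")
        case False then show ?thesis using g i c by (auto simp: i'_def)
      next
        case True
        have gd: "good c B" using val_good[OF c B(1)] .
        have ne: "c p \<noteq> c q" using gd pq unfolding good_def inj_on_def by metis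
        have "c p < 2 \<longleftrightarrow> c q < 2" using gd B(2) pq unfolding good_def by metis
        moreover have "c p < 4" "c q < 4" using val_less4[OF c] pq BE by blast+
        ultimately have "c q = tau (c p)" using ne unfolding less4 by (auto simp: tau_def)
        moreover have "c p = (if i p then tau (c x) else c x)" using i c pq by blast
        ultimately show ?thesis using True by (simp add: i'_def)
      qed
    qed
    have mono: "pin P' K \<le> pin P' (insert q K)" if "side E P'" for P'
      unfolding pin_def using finite_side[OF fin that] by (intro card_mono) auto
    have strict: "pin P' K + 1 \<le> pin P' (insert q K)" if "side E P'" "B \<in> P'" for P'
    proof -
      have "B \<subseteq> insert q K" unfolding Beq using pq by simp
      then have "insert B {C \<in> P'. card C = 2 \<and> C \<subseteq> K} \<subseteq> {C \<in> P'. card C = 2 \<and> C \<subseteq> insert q K}"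
        using that(2) B(2) by blast
      moreover have "B \<notin> {C \<in> P'. card C = 2 \<and> C \<subseteq> K}" using pq by blast
      moreover have "finite P'" using finite_side[OF fin that(1)] .
      ultimately show ?thesis unfolding pin_def
        using card_mono[of "{C \<in> P'. card C = 2 \<and> C \<subseteq> insert q K}" "insert B {C \<in> P'. card C = 2 \<and> C \<subseteq> K}"] by simp
    qed
    have "pin P K + pin Q K + 1 \<le> pin P (insert q K) + pin Q (insert q K)"
      using B(1) mono[OF s(1)] mono[OF s(2)] strict[OF s(1)] strict[OF s(2)] by fastforce
    then have "card (insert q K) \<le> 1 + pin P (insert q K) + pin Q (insert q K)"
      using cK finK pq by simp
    moreover have "\<not> i' x" using i(1) pq KE by (auto simp: i'_def)
    ultimately have "G (insert q K)" unfolding G_def using KE pq BE ins by blast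
    then show False using K(2)[of "insert q K"] finK pq by simp
  qed
  have pc: "pclosed P K" "pclosed Q K" using cl by (auto simp: pclosed_def)
  \<comment> \<open>Counting edges from both sides, 2 card K equals 2 (pin P K + pin Q K) plus the
    number of ends at vertices of degree 4, while pin P K + pin Q K is at least card K - 1.\<close>
  have "(\<Sum>B\<in>quads P. card (B \<inter> K)) + (\<Sum>B\<in>quads Q. card (B \<inter> K)) \<le> 2"
    using side_card[OF fin s(1) KE(1) pc(1)] side_card[OF fin s(2) KE(1) pc(2)] cK
    unfolding pin_def by linarith
  then show thesis using that[of K i] KE pc i by blast
qed

lemma quad_good:
  assumes "card v = 4" "v = {x, y, z, w}" "distinct [x, y, z, w]"
  shows "good c v \<longleftrightarrow> distinct [c x, c y, c z, c w]"
  unfolding good_def using assms by auto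

text \<open>If a chain leaves one vertex of degree 4 and does not reach the other, the two colours of its type can be
  swapped off the chain. Otherwise four chains join the two vertices, and the types of two of them can be
  exchanged.\<close>

lemma diff_two_quads:
  assumes fin: "finite E" and s: "side E P" "side E Q" and n2: "num_quads P Q = 2"
    and v: "v \<in> quads P" and xy: "x \<in> v" "y \<in> v" "x \<noteq> y"
  shows "8 dvd diffc E P Q x y"
proof -
  have v4: "card v = 4" and vP: "v \<in> P" using v by (auto simp: quads_def)
  have vE: "v \<subseteq> E" using side_in[OF s(1) vP] .
  obtain z w where vzw: "v = {x, y, z, w}" "distinct [x, y, z, w]" using quad_list[OF v4 xy] .
  have finq: "finite (quads P)" "finite (quads Q)"
    using finite_side[OF fin] s by (auto simp: quads_def)
  have "\<exists>u. quads P = {v, u} \<and> v \<noteq> u \<and> quads Q = {} \<or> quads P = {v} \<and> quads Q = {u}"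
  proof -
    have "card (quads P) \<ge> 1" using v finq by (metis One_nat_def Suc_leI card_gt_0_iff empty_iff)
    then consider "card (quads P) = 2" "card (quads Q) = 0" | "card (quads P) = 1" "card (quads Q) = 1"
      using n2 unfolding num_quads_def by linarith
    then show ?thesis
    proof cases
      case 1
      then obtain a b where "quads P = {a, b}" "a \<noteq> b" by (meson card_2_iff)
      then have "quads P = {v, if v = a then b else a}" "v \<noteq> (if v = a then b else a)" using v by auto
      moreover have "quads Q = {}" using 1 finq by simp
      ultimately show ?thesis by metis
    next
      case 2
      then obtain a b where ab: "quads P = {a}" "quads Q = {b}" by (meson card_1_singletonE)
      then have "a = v" using v by simp
      with ab show ?thesis by metis
    qed
  qed
  then obtain u where u: "quads P = {v, u} \<and> v \<noteq> u \<and> quads Q = {} \<or> quads P = {v} \<and> quads Q = {u}" by blast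
  have uq: "u \<in> quads P \<union> quads Q" using u by blast
  then have u4: "card u = 4" and uPQ: "u \<in> P \<union> Q" by (auto simp: quads_def)
  have uE: "u \<subseteq> E" using uPQ s side_in by blast
  have ends: "(\<Sum>B\<in>quads P. card (B \<inter> K)) + (\<Sum>B\<in>quads Q. card (B \<inter> K)) = card (v \<inter> K) + card (u \<inter> K)" for K
    using u by (elim disjE conjE) simp_all
  have even: "even (card (v \<inter> K) + card (u \<inter> K))" if "K \<subseteq> E" "pclosed P K" "pclosed Q K" for K
    using side_card[OF fin s(1) that(1,2)] side_card[OF fin s(2) that(1,3)] ends[of K] by presburger
  have blocks: "card B = 2 \<or> B = v \<or> B = u" if "B \<in> P \<union> Q" for B
  proof (rule ccontr)
    assume *: "\<not> ?thesis"
    then have "card B = 4" using that s unfolding side_def Un_iff by metis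
    then have "B \<in> quads P \<union> quads Q" using that by (auto simp: quads_def)
    moreover have "quads P \<union> quads Q = {v, u}" using u by (elim disjE conjE) (simp_all add: insert_commute)
    ultimately show False using * by simp
  qed
  \<comment> \<open>Summing \<open>f\<close> over \<open>K\<close> by vertices of either side gives
    the same value, and only the ends at v and u survive. They cancel if v and u are on the same
    side (\<epsilon> = -1) and agree otherwise (\<epsilon> = 1). For alternating signs this says
    that all chains joining v to u have lengths of the same parity.\<close>
  obtain \<epsilon> :: int where sgn: "\<And>K f. K \<subseteq> E \<Longrightarrow> pclosed P K \<Longrightarrow> pclosed Q K \<Longrightarrow>
      (\<And>B. B \<in> P \<union> Q \<Longrightarrow> card B = 2 \<Longrightarrow> B \<subseteq> K \<Longrightarrow> sum f B = 0) \<Longrightarrow>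
      sum f (v \<inter> K) = \<epsilon> * sum f (u \<inter> K)"
  proof -
    have *: "sum f K = (\<Sum>B\<in>quads P. sum f (B \<inter> K))" "sum f K = (\<Sum>B\<in>quads Q. sum f (B \<inter> K))"
      if "K \<subseteq> E" "pclosed P K" "pclosed Q K" "\<And>B. B \<in> P \<union> Q \<Longrightarrow> card B = 2 \<Longrightarrow> B \<subseteq> K \<Longrightarrow> sum f B = 0"
      for K and f :: "nat \<Rightarrow> int"
    proof -
      have "(\<Sum>B\<in>{B \<in> P. card B = 2 \<and> B \<subseteq> K}. sum f B) = 0" "(\<Sum>B\<in>{B \<in> Q. card B = 2 \<and> B \<subseteq> K}. sum f B) = 0"
        using that(4) by (intro sum.neutral; blast)+
      then show "sum f K = (\<Sum>B\<in>quads P. sum f (B \<inter> K))" "sum f K = (\<Sum>B\<in>quads Q. sum f (B \<inter> K))"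
        using side_sum[OF fin s(1) that(1,2), of f] side_sum[OF fin s(2) that(1,3), of f] by simp_all
    qed
    show thesis
    proof (cases "quads Q = {}")
      case True
      then have uu: "quads P = {v, u}" "v \<noteq> u" using u by simp_all
      show thesis
      proof (rule that[of "-1"])
        fix K and f :: "nat \<Rightarrow> int"
        assume a: "K \<subseteq> E" "pclosed P K" "pclosed Q K" "\<And>B. B \<in> P \<union> Q \<Longrightarrow> card B = 2 \<Longrightarrow> B \<subseteq> K \<Longrightarrow> sum f B = 0"
        show "sum f (v \<inter> K) = - 1 * sum f (u \<inter> K)" using *[OF a] uu True by simp
      qed
    next
      case False
      then have uu: "quads P = {v}" "quads Q = {u}" using u by auto
      show thesis
      proof (rule that[of 1])
        fix K and f :: "nat \<Rightarrow> int"
        assume a: "K \<subseteq> E" "pclosed P K" "pclosed Q K" "\<And>B. B \<in> P \<union> Q \<Longrightarrow> card B = 2 \<Longrightarrow> B \<subseteq> K \<Longrightarrow> sum f B = 0"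
        show "sum f (v \<inter> K) = 1 * sum f (u \<inter> K)" using *[OF a] uu by simp
      qed
    qed
  qed
  \<comment> \<open>The swaps within the types show that the four admissible colour pairs of x and y
    occur equally often. So it is enough that one of them occurs an even number of times.\<close>
  define F where "F = (\<lambda>a b. {c \<in> val E P Q. c x = a \<and> c y = b})"
  have finF: "finite (F a b)" for a b using finite_val[OF fin] by (simp add: F_def)
  have xyE: "x \<in> E" "y \<in> E" using xy vE by auto
  have card01: "card (F a b) = card (F (swap01 a) b)" if "b \<ge> 2" for a b
  proof (rule bij_betw_same_card)
    have "recol E swap01 c \<in> F (swap01 a) b" if "c \<in> F a b" for a c
      using that \<open>b \<ge> 2\<close> recol_all[OF _ typed_colors(2) s] xyE by (auto simp: F_def recol_def swap01_def)
    then show "bij_betw (recol E swap01) (F a b) (F (swap01 a) b)"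
      by (intro bij_betw_byWitness[where f' = "recol E swap01"]) (fastforce simp: recol_def)+
  qed
  have card23: "card (F a b) = card (F a (swap23 b))" if "a < 2" for a b
  proof (rule bij_betw_same_card)
    have "recol E swap23 c \<in> F a (swap23 b)" if "c \<in> F a b" for b c
      using that \<open>a < 2\<close> recol_all[OF _ typed_colors(3) s] xyE by (auto simp: F_def recol_def swap23_def)
    then show "bij_betw (recol E swap23) (F a b) (F a (swap23 b))"
      by (intro bij_betw_byWitness[where f' = "recol E swap23"]) (fastforce simp: recol_def)+
  qed
  have ca: "card (F 1 2) = card (F 0 2)" "card (F 0 3) = card (F 0 2)" "card (F 1 3) = card (F 0 2)"
    using card01[of 2 0] card23[of 0 2] card23[of 1 2] by (simp_all add: swap01_def swap23_def)
  have ab: "a < 2 \<and> \<not> b < 2 \<longleftrightarrow> a = 0 \<and> b = 2 \<or> a = 1 \<and> b = 2 \<or> a = 0 \<and> b = 3 \<or> a = 1 \<and> b = 3"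
    if "b < 4" for a b :: nat using that by arith
  have "{c \<in> val E P Q. c x < 2 \<and> \<not> c y < 2} = F 0 2 \<union> (F 1 2 \<union> (F 0 3 \<union> F 1 3))"
    using ab[OF val_less4[OF _ xyE(2)]] unfolding F_def by blast
  moreover have "F 0 3 \<inter> F 1 3 = {}" "F 1 2 \<inter> (F 0 3 \<union> F 1 3) = {}" "F 0 2 \<inter> (F 1 2 \<union> (F 0 3 \<union> F 1 3)) = {}"
    by (auto simp: F_def)
  ultimately have "diffc E P Q x y = card (F 0 2) + (card (F 1 2) + (card (F 0 3) + card (F 1 3)))"
    unfolding diffc_def using finF by (simp only: card_Un_disjoint finite_Un)
  then have d4: "diffc E P Q x y = 4 * card (F 0 2)" using ca by simp
  have "even (card (F 0 2))"
  proof (cases "F 0 2 = {}")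
    case False
    then obtain c0 where c0: "c0 \<in> val E P Q" by (auto simp: F_def)
    \<comment> \<open>At a subdivision vertex the two colours differ, so exactly one of its edges is
      marked by \<open>i\<close> and the signs cancel.\<close>
    have idx: "sum (\<lambda>g. if i g then -1 else 1) B = (0::int)"
      if B: "B \<in> P \<union> Q" "card B = 2" "B \<subseteq> K"
        and i: "\<And>c g. c \<in> val E P Q \<Longrightarrow> g \<in> K \<Longrightarrow> c g = (if i g then tau (c a) else c a)" for B K i a
    proof -
      obtain p q where pq: "B = {p, q}" "p \<noteq> q" using B(2) by (auto simp: card_2_iff)
      have "c0 p \<noteq> c0 q" using val_good[OF c0 B(1)] pq unfolding good_def inj_on_def by blast
      then have "i p \<noteq> i q" using i[OF c0, of p] i[OF c0, of q] pq B(3) by (metis insert_subset)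
      then show ?thesis using pq by auto
    qed
    define \<Phi> where "\<Phi> = (\<lambda>g K i. g \<in> K \<and> K \<subseteq> E \<and> pclosed P K \<and> pclosed Q K \<and> \<not> i g \<and>
       (\<forall>c\<in>val E P Q. \<forall>h\<in>K. c h = (if i h then tau (c g) else c g)) \<and> card (v \<inter> K) + card (u \<inter> K) \<le> 2)"
    have ex: "\<exists>K i. \<Phi> g K i" if "g \<in> v" for g
    proof -
      have "g \<in> E" using that vE by blast
      from chain_exists[OF fin s this, unfolded ends] obtain K i where
        "g \<in> K" "K \<subseteq> E" "pclosed P K" "pclosed Q K" "\<not> i g"
        "\<And>c h. c \<in> val E P Q \<Longrightarrow> h \<in> K \<Longrightarrow> c h = (if i h then tau (c g) else c g)"
        "card (v \<inter> K) + card (u \<inter> K) \<le> 2" by metis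
      then show ?thesis unfolding \<Phi>_def by (intro exI[of _ K] exI[of _ i]) simp
    qed
    have "\<exists>K. \<forall>g\<in>v. \<exists>i. \<Phi> g (K g) i" by (rule bchoice) (use ex in blast)
    then obtain K where "\<forall>g\<in>v. \<exists>i. \<Phi> g (K g) i" ..
    then have "\<exists>i. \<forall>g\<in>v. \<Phi> g (K g) (i g)" by (rule bchoice)
    then obtain i where Ki: "\<forall>g\<in>v. \<Phi> g (K g) (i g)" ..
    have K: "g \<in> K g" "K g \<subseteq> E" "pclosed P (K g)" "pclosed Q (K g)" "\<not> i g g"
      "\<And>c h. c \<in> val E P Q \<Longrightarrow> h \<in> K g \<Longrightarrow> c h = (if i g h then tau (c g) else c g)"
      "card (v \<inter> K g) + card (u \<inter> K g) \<le> 2" if "g \<in> v" for g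
      using Ki that unfolding \<Phi>_def by blast+
    have finvu: "finite v" "finite u" using vE uE fin finite_subset by blast+
    have distv: "distinct [c x, c y, c z, c w]" if "c \<in> val E P Q" for c
      using val_good[OF that, of v] vP quad_good[OF v4 vzw] by simp
    have pos: "card (v \<inter> K g) \<ge> 1" if "g \<in> v" for g
    proof -
      have "v \<inter> K g \<noteq> {}" using K(1)[OF that] that by blast
      then show ?thesis using finvu by (simp add: Suc_leI card_gt_0_iff)
    qed
    show ?thesis
    proof (cases "\<exists>g\<in>v. u \<inter> K g = {}")
      case True
      then obtain g where g: "g \<in> v" "u \<inter> K g = {}" by blast
      have "card (v \<inter> K g) = 2"
      proof -
        have "card (u \<inter> K g) = 0" using g(2) by simp
        moreover have "n = 2" if "n + 0 \<le> 2" "1 \<le> n" "even (n + 0)" for n :: nat using that by presburger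
        ultimately show ?thesis
          using K(7)[OF g(1)] pos[OF g(1)] even[OF K(2)[OF g(1)] K(3)[OF g(1)] K(4)[OF g(1)]] by metis
      qed
      then obtain a b where ab: "v \<inter> K g = {a, b}" "a \<noteq> b" by (meson card_2_iff)
      have "g \<in> v \<inter> K g" using K(1)[OF g(1)] g(1) by blast
      then have "v \<inter> K g = {g, if g = a then b else a}" "(if g = a then b else a) \<noteq> g" using ab by auto
      then obtain h where h: "v \<inter> K g = {g, h}" "h \<noteq> g" "h \<in> v" by blast
      \<comment> \<open>By parity the chain returns to v, at h. The edges g and h carry both colours
        of one type, so exchanging these two colours off the chain changes nothing at v.\<close>
      define p where "p = (\<lambda>c. if (c g :: nat) < 2 then swap01 else swap23)"
      define \<psi> where "\<psi> = (\<lambda>c. recol (E - K g) (p c) c)"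
      have tp: "typed (p c)" for c using typed_colors by (simp add: p_def)
      have cv: "\<psi> c a = c a" if c: "c \<in> val E P Q" and a: "a \<in> v" for c a
      proof (cases "a \<in> K g")
        case False
        have "c h = (if i g h then tau (c g) else c g)" using K(6)[OF g(1) c] h by blast
        moreover have gdv: "inj_on c v" using val_good[OF c, of v] vP by (simp add: good_def)
        then have "c h \<noteq> c g" using h g by (meson inj_on_eq_iff)
        ultimately have ch: "c h = tau (c g)" by (auto split: if_splits)
        have "c a \<noteq> c g" "c a \<noteq> c h" using gdv a False h g by (metis (no_types) IntI insertCI inj_on_eq_iff K(1) Int_iff)+
        moreover have "c a < 4" "c g < 4" using val_less4[OF c] a g vE by blast+
        ultimately show ?thesis using ch unfolding \<psi>_def p_def recol_def less4
          by (auto simp: swap01_def swap23_def tau_def)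
      qed (simp add: \<psi>_def recol_def)
      show ?thesis
      proof (rule involution_card[where f = \<psi>, OF finF])
        fix c assume cF: "c \<in> F 0 2"
        then have c: "c \<in> val E P Q" by (simp add: F_def)
        have "\<psi> c \<in> val E P Q" unfolding \<psi>_def
        proof (rule recol_val[OF c tp])
          fix B assume B: "B \<in> P \<union> Q"
          have BE: "B \<subseteq> E" using B s side_in by blast
          show "good (recol (E - K g) (p c) c) B"
          proof (cases "B = v")
            case True
            have "good c v" using val_good[OF c] vP by blast
            then show ?thesis using cv[OF c] True v4 unfolding \<psi>_def good_def inj_on_def by auto
          next
            case False
            have "B \<subseteq> E - K g \<or> B \<inter> (E - K g) = {}"
              using blocks[OF B] False g(2) BE B K(3,4)[OF g(1)] unfolding pclosed_def by blast
            then show ?thesis using recol_good[OF c tp B BE] by blast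
          qed
        qed auto
        then show "\<psi> c \<in> F 0 2" using cF cv[OF c] xy by (simp add: F_def)
        have "\<psi> c g = c g" using cv[OF c g(1)] .
        then have "p (\<psi> c) = p c" by (simp add: p_def)
        moreover have "p c (p c a) = a" for a by (simp add: p_def)
        ultimately show "\<psi> (\<psi> c) = c" unfolding \<psi>_def recol_def by (auto simp: fun_eq_iff)
        \<comment> \<open>u lies off the chain and sees all colours, in particular one of the
          exchanged type; hence \<psi> has no fixed point.\<close>
        define a where "a = (if c g < 2 then 0 else 2 :: nat)"
        have "a < 4" by (simp add: a_def)
        then obtain b where b: "b \<in> u" "c b = a" using quad_surj[OF c s uq] by blast
        then have "b \<in> E - K g" using g(2) uE by blast
        then have "\<psi> c b \<noteq> c b" using b by (auto simp: \<psi>_def recol_def p_def a_def swap01_def swap23_def)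
        then show "\<psi> c \<noteq> c" by auto
      qed
    next
      case False
      have one: "card (v \<inter> K g) = 1" "card (u \<inter> K g) = 1" if "g \<in> v" for g
      proof -
        have "u \<inter> K g \<noteq> {}" using False that by blast
        then have "card (u \<inter> K g) \<ge> 1" using finvu by (simp add: Suc_leI card_gt_0_iff)
        then show "card (v \<inter> K g) = 1" "card (u \<inter> K g) = 1" using K(7)[OF that] pos[OF that] by linarith+
      qed
      have zw: "z \<in> v" "w \<in> v" "z \<noteq> w" using vzw by auto
      have vK: "v \<inter> K g = {g}" if "g \<in> v" for g
      proof -
        have g: "g \<in> v \<inter> K g" "card (v \<inter> K g) = 1" using K(1)[OF that] one(1)[OF that] that by blast+
        then obtain a where "v \<inter> K g = {a}" by (meson card_1_singletonE)
        moreover note g(1)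
        ultimately show ?thesis by simp
      qed
      obtain z' where z': "u \<inter> K z = {z'}" using one(2)[OF zw(1)] by (meson card_1_singletonE)
      \<comment> \<open>Removing \<open>K z\<close> makes the two sets disjoint by construction.
        \<open>W\<close> is still closed, and by parity it has exactly one end at u.\<close>
      define W where "W = K w - K z"
      have WE: "W \<subseteq> E" using K(2)[OF zw(2)] by (auto simp: W_def)
      have pc: "pclosed P' (A - B)" "pclosed P' (B \<union> (A - B))" if "pclosed P' A" "pclosed P' B" for P' A B
        using that unfolding pclosed_def by blast+
      have Wc: "pclosed P W" "pclosed Q W"
        unfolding W_def using pc(1)[OF K(3)[OF zw(2)] K(3)[OF zw(1)]] pc(1)[OF K(4)[OF zw(2)] K(4)[OF zw(1)]] by simp_all
      have vW: "v \<inter> W = {w}" 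
      proof -
        have "w \<notin> K z" using vK[OF zw(1)] zw(2,3) by (metis IntI singletonD)
        moreover have "v \<inter> W = v \<inter> K w - K z" unfolding W_def by (rule Int_Diff[symmetric])
        moreover have "{w} - K z = {w}" using \<open>w \<notin> K z\<close> by auto
        ultimately show ?thesis using vK[OF zw(2)] by simp
      qed
      have "card (u \<inter> W) \<le> card (u \<inter> K w)" using finvu by (intro card_mono) (auto simp: W_def)
      then have "card (u \<inter> W) \<le> 1" using one(2)[OF zw(2)] by simp
      moreover have "odd (card (u \<inter> W))" using even[OF WE Wc] vW by simp
      ultimately have "card (u \<inter> W) = 1" by presburger
      then obtain w' where w': "u \<inter> W = {w'}" by (meson card_1_singletonE)
      have "sum (\<lambda>g. if i z g then -1 else 1) (v \<inter> K z) = \<epsilon> * sum (\<lambda>g. if i z g then -1 else 1) (u \<inter> K z)"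
        using idx K(6)[OF zw(1)] by (intro sgn K zw) blast
      moreover have "sum (\<lambda>g. if i w g then -1 else 1) (v \<inter> W) = \<epsilon> * sum (\<lambda>g. if i w g then -1 else 1) (u \<inter> W)"
      proof (rule sgn[OF WE Wc])
        fix B assume B: "B \<in> P \<union> Q" "card B = 2" "B \<subseteq> W"
        then have "B \<subseteq> K w" unfolding W_def by blast
        from idx[OF B(1,2) this K(6)[OF zw(2)]] show "sum (\<lambda>g. if i w g then -1 else 1) B = (0::int)" .
      qed
      ultimately have ii: "i z z' = i w w'"
        using K(5)[OF zw(1)] K(5)[OF zw(2)] vK[OF zw(1)] vW z' w' by (auto split: if_splits)
      \<comment> \<open>With 0 on x and 2 on y, the edges z and w carry 1 and 3 in some order.
        Exchanging the types on both chains swaps these colours at v and, since the chains have the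
        same parity, also swaps the two colours at u.\<close>
      define D where "D = K z \<union> W"
      have DE: "D \<subseteq> E" using K(2)[OF zw(1)] WE by (auto simp: D_def)
      have Dc: "B \<subseteq> D \<or> B \<inter> D = {}" if "B \<in> P \<union> Q" "card B = 2" for B
        using that pc(2)[OF K(3)[OF zw(2)] K(3)[OF zw(1)]] pc(2)[OF K(4)[OF zw(2)] K(4)[OF zw(1)]]
        unfolding pclosed_def D_def W_def by blast
      have vD: "v \<inter> D = {z, w}" and uD: "u \<inter> D = {z', w'}"
        unfolding D_def Int_Un_distrib vK[OF zw(1)] vW z' w' by (simp_all add: insert_commute)
      have zw': "z' \<noteq> w'" "z' \<in> u" "w' \<in> u" "z' \<in> K z" "w' \<in> K w"
      proof -
        have "z' \<in> u \<inter> K z" "w' \<in> u \<inter> W" unfolding z' w' by simp_all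
        then show "z' \<in> u" "w' \<in> u" "z' \<in> K z" "w' \<in> K w" "z' \<noteq> w'" unfolding W_def by auto
      qed
      show ?thesis
      proof (rule involution_card[where f = "recol D rho", OF finF])
        fix c assume cF: "c \<in> F 0 2"
        then have c: "c \<in> val E P Q" "c x = 0" "c y = 2" by (simp_all add: F_def)
        have l: "c z < 4" "c w < 4" using val_less4[OF c(1)] zw vE by blast+
        have czw: "c z = 1 \<and> c w = 3 \<or> c z = 3 \<and> c w = 1"
          using distv[OF c(1)] c l unfolding less4 by auto
        have "c z' = (if i z z' then tau (c z) else c z)" "c w' = (if i w w' then tau (c w) else c w)"
          using K(6)[OF zw(1) c(1) zw'(4)] K(6)[OF zw(2) c(1) zw'(5)] .
        then have rr: "rho (c z) = c w" "rho (c w) = c z" "rho (c z') = c w'" "rho (c w') = c z'"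
          using czw ii by (auto simp: rho_def tau_def)
        have inj: "inj_on (recol D rho c) B"
          if B: "inj_on c B" "B \<inter> D = {a, b}" "rho (c a) = c b" "rho (c b) = c a" for B a b
        proof (rule inj_onI)
          fix s t assume st: "s \<in> B" "t \<in> B" "recol D rho c s = recol D rho c t"
          have ab: "a \<in> B" "b \<in> B" "a \<in> D" "b \<in> D" using B(2) by blast+
          define r where "r = (\<lambda>s. if s = a then b else if s = b then a else s)"
          have "recol D rho c s = c (r s)" "r s \<in> B" if "s \<in> B" for s
            using that B(2-4) ab by (auto simp: recol_def r_def)
          then have "r s = r t" using st B(1) by (metis inj_onD)
          then show "s = t" by (auto simp: r_def split: if_splits)
        qed
        have "recol D rho c \<in> val E P Q"
        proof (rule recol_val[OF c(1) typed_colors(4) DE])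
          fix B assume B: "B \<in> P \<union> Q"
          have BE: "B \<subseteq> E" using B s side_in by blast
          have ij: "inj_on c B" using val_good[OF c(1) B] by (simp add: good_def)
          show "good (recol D rho c) B"
            using blocks[OF B]
          proof (elim disjE)
            assume "card B = 2"
            then show ?thesis using recol_good[OF c(1) typed_colors(4) B BE Dc[OF B]] by blast
          next
            assume "B = v"
            then show ?thesis using inj[OF ij, of z w] vD rr v4 by (simp add: good_def)
          next
            assume "B = u"
            then show ?thesis using inj[OF ij, of z' w'] uD rr u4 by (simp add: good_def)
          qed
        qed
        moreover have "x \<notin> D" "y \<notin> D" using vD xy vzw by auto
        ultimately show "recol D rho c \<in> F 0 2" using c by (simp add: F_def recol_def)
        show "recol D rho (recol D rho c) = c" by (auto simp: recol_def)
        have "z \<in> D" using vD by blast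
        then have "recol D rho c z \<noteq> c z" using rr czw by (auto simp: recol_def)
        then show "recol D rho c \<noteq> c" by auto
      qed
    qed
  qed simp
  then show ?thesis using d4 by (auto elim: evenE)
qed

text \<open>A vertex of degree 4 can be split in three ways into two subdivision vertices of different types; this
  reduces adjacent edges to a smaller graph, and adjacent edges suffice by \<open>diff_triple\<close>.\<close>

theorem diff_dvd8:
  assumes fin: "finite E" and "side E P" "side E Q" and "num_quads P Q \<ge> 2" and "e \<in> E" "f \<in> E"
  shows "8 dvd diffc E P Q e f"
  using assms(2-)
proof (induction "num_quads P Q" arbitrary: P Q e f rule: less_induct)
  case less
  note s = less.prems(1,2)
  have adj: "8 dvd diffc E P Q x y"
    if s: "side E P" "side E Q" and n: "num_quads P Q \<ge> 2" and u: "u \<in> quads P" "x \<in> u" "y \<in> u" "x \<noteq> y"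
      and IH: "\<And>P' Q' e f. num_quads P' Q' < num_quads P Q \<Longrightarrow> side E P' \<Longrightarrow> side E Q' \<Longrightarrow> num_quads P' Q' \<ge> 2 \<Longrightarrow> e \<in> E \<Longrightarrow> f \<in> E \<Longrightarrow> 8 dvd diffc E P' Q' e f"
    for P Q u x y
  proof (cases "num_quads P Q = 2")
    case True
    then show ?thesis using diff_two_quads[OF fin s True u] by blast
  next
    case False
    have u4: "card u = 4" "u \<subseteq> E" using u(1) side_in[OF s(1)] by (auto simp: quads_def)
    obtain z w where zw: "u = {x, y, z, w}" "distinct [x, y, z, w]" using quad_list[OF u4(1) u(2-4)] .
    have zw1: "u = {x, z, y, w}" "distinct [x, z, y, w]" and zw2: "u = {x, w, y, z}" "distinct [x, w, y, z]"
      using zw by auto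
    have xyE: "x \<in> E" "y \<in> E" using u u4 by blast+
    note 1 = side_split(1)[OF s(1) u(1) zw1] num_quads_split[OF fin s(1) u(1) zw1, of Q]
    note 2 = side_split(1)[OF s(1) u(1) zw2] num_quads_split[OF fin s(1) u(1) zw2, of Q]
    have "8 dvd diffc E (insert {x, z} (insert {y, w} (P - {u}))) Q x y"
      using n False 1(2) by (intro IH 1 s(2) xyE) linarith+
    moreover have "8 dvd diffc E (insert {x, w} (insert {y, z} (P - {u}))) Q x y"
      using n False 2(2) by (intro IH 2 s(2) xyE) linarith+
    ultimately show ?thesis unfolding diff_adj[OF fin s(1) u(1) zw] by (rule dvd_add)
  qed
  obtain v where v: "v \<in> quads P \<union> quads Q" using num_quads_ex[of P Q] less.prems(3) by auto
  show ?case
  proof (rule diff_all[OF fin s v _ less.prems(4,5)])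
    fix u x y assume u: "u \<in> quads P \<union> quads Q" "x \<in> u" "y \<in> u" "x \<noteq> y"
    show "8 dvd diffc E P Q x y"
    proof (cases "u \<in> quads P")
      case True
      then show ?thesis using adj[OF s less.prems(3) True u(2-4)] less.hyps by blast
    next
      case False
      then have uQ: "u \<in> quads Q" using u by blast
      have c: "num_quads Q P = num_quads P Q" by (simp add: num_quads_def)
      then show ?thesis unfolding diffc_commute[of E P Q]
        using adj[OF s(2,1) _ uQ u(2-4)] less.hyps less.prems(3) by metis
    qed
  qed
qed

text \<open>By \<open>card_rho\<close>, exactly half of all colourings give the first type to a
  chosen edge, whichever it is. For adjacent edges this half is \<open>samec\<close> plus
  \<open>diffc\<close>, both multiples of 8; splitting for \<open>samec\<close> uses up the third
  vertex of degree 4. Hence the half is a multiple of 8, and subtracting \<open>diffc\<close>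
  settles arbitrary edges.\<close>

theorem same_dvd8:
  assumes fin: "finite E" and s: "side E P" "side E Q" and n: "num_quads P Q \<ge> 3" and ef: "e \<in> E" "f \<in> E"
  shows "8 dvd samec E P Q e f"
proof -
  have D: "8 dvd diffc E P Q a b" if "a \<in> E" "b \<in> E" for a b
    using diff_dvd8[OF fin s _ that] n by simp
  have T: "samec E P Q a b + diffc E P Q a b = card {c \<in> val E P Q. c a < 2}" for a b
  proof -
    have "{c \<in> val E P Q. c a < 2} = {c \<in> val E P Q. c a < 2 \<and> c b < 2} \<union> {c \<in> val E P Q. c a < 2 \<and> \<not> c b < 2}"
      by blast
    then show ?thesis using finite_val[OF fin, of P Q] unfolding samec_def diffc_def
      by (subst card_Un_disjoint[symmetric]) auto
  qed
  have half: "card {c \<in> val E P Q. c a < 2} * 2 = card (val E P Q)" if "a \<in> E" for a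
  proof -
    have 1: "{c \<in> val E P Q. c a < 2} = typed_count E P Q (\<lambda>R. True \<and> a \<in> R)"
      "val E P Q = typed_count E P Q (\<lambda>R. True)"
      using that by (auto simp: typed_count_def)
    have "card (typed_count E P Q (\<lambda>R. True \<and> a \<in> R)) = card (typed_count E P Q (\<lambda>R. True \<and> a \<notin> R))"
      unfolding card_rho[OF fin s, of "\<lambda>R. True \<and> a \<in> R"] using that by simp
    then show ?thesis using card_split[OF fin, of P Q "\<lambda>R. True" a] 1 by simp
  qed
  have adj: "\<exists>x\<in>E. 8 dvd card {c \<in> val E P Q. c x < 2}"
    if s: "side E P" "side E Q" and n: "num_quads P Q \<ge> 3" and u: "u \<in> quads P" for P Q u
  proof -
    have u4: "card u = 4" "u \<subseteq> E" using u side_in[OF s(1)] by (auto simp: quads_def)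
    have "finite u" using u4(2) fin finite_subset by blast
    then obtain x y where xy: "x \<in> u" "y \<in> u" "x \<noteq> y"
      using u4(1) card_le_Suc0_iff_eq[of u] by fastforce
    obtain z w where zw: "u = {x, y, z, w}" "distinct [x, y, z, w]" using quad_list[OF u4(1) xy] .
    have xE: "x \<in> E" "y \<in> E" "z \<in> E" using zw u4 by auto
    have 1: "8 dvd samec E P Q x y" unfolding same_adj[OF s(1) u zw]
      using diff_dvd8[OF fin side_split(1)[OF s(1) u zw] s(2) _ xE(1,3)] num_quads_split[OF fin s(1) u zw, of Q] n by simp
    have 2: "8 dvd diffc E P Q x y" using diff_dvd8[OF fin s _ xE(1,2)] n by simp
    have 3: "samec E P Q x y + diffc E P Q x y = card {c \<in> val E P Q. c x < 2}"
    proof -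
      have "{c \<in> val E P Q. c x < 2} = {c \<in> val E P Q. c x < 2 \<and> c y < 2} \<union> {c \<in> val E P Q. c x < 2 \<and> \<not> c y < 2}"
        by blast
      then show ?thesis using finite_val[OF fin, of P Q] unfolding samec_def diffc_def
        by (subst card_Un_disjoint[symmetric]) auto
    qed
    show ?thesis using dvd_add[OF 1 2] xE(1) unfolding 3 by blast
  qed
  obtain v where v: "v \<in> quads P \<union> quads Q" using num_quads_ex[of P Q] n by auto
  have "\<exists>x\<in>E. 8 dvd card {c \<in> val E P Q. c x < 2}"
  proof (cases "v \<in> quads P")
    case True then show ?thesis using adj[OF s n] by blast
  next
    case False
    then have "v \<in> quads Q" using v by blast
    then show ?thesis using adj[OF s(2,1)] n unfolding val_commute[of E P Q] num_quads_def by (simp add: add.commute)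
  qed
  then obtain x where x: "x \<in> E" "8 dvd card {c \<in> val E P Q. c x < 2}" by blast
  have "card {c \<in> val E P Q. c e < 2} = card {c \<in> val E P Q. c x < 2}"
    using half[OF ef(1)] half[OF x(1)] by simp
  then have "8 dvd samec E P Q e f + diffc E P Q e f" using x T[of e f] by simp
  then show ?thesis using D[OF ef] by (simp only: dvd_add_left_iff)
qed

section \<open>Groups of order 8 acting on the colours: conditions (1) and (3)\<close>

section \<open>Permuting colours\<close>

lemma finite_colorings:
  assumes "finite E" "\<And>j. finite (cs j)"
  shows "finite (colorings E cs A B)"
proof (rule finite_subset)
  show "colorings E cs A B \<subseteq> {f. \<forall>x. (x \<in> E \<longrightarrow> f x \<in> (\<Union>y\<in>E. cs (A y))) \<and> (x \<notin> E \<longrightarrow> f x = 0)}"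
    unfolding colorings_def using colvalid_in by fast
  show "finite {f. \<forall>x. (x \<in> E \<longrightarrow> f x \<in> (\<Union>y\<in>E. cs (A y))) \<and> (x \<notin> E \<longrightarrow> f x = (0::nat))}"
    using assms by (intro finite_set_of_finite_funs) auto
qed

lemma colorings_recolor:
  assumes "R \<in> colorings E cs A B" "inj p" "p 0 = 0" "\<And>j. p ` cs j = cs j"
  shows "p \<circ> R \<in> colorings E cs A B"
  using assms colvalid_recolor unfolding colorings_def by auto

text \<open>Every colour of \<open>cs 1\<close> occurs on some edge of every colouring. Permutations
  that differ on \<open>cs 1\<close> therefore give different recolourings, and the listed
  inequalities supply the freeness demanded by \<open>involution_dvd8\<close>. The colour 0 is fixed
  because it is the value off \<open>E\<close>.\<close>

lemma color_dvd8:
  assumes fin: "finite E" "\<And>j. finite (cs j)"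
    and z: "F 0 = 0" "G 0 = 0" "H 0 = 0"
    and pres: "\<And>j. F ` cs j = cs j" "\<And>j. G ` cs j = cs j" "\<And>j. H ` cs j = cs j"
    and inv: "\<And>a. F (F a) = a" "\<And>a. G (G a) = a" "\<And>a. H (H a) = a"
    and com: "\<And>a. G (F a) = F (G a)" "\<And>a. H (F a) = F (H a)"
      "(\<forall>a. H (G a) = G (H a)) \<or> (\<forall>a. H (G a) = F (G (H a)))"
    and ne: "\<exists>a\<in>cs 1. F a \<noteq> a" "\<exists>a\<in>cs 1. G a \<noteq> a" "\<exists>a\<in>cs 1. G a \<noteq> F a"
      "\<exists>a\<in>cs 1. H a \<noteq> a" "\<exists>a\<in>cs 1. H a \<noteq> F a" "\<exists>a\<in>cs 1. H a \<noteq> G a" "\<exists>a\<in>cs 1. H a \<noteq> F (G a)"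
  shows "8 dvd sum (wt E A B) (colorings E cs A B)"
proof -
  have inj: "inj F" "inj G" "inj H" using inv by (metis injI)+
  have dist: "p \<circ> R \<noteq> q \<circ> R" if R: "R \<in> colorings E cs A B" and ex: "\<exists>a\<in>cs 1. p a \<noteq> q a" for R and p q :: "nat \<Rightarrow> nat"
  proof
    assume eq: "p \<circ> R = q \<circ> R"
    obtain a where a: "a \<in> cs 1" "p a \<noteq> q a" using ex by blast
    then obtain k where "R k = a" using R colvalid_ex unfolding colorings_def by blast
    then show False using a eq by (metis comp_apply)
  qed
  have w: "wt E A B (p \<circ> R) = wt E A B R" if "R \<in> colorings E cs A B" "inj p" "\<And>j. p ` cs j = cs j" for p R
    using that wt_recolor[OF fin(1)] unfolding colorings_def by blast
  show ?thesis
  proof (rule involution_dvd8[where f = "comp F" and g = "comp G" and h = "comp H", OF finite_colorings[OF fin]])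
    fix R assume R: "R \<in> colorings E cs A B"
    show "F \<circ> R \<in> colorings E cs A B" "G \<circ> R \<in> colorings E cs A B" "H \<circ> R \<in> colorings E cs A B"
      using colorings_recolor[OF R] inj z pres by blast+
    show "wt E A B (F \<circ> R) = wt E A B R" "wt E A B (G \<circ> R) = wt E A B R" "wt E A B (H \<circ> R) = wt E A B R"
      using w[OF R] inj pres by blast+
    show "F \<circ> (F \<circ> R) = R" "G \<circ> (G \<circ> R) = R" "H \<circ> (H \<circ> R) = R" using inv by (simp_all add: fun_eq_iff)
    show "G \<circ> (F \<circ> R) = F \<circ> (G \<circ> R)" "H \<circ> (F \<circ> R) = F \<circ> (H \<circ> R)" using com by (simp_all add: fun_eq_iff)
    show "H \<circ> (G \<circ> R) \<in> {G \<circ> (H \<circ> R), F \<circ> (G \<circ> (H \<circ> R))}" using com(3) by (auto simp: fun_eq_iff)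
    have "F \<circ> R \<noteq> id \<circ> R" "G \<circ> R \<noteq> id \<circ> R" "G \<circ> R \<noteq> F \<circ> R" "H \<circ> R \<noteq> id \<circ> R" "H \<circ> R \<noteq> F \<circ> R" "H \<circ> R \<noteq> G \<circ> R"
      "H \<circ> R \<noteq> (F \<circ> G) \<circ> R"
      by (rule dist[OF R]; use ne in simp)+
    then show "F \<circ> R \<noteq> R" "G \<circ> R \<notin> {R, F \<circ> R}" "H \<circ> R \<notin> {R, F \<circ> R, G \<circ> R, F \<circ> (G \<circ> R)}"
      by (simp_all add: o_assoc)
  qed
qed

lemma cset_iff: "i \<in> cset lam j \<longleftrightarrow> 1 \<le> i \<and> 1 \<le> j \<and> j \<le> lam i"
  by (simp add: cset_def young_def)

lemma transpose_cset:
  assumes "lam a = lam b" "1 \<le> a" "1 \<le> b"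
  shows "transpose a b ` cset lam j = cset lam j"
proof -
  have "transpose a b ` cset lam j \<subseteq> cset lam j" using assms by (auto simp: cset_iff transpose_def)
  then have "transpose a b ` transpose a b ` cset lam j \<subseteq> transpose a b ` cset lam j" by blast
  then show ?thesis using \<open>transpose a b ` cset lam j \<subseteq> cset lam j\<close> by (simp add: image_comp)
qed

context
  fixes n :: nat and lam :: "nat \<Rightarrow> nat" and A B :: "nat \<Rightarrow> nat"
  assumes part: "is_partition n lam"
begin

lemma finite_cset: "finite (cset lam j)"
proof (rule finite_subset)
  show "cset lam j \<subseteq> fst ` young lam" by (force simp: cset_def)
  show "finite (fst ` young lam)" using finite_young[OF part] by simp
qed

lemma antitone: assumes "1 \<le> i" "i \<le> j" shows "lam j \<le> lam i"
  using assms(2,1)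
proof (induction j rule: dec_induct)
  case (step k)
  then show ?case using part unfolding is_partition_def by (metis le_trans)
qed simp

lemma dvd8_triply_singular:
  assumes "triply_2_singular lam"
  shows "8 dvd sum (wt {1..n} A B) (colorings {1..n} (cset lam) A B)"
proof -
  obtain i1 i2 i3 where i: "1 \<le> i1" "i1 + 2 \<le> i2" "i2 + 2 \<le> i3"
     "lam i1 = lam (i1 + 1)" "lam i1 > 0" "lam i2 = lam (i2 + 1)" "lam i2 > 0"
     "lam i3 = lam (i3 + 1)" "lam i3 > 0"
    using assms by (auto simp: triply_2_singular_def)
  \<comment> \<open>The index gaps of at least two make these transpositions disjoint.\<close>
  define F G H where "F = transpose i1 (i1 + 1)" and "G = transpose i2 (i2 + 1)" and "H = transpose i3 (i3 + 1)"
  have vals: "F i1 = i1 + 1" "F i2 = i2" "F i3 = i3" "G i2 = i2 + 1" "G i3 = i3" "H i3 = i3 + 1"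
    "G i1 = i1" "H i1 = i1" "H i2 = i2" "F (i2 + 1) = i2 + 1"
    using i by (auto simp: F_def G_def H_def transpose_def)
  have mem: "i1 \<in> cset lam 1" "i2 \<in> cset lam 1" "i3 \<in> cset lam 1" using i by (auto simp: cset_iff)
  show ?thesis
  proof (rule color_dvd8[where F = F and G = G and H = H])
    show "finite {1..n}" "\<And>j. finite (cset lam j)" using finite_cset by auto
    show "F 0 = 0" "G 0 = 0" "H 0 = 0" using i by (auto simp: F_def G_def H_def transpose_def)
    show "F ` cset lam j = cset lam j" "G ` cset lam j = cset lam j" "H ` cset lam j = cset lam j" for j
      unfolding F_def G_def H_def using i by (intro transpose_cset; simp)+
    show "F (F a) = a" "G (G a) = a" "H (H a) = a" for a by (simp_all add: F_def G_def H_def)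
    show "G (F a) = F (G a)" "H (F a) = F (H a)" for a
      using i by (auto simp: F_def G_def H_def transpose_def)
    show "(\<forall>a. H (G a) = G (H a)) \<or> (\<forall>a. H (G a) = F (G (H a)))"
      using i by (auto simp: G_def H_def transpose_def)
    show "\<exists>a\<in>cset lam 1. F a \<noteq> a" "\<exists>a\<in>cset lam 1. G a \<noteq> F a" "\<exists>a\<in>cset lam 1. H a \<noteq> F a"
      using mem(1) vals by (intro bexI[of _ i1]; simp)+
    show "\<exists>a\<in>cset lam 1. G a \<noteq> a" "\<exists>a\<in>cset lam 1. H a \<noteq> G a" "\<exists>a\<in>cset lam 1. H a \<noteq> F (G a)"
      using mem(2) vals by (intro bexI[of _ i2]; simp)+
    show "\<exists>a\<in>cset lam 1. H a \<noteq> a" using mem(3) vals by (intro bexI[of _ i3]; simp)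
  qed
qed

lemma dvd8_four_equal:
  assumes i: "1 \<le> i" "lam i = lam (i + 3)" "lam i > 0"
  shows "8 dvd sum (wt {1..n} A B) (colorings {1..n} (cset lam) A B)"
proof -
  have eq: "lam (i + 1) = lam i" "lam (i + 2) = lam i"
    using antitone[of i "i + 1"] antitone[of "i + 1" "i + 3"] antitone[of i "i + 2"] antitone[of "i + 2" "i + 3"] i by auto
  define a b c d where "a = i" and "b = i + 1" and "c = i + 2" and "d = i + 3"
  have abcd: "distinct [0, a, b, c, d]" "lam a = lam b" "lam c = lam d" "lam a = lam c" "lam b = lam d" "a \<ge> 1" "b \<ge> 1" "c \<ge> 1" "d \<ge> 1"
    using i eq by (auto simp: a_def b_def c_def d_def)
  \<comment> \<open>A dihedral group of order 8 in the symmetric group of the four rows;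
    \<open>F\<close> is central, and \<open>G\<close> and \<open>H\<close> commute up to
    \<open>F\<close>.\<close>
  define F G H where "F = transpose a b \<circ> transpose c d" and "G = transpose a b" and "H = transpose a c \<circ> transpose b d"
  have ne: "a \<noteq> b" "a \<noteq> c" "a \<noteq> d" "b \<noteq> c" "b \<noteq> d" "c \<noteq> d" "b \<noteq> a" "c \<noteq> a" "d \<noteq> a" "c \<noteq> b" "d \<noteq> b" "d \<noteq> c"
    using abcd(1) by auto
  have v: "F a = b" "F b = a" "F c = d" "F d = c" "G a = b" "G b = a" "G c = c" "G d = d"
    "H a = c" "H b = d" "H c = a" "H d = b"
    unfolding F_def G_def H_def comp_def transpose_def by (simp_all only: ne if_True if_False refl)
  have out: "F x = x" "G x = x" "H x = x" if "x \<notin> {a, b, c, d}" for x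
    using that by (simp_all add: F_def G_def H_def transpose_def)
  have all: "P x" if "P a" "P b" "P c" "P d" "x \<notin> {a, b, c, d} \<Longrightarrow> P x" for P and x :: nat
  proof (cases "x \<in> {a, b, c, d}")
    case True
    then show ?thesis by (elim insertE emptyE) (simp_all only: that(1-4))
  qed (rule that(5))
  have mem: "a \<in> cset lam 1" "b \<in> cset lam 1" "c \<in> cset lam 1" "d \<in> cset lam 1"
    using i eq by (auto simp: cset_iff a_def b_def c_def d_def)
  show ?thesis
  proof (rule color_dvd8[where F = F and G = G and H = H])
    show "finite {1..n}" "\<And>j. finite (cset lam j)" using finite_cset by auto
    have "0 \<notin> {a, b, c, d}" using abcd(1) by auto
    then show "F 0 = 0" "G 0 = 0" "H 0 = 0" by (simp_all add: out)
    show "F ` cset lam j = cset lam j" "G ` cset lam j = cset lam j" "H ` cset lam j = cset lam j" for j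
      unfolding F_def G_def H_def image_comp[symmetric] using abcd by (simp_all add: transpose_cset)
    show "F (F x) = x" for x by (rule all[of _ x]) (simp_all only: v out not_False_eq_True)
    show "G (G x) = x" for x by (rule all[of _ x]) (simp_all only: v out not_False_eq_True)
    show "H (H x) = x" for x by (rule all[of _ x]) (simp_all only: v out not_False_eq_True)
    show "G (F x) = F (G x)" for x by (rule all[of _ x]) (simp_all only: v out not_False_eq_True)
    show "H (F x) = F (H x)" for x by (rule all[of _ x]) (simp_all only: v out not_False_eq_True)
    have "H (G x) = F (G (H x))" for x by (rule all[of _ x]) (simp_all only: v out not_False_eq_True)
    then show "(\<forall>a. H (G a) = G (H a)) \<or> (\<forall>a. H (G a) = F (G (H a)))" by blast
    show "\<exists>x\<in>cset lam 1. F x \<noteq> x" "\<exists>x\<in>cset lam 1. G x \<noteq> x" "\<exists>x\<in>cset lam 1. H x \<noteq> x"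
      "\<exists>x\<in>cset lam 1. H x \<noteq> F x" "\<exists>x\<in>cset lam 1. H x \<noteq> G x" "\<exists>x\<in>cset lam 1. H x \<noteq> F (G x)"
      using mem(1) ne by (intro bexI[of _ a]; simp only: v; simp)+
    show "\<exists>x\<in>cset lam 1. G x \<noteq> F x" using mem(3) ne by (intro bexI[of _ c]; simp only: v; simp)
  qed
qed

end

section \<open>Colourings that agree outside a set of colours\<close>

lemma bij_betw_filter: "bij_betw f S U \<Longrightarrow> bij_betw f {x \<in> S. f x \<in> T} (U \<inter> T)"
  unfolding bij_betw_def by (auto intro: inj_on_subset)

text \<open>0 is never the colour of an edge, so it can mark an erased colour. Signed sums are split
  along the fibres of this map.\<close>

definition erase :: "nat set \<Rightarrow> (nat \<Rightarrow> nat) \<Rightarrow> nat \<Rightarrow> nat" where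
  "erase T R = (\<lambda>k. if R k \<in> T then 0 else R k)"

context
  fixes E :: "nat set" and cs :: "nat \<Rightarrow> nat set" and A B :: "nat \<Rightarrow> nat" and T :: "nat set"
    and R0 :: "nat \<Rightarrow> nat" and E' :: "nat set"
  assumes R0: "R0 \<in> colorings E cs A B" and cs0: "\<And>j. 0 \<notin> cs j" and T0: "0 \<notin> T"
  defines "E' \<equiv> {k \<in> E. R0 k \<in> T}"
begin

lemma coloring_pos: "R \<in> colorings E cs A B \<Longrightarrow> k \<in> E \<Longrightarrow> R k \<noteq> 0"
  using colvalid_in cs0 unfolding colorings_def by (metis (mono_tags, lifting) mem_Collect_eq)

lemma fibre_in:
  assumes "R \<in> colorings E cs A B" "erase T R = erase T R0" "k \<in> E"
  shows "R k \<in> T \<longleftrightarrow> k \<in> E'"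
  using fun_cong[OF assms(2), of k] coloring_pos[OF assms(1,3)] coloring_pos[OF R0 assms(3)] assms(3)
  by (auto simp: erase_def E'_def split: if_splits)

lemma fibre_out:
  assumes "R \<in> colorings E cs A B" "erase T R = erase T R0" "k \<notin> E'"
  shows "R k = R0 k"
proof (cases "k \<in> E")
  case True
  then show ?thesis using fun_cong[OF assms(2), of k] fibre_in[OF assms(1,2) True] fibre_in[OF R0 refl True] assms(3)
    by (auto simp: erase_def split: if_splits)
next
  case False
  then show ?thesis using assms(1) R0 by (simp add: colorings_def)
qed

lemma colvalid_restrict:
  assumes v: "colvalid E cs C R" and "\<And>k. k \<in> E \<Longrightarrow> R k \<in> T \<longleftrightarrow> k \<in> E'"
    "\<And>k. k \<in> E' \<Longrightarrow> R' k = R k"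
  shows "colvalid E' (\<lambda>j. cs j \<inter> T) C R'"
  unfolding colvalid_def
proof
  fix j
  have b: "bij_betw R {k \<in> E. C k = j} (cs j)" using v by (simp add: colvalid_def)
  have "{k \<in> E'. C k = j} = {k \<in> {k \<in> E. C k = j}. R k \<in> T}" using assms(2) by (auto simp: E'_def)
  moreover have "bij_betw R {k \<in> {k \<in> E. C k = j}. R k \<in> T} (cs j \<inter> T)"
    using b by (rule bij_betw_filter)
  ultimately have "bij_betw R {k \<in> E'. C k = j} (cs j \<inter> T)" by simp
  then show "bij_betw R' {k \<in> E'. C k = j} (cs j \<inter> T)"
    by (rule bij_betw_cong[THEN iffD1, rotated]) (simp add: assms(3))
qed

lemma colvalid_merge:
  assumes v: "colvalid E cs C R0" and c: "colvalid E' (\<lambda>j. cs j \<inter> T) C c"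
  shows "colvalid E cs C (\<lambda>k. if k \<in> E' then c k else R0 k)" (is "colvalid E cs C ?R")
  unfolding colvalid_def
proof
  fix j
  have b: "bij_betw R0 {k \<in> E. C k = j} (cs j)" using v by (simp add: colvalid_def)
  have 1: "bij_betw ?R {k \<in> E'. C k = j} (cs j \<inter> T)"
    using c unfolding colvalid_def by (elim allE[of _ j]) (rule bij_betw_cong[THEN iffD1, rotated], auto)
  have "bij_betw R0 {k \<in> {k \<in> E. C k = j}. R0 k \<notin> T} (cs j - T)"
    using bij_betw_filter[OF b, of "- T"] by (simp add: Diff_eq)
  moreover have "{k \<in> {k \<in> E. C k = j}. R0 k \<notin> T} = {k \<in> E - E'. C k = j}" by (auto simp: E'_def)
  ultimately have "bij_betw R0 {k \<in> E - E'. C k = j} (cs j - T)" by simp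
  then have 2: "bij_betw ?R {k \<in> E - E'. C k = j} (cs j - T)"
    by (rule bij_betw_cong[THEN iffD1, rotated]) simp
  have "bij_betw ?R ({k \<in> E'. C k = j} \<union> {k \<in> E - E'. C k = j}) (cs j \<inter> T \<union> (cs j - T))"
    by (rule bij_betw_combine[OF 1 2]) auto
  moreover have "{k \<in> E'. C k = j} \<union> {k \<in> E - E'. C k = j} = {k \<in> E. C k = j}" by (auto simp: E'_def)
  moreover have "cs j \<inter> T \<union> (cs j - T) = cs j" by auto
  ultimately show "bij_betw ?R {k \<in> E. C k = j} (cs j)" by simp
qed

text \<open>On a fibre the edges with colours outside \<open>T\<close> are frozen. The edges
  coloured from \<open>T\<close> are the same for all members, and they may carry any colouring of
  their own subgraph.\<close>

lemma fibre_bij: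
  "bij_betw (\<lambda>R k. if k \<in> E' then R k else 0) {R \<in> colorings E cs A B. erase T R = erase T R0}
     (colorings E' (\<lambda>j. cs j \<inter> T) A B)"
proof (rule bij_betw_byWitness[where f' = "\<lambda>c k. if k \<in> E' then c k else R0 k"])
  let ?Y = "{R \<in> colorings E cs A B. erase T R = erase T R0}"
  show "\<forall>R\<in>?Y. (\<lambda>k. if k \<in> E' then if k \<in> E' then R k else 0 else R0 k) = R"
    using fibre_out by (auto simp: fun_eq_iff)
  show "\<forall>c\<in>colorings E' (\<lambda>j. cs j \<inter> T) A B. (\<lambda>k. if k \<in> E' then if k \<in> E' then c k else R0 k else 0) = c"
    by (auto simp: fun_eq_iff colorings_def)
  show "(\<lambda>R k. if k \<in> E' then R k else 0) ` ?Y \<subseteq> colorings E' (\<lambda>j. cs j \<inter> T) A B"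
  proof (rule image_subsetI)
    fix R assume R: "R \<in> ?Y"
    then have v: "colvalid E cs A R" "colvalid E cs B R" by (auto simp: colorings_def)
    show "(\<lambda>k. if k \<in> E' then R k else 0) \<in> colorings E' (\<lambda>j. cs j \<inter> T) A B"
      unfolding colorings_def using R fibre_in colvalid_restrict[OF v(1)] colvalid_restrict[OF v(2)] by auto
  qed
  show "(\<lambda>c k. if k \<in> E' then c k else R0 k) ` colorings E' (\<lambda>j. cs j \<inter> T) A B \<subseteq> ?Y"
  proof (rule image_subsetI)
    fix c assume c: "c \<in> colorings E' (\<lambda>j. cs j \<inter> T) A B"
    let ?R = "\<lambda>k. if k \<in> E' then c k else R0 k"
    have v0: "colvalid E cs A R0" "colvalid E cs B R0" using R0 by (auto simp: colorings_def)
    have "?R \<in> colorings E cs A B"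
      unfolding colorings_def using c colvalid_merge[OF v0(1)] colvalid_merge[OF v0(2)] R0
      by (auto simp: colorings_def E'_def)
    moreover have "c k \<in> T" if "k \<in> E'" for k
      using c colvalid_in[of E' _ A c k] that by (auto simp: colorings_def)
    then have "erase T ?R = erase T R0" by (auto simp: erase_def fun_eq_iff E'_def)
    ultimately show "?R \<in> ?Y" by simp
  qed
qed

end

section \<open>The cubic graph of three consecutive rows\<close>

section \<open>Three rows of almost equal length\<close>

lemma ordered_triple:
  assumes "card (S :: nat set) = 3"
  obtains x y z where "S = {x, y, z}" "x < y" "y < z"
proof -
  have fin: "finite S" using assms card.infinite by fastforce
  have "\<exists>x y z. l = [x, y, z]" if "length l = 3" for l :: "nat list"
    using that by (auto simp: numeral_3_eq_3 length_Suc_conv)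
  moreover have "length (sorted_list_of_set S) = 3" using assms by simp
  ultimately obtain x y z where l: "sorted_list_of_set S = [x, y, z]" by metis
  have "set (sorted_list_of_set S) = S" "sorted_wrt (<) (sorted_list_of_set S)"
    using fin by (simp_all add: strict_sorted_list_of_set)
  then show thesis using that[of x y z] l by auto
qed

lemma ordered_pair:
  assumes "card (S :: nat set) = 2"
  obtains x y where "S = {x, y}" "x < y"
proof -
  obtain a b where "S = {a, b}" "a \<noteq> b" using assms by (meson card_2_iff)
  then show thesis using that[of a b] that[of b a] by (metis insert_commute nat_neq_iff)
qed

text \<open>A triple lists the edges of a column in increasing order, so that \<open>eps\<close> is
  exactly the product of the three inversion signs of that column. A nonzero product certifies
  distinct colours.\<close>

lemma triples_of_columns:
  assumes fin: "finite E"
  shows "(\<forall>j\<in>{1..m}. card {k \<in> E. A k = j} = 3) \<Longrightarrow>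
    \<exists>al. distinct (labs al) \<and> set (labs al) = {k \<in> E. A k \<in> {1..m}} \<and> length al = m \<and>
     (\<forall>R. (\<Prod>(x, y)\<in>{p \<in> samecol E A. A (fst p) \<in> {1..m}}. sgn (int (R y) - int (R x))) = wprod al R) \<and>
     (\<forall>c j. wprod al c \<noteq> 0 \<longrightarrow> j \<in> {1..m} \<longrightarrow> inj_on c {k \<in> E. A k = j})"
proof (induction m)
  case 0
  have "{p \<in> samecol E A. A (fst p) \<in> {1..0::nat}} = {}" by auto
  then show ?case by (intro exI[of _ "[]"]) auto
next
  case (Suc m)
  have "\<forall>j\<in>{1..m}. card {k \<in> E. A k = j} = 3" using Suc.prems by simp
  from Suc.IH[OF this] obtain al where al: "distinct (labs al)" "set (labs al) = {k \<in> E. A k \<in> {1..m}}" "length al = m"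
     "\<And>R. (\<Prod>(x, y)\<in>{p \<in> samecol E A. A (fst p) \<in> {1..m}}. sgn (int (R y) - int (R x))) = wprod al R"
     "\<And>c j. wprod al c \<noteq> 0 \<Longrightarrow> j \<in> {1..m} \<Longrightarrow> inj_on c {k \<in> E. A k = j}" by blast
  obtain x y z where xyz: "{k \<in> E. A k = Suc m} = {x, y, z}" "x < y" "y < z"
  proof -
    have "card {k \<in> E. A k = Suc m} = 3" using Suc.prems by simp
    from ordered_triple[OF this] show thesis using that by metis
  qed
  have mem: "k \<in> E \<and> A k = Suc m \<longleftrightarrow> k = x \<or> k = y \<or> k = z" for k 
  proof -
    have "k \<in> E \<and> A k = Suc m \<longleftrightarrow> k \<in> {k \<in> E. A k = Suc m}" by simp
    then show ?thesis unfolding xyz(1) by simp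
  qed
  have sets: "{p \<in> samecol E A. A (fst p) \<in> {1..Suc m}} =
      {p \<in> samecol E A. A (fst p) \<in> {1..m}} \<union> {(x, y), (x, z), (y, z)}"
  proof -
    have "(a, b) \<in> samecol E A \<and> A a = Suc m \<longleftrightarrow> (a, b) \<in> {(x, y), (x, z), (y, z)}" for a b
    proof -
      have "(a, b) \<in> samecol E A \<and> A a = Suc m \<longleftrightarrow> (a \<in> E \<and> A a = Suc m) \<and> (b \<in> E \<and> A b = Suc m) \<and> a < b"
        by (auto simp: samecol_def)
      also have "\<dots> \<longleftrightarrow> (a, b) \<in> {(x, y), (x, z), (y, z)}" unfolding mem using xyz(2,3) by auto
      finally show ?thesis .
    qed
    moreover have "a \<in> {1..Suc m} \<longleftrightarrow> a \<in> {1..m} \<or> a = Suc m" for a by auto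
    ultimately have *: "(a, b) \<in> {p \<in> samecol E A. A (fst p) \<in> {1..Suc m}} \<longleftrightarrow>
      (a, b) \<in> {p \<in> samecol E A. A (fst p) \<in> {1..m}} \<union> {(x, y), (x, z), (y, z)}" for a b
      unfolding Un_iff mem_Collect_eq fst_conv by metis
    show ?thesis
    proof (rule set_eqI)
      fix p
      show "p \<in> {p \<in> samecol E A. A (fst p) \<in> {1..Suc m}} \<longleftrightarrow>
        p \<in> {p \<in> samecol E A. A (fst p) \<in> {1..m}} \<union> {(x, y), (x, z), (y, z)}"
        using *[of "fst p" "snd p"] by (simp only: prod.collapse)
    qed
  qed
  have disj: "{p \<in> samecol E A. A (fst p) \<in> {1..m}} \<inter> {(x, y), (x, z), (y, z)} = {}"
  proof -
    have "A x = Suc m" "A y = Suc m" using mem[of x] mem[of y] by blast+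
    then show ?thesis by auto
  qed
  have prod: "(\<Prod>(a, b)\<in>{p \<in> samecol E A. A (fst p) \<in> {1..Suc m}}. sgn (int (R b) - int (R a))) = wprod ((x, y, z) # al) R" for R
  proof -
    have "(\<Prod>(a, b)\<in>{(x, y), (x, z), (y, z)}. sgn (int (R b) - int (R a))) = eps (R x) (R y) (R z)"
      using xyz(2,3) by (simp add: eps_def)
    then show ?thesis unfolding sets
      by (subst prod.union_disjoint) (use fin disj al(4) in \<open>auto simp: mult.commute\<close>)
  qed
  have inj: "inj_on c {k \<in> E. A k = j}" if "wprod ((x, y, z) # al) c \<noteq> 0" "j \<in> {1..Suc m}" for c j
  proof (cases "j = Suc m")
    case True
    have "eps (c x) (c y) (c z) \<noteq> 0" using that(1) by auto
    then have "c x \<noteq> c y" "c x \<noteq> c z" "c y \<noteq> c z" by (auto simp: eps_def)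
    then show ?thesis unfolding True xyz(1) by auto
  next
    case False
    then show ?thesis using al(5)[of c j] that by auto
  qed
  have lb: "set (labs ((x, y, z) # al)) = {k \<in> E. A k \<in> {1..Suc m}}"
  proof -
    have "a \<in> {1..Suc m} \<longleftrightarrow> a \<in> {1..m} \<or> a = Suc m" for a by auto
    moreover have "x \<in> E" "y \<in> E" "z \<in> E" "A x = Suc m" "A y = Suc m" "A z = Suc m"
      using mem[of x] mem[of y] mem[of z] by blast+
    ultimately have "k \<in> set (labs ((x, y, z) # al)) \<longleftrightarrow> k \<in> {k \<in> E. A k \<in> {1..Suc m}}" for k
      using mem[of k] by (cases "k = x \<or> k = y \<or> k = z") (auto simp: al(2))
    then show ?thesis by blast
  qed
  have "A x = Suc m" "A y = Suc m" "A z = Suc m" using mem[of x] mem[of y] mem[of z] by blast+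
  then have "x \<notin> set (labs al)" "y \<notin> set (labs al)" "z \<notin> set (labs al)" unfolding al(2) by auto
  then have "distinct (labs ((x, y, z) # al))" using al(1) xyz by auto
  with lb al(3) prod inj show ?case by (intro exI[of _ "(x, y, z) # al"]) simp
qed

lemma vsgn_triples:
  assumes fin: "finite E" and al: "\<And>R. (\<Prod>(x, y)\<in>{p \<in> samecol E A. A (fst p) \<in> {1..m}}. sgn (int (R y) - int (R x))) = wprod al R"
  shows "vsgn E A R = wprod al R * (\<Prod>(x, y)\<in>{p \<in> samecol E A. A (fst p) \<notin> {1..m}}. sgn (int (R y) - int (R x)))"
proof -
  have "samecol E A = {p \<in> samecol E A. A (fst p) \<in> {1..m}} \<union> {p \<in> samecol E A. A (fst p) \<notin> {1..m}}" by blast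
  then have "vsgn E A R = (\<Prod>(x, y)\<in>{p \<in> samecol E A. A (fst p) \<in> {1..m}} \<union> {p \<in> samecol E A. A (fst p) \<notin> {1..m}}. sgn (int (R y) - int (R x)))"
    by (simp add: vsgn_def)
  also have "\<dots> = (\<Prod>(x, y)\<in>{p \<in> samecol E A. A (fst p) \<in> {1..m}}. sgn (int (R y) - int (R x))) *
     (\<Prod>(x, y)\<in>{p \<in> samecol E A. A (fst p) \<notin> {1..m}}. sgn (int (R y) - int (R x)))"
    by (rule prod.union_disjoint) (use fin in auto)
  finally show ?thesis unfolding al .
qed

text \<open>The contraction runs over all maps, the signed count over proper colourings only: maps
  that decode to no colouring must have weight 0.\<close>

lemma sum_transfer:
  fixes w :: "'a \<Rightarrow> int"
  assumes "finite C" and "\<And>R. R \<in> X \<Longrightarrow> \<exists>c\<in>C. dec c = R" "inj_on dec C"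
    "\<And>c. c \<in> C \<Longrightarrow> g c \<noteq> 0 \<Longrightarrow> dec c \<in> X" "\<And>c. c \<in> C \<Longrightarrow> dec c \<in> X \<Longrightarrow> w (dec c) = g c"
  shows "sum w X = sum g C"
proof -
  have "bij_betw dec {c \<in> C. dec c \<in> X} X"
    using assms(2,3) unfolding bij_betw_def inj_on_def by blast
  then have "sum w X = (\<Sum>c\<in>{c \<in> C. dec c \<in> X}. w (dec c))" by (rule sum.reindex_bij_betw[symmetric])
  also have "\<dots> = (\<Sum>c\<in>{c \<in> C. dec c \<in> X}. g c)" by (rule sum.cong) (use assms(5) in auto)
  also have "\<dots> = sum g C" by (rule sum.mono_neutral_left) (use assms(1,4) in auto)
  finally show ?thesis .
qed

lemma colvalid_if_inj:
  assumes "\<And>k. k \<in> E \<Longrightarrow> R k \<in> cs (A k)" "\<And>j. inj_on R {k \<in> E. A k = j}"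
    "\<And>j. card {k \<in> E. A k = j} = card (cs j)" "\<And>j. finite (cs j)"
  shows "colvalid E cs A R"
  unfolding colvalid_def bij_betw_def
proof (intro allI conjI assms(2))
  fix j
  have "R ` {k \<in> E. A k = j} \<subseteq> cs j" using assms(1) by blast
  moreover have "card (R ` {k \<in> E. A k = j}) = card (cs j)" using assms(2,3) by (simp add: card_image)
  ultimately show "R ` {k \<in> E. A k = j} = cs j" using assms(4) card_subset_eq by blast
qed

lemma wprod_shift: "wprod al (\<lambda>k. i + c k) = wprod al c"
  by (induction al) (auto simp: eps_def)

lemma cubic_dvd_cases:
  assumes "wff al bl"
  shows "length bl \<ge> 2 \<Longrightarrow> 12 dvd ncub al bl" "length bl \<ge> 3 \<Longrightarrow> 24 dvd ncub al bl"
proof -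
  have c: "cubic_dvd al bl" using cubic_divisibility[OF assms] .
  show 3: "24 dvd ncub al bl" if "length bl \<ge> 3" using c that by (simp add: cubic_dvd_def)
  show "12 dvd ncub al bl" if "length bl \<ge> 2"
  proof (cases "length bl = 2")
    case True then show ?thesis using c by (auto simp: cubic_dvd_def)
  next
    case False
    then have "24 dvd ncub al bl" using that 3 by simp
    then show ?thesis by (rule dvd_trans[rotated]) simp
  qed
qed

lemma wffI: "distinct (labs al) \<Longrightarrow> distinct (labs bl) \<Longrightarrow> set (labs al) = set (labs bl) \<Longrightarrow> wff al bl"
  unfolding wff_def by (metis set_eq_iff_mset_eq_distinct)

text \<open>There are m full columns and at most one shorter column, whose colours form an initial
  segment since row lengths decrease. The existence of \<open>R0\<close> gives the fibres of
  \<open>A\<close> and \<open>B\<close> the right sizes.\<close>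

locale three_rows =
  fixes E :: "nat set" and cs :: "nat \<Rightarrow> nat set" and A B :: "nat \<Rightarrow> nat" and i m :: nat and R0 :: "nat \<Rightarrow> nat"
  assumes fin: "finite E" and R0: "R0 \<in> colorings E cs A B"
    and full: "\<And>j. 1 \<le> j \<Longrightarrow> j \<le> m \<Longrightarrow> cs j = {i, i + 1, i + 2}"
    and other: "\<And>j. j = 0 \<or> j > Suc m \<Longrightarrow> cs j = {}"
    and extra: "cs (Suc m) \<in> {{}, {i}, {i, i + 1}}"
begin

lemma sub: "cs j \<subseteq> {i, i + 1, i + 2}"
proof -
  consider "j = 0 \<or> j > Suc m" | "j = Suc m" | "1 \<le> j" "j \<le> m" by linarith
  then show ?thesis
  proof cases
    case 1 then show ?thesis using other[of j] by simp
  next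
    case 2 then show ?thesis using extra by auto
  next
    case 3 then show ?thesis using full[of j] by simp
  qed
qed

lemma fin_cs: "finite (cs j)"
  using sub[of j] by (rule finite_subset) simp

lemma card_fibre:
  "card {k \<in> E. A k = j} = card (cs j)" "card {k \<in> E. B k = j} = card (cs j)"
  using R0 bij_betw_same_card unfolding colorings_def colvalid_def by blast+

lemma col_range: "k \<in> E \<Longrightarrow> A k \<in> {1..m} \<or> A k = Suc m" "k \<in> E \<Longrightarrow> B k \<in> {1..m} \<or> B k = Suc m"
proof -
  have *: "j \<in> {1..m} \<or> j = Suc m" if "cs j \<noteq> {}" for j
  proof -
    have "\<not> (j = 0 \<or> j > Suc m)" using other that by blast
    then show ?thesis by auto
  qed
  assume "k \<in> E"
  then have "R0 k \<in> cs (A k)" "R0 k \<in> cs (B k)" using R0 colvalid_in unfolding colorings_def by blast+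
  then show "A k \<in> {1..m} \<or> A k = Suc m" "B k \<in> {1..m} \<or> B k = Suc m" using * by blast+
qed

lemma card3: "\<forall>j\<in>{1..m}. card {k \<in> E. A k = j} = 3" "\<forall>j\<in>{1..m}. card {k \<in> E. B k = j} = 3"
  using card_fibre full by auto

lemma cs_triple: "j \<in> {1..m} \<Longrightarrow> a < 3 \<Longrightarrow> i + a \<in> cs j"
  using full[of j] by auto

lemma coloring_range: "R \<in> colorings E cs A B \<Longrightarrow> k \<in> E \<Longrightarrow> i \<le> R k \<and> R k < i + 3"
proof -
  assume "R \<in> colorings E cs A B" "k \<in> E"
  then have "R k \<in> cs (A k)" using colvalid_in unfolding colorings_def by blast
  then show ?thesis using sub[of "A k"] by auto
qed

lemma small_columns:
  assumes "card {k \<in> E. C k = Suc m} \<le> 1" "\<And>k. k \<in> E \<Longrightarrow> C k \<in> {1..m} \<or> C k = Suc m"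
  shows "{p \<in> samecol E C. C (fst p) \<notin> {1..m}} = {}"
proof -
  have "False" if "(x, y) \<in> samecol E C" "C x \<notin> {1..m}" for x y
  proof -
    have "x \<in> {k \<in> E. C k = Suc m}" "y \<in> {k \<in> E. C k = Suc m}" "x \<noteq> y"
      using that assms(2)[of x] by (auto simp: samecol_def)
    moreover have "\<forall>a\<in>{k \<in> E. C k = Suc m}. \<forall>b\<in>{k \<in> E. C k = Suc m}. a = b"
      using card_le_Suc0_iff_eq[of "{k \<in> E. C k = Suc m}"] fin assms(1) by simp
    ultimately show False by blast
  qed
  then show ?thesis by auto
qed

lemma none_dvd:
  assumes e: "cs (Suc m) = {}"
  shows "(2 \<le> m \<longrightarrow> 4 dvd sum (wt E A B) (colorings E cs A B)) \<and> (3 \<le> m \<longrightarrow> 8 dvd sum (wt E A B) (colorings E cs A B))"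
proof -
  have ne: "{k \<in> E. A k = Suc m} = {}" "{k \<in> E. B k = Suc m} = {}"
    using card_fibre[of "Suc m"] fin e by simp_all
  have rng: "A k \<in> {1..m}" "B k \<in> {1..m}" if "k \<in> E" for k using col_range[OF that] ne that by blast+
  obtain al where al: "distinct (labs al)" "set (labs al) = {k \<in> E. A k \<in> {1..m}}" "length al = m"
     "\<And>R. (\<Prod>(x, y)\<in>{p \<in> samecol E A. A (fst p) \<in> {1..m}}. sgn (int (R y) - int (R x))) = wprod al R"
     "\<And>c j. wprod al c \<noteq> 0 \<Longrightarrow> j \<in> {1..m} \<Longrightarrow> inj_on c {k \<in> E. A k = j}"
    using triples_of_columns[OF fin card3(1)] by blast
  obtain bl where bl: "distinct (labs bl)" "set (labs bl) = {k \<in> E. B k \<in> {1..m}}" "length bl = m"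
     "\<And>R. (\<Prod>(x, y)\<in>{p \<in> samecol E B. B (fst p) \<in> {1..m}}. sgn (int (R y) - int (R x))) = wprod bl R"
     "\<And>c j. wprod bl c \<noteq> 0 \<Longrightarrow> j \<in> {1..m} \<Longrightarrow> inj_on c {k \<in> E. B k = j}"
    using triples_of_columns[OF fin card3(2)] by blast
  have E: "set (labs al) = E" "set (labs bl) = E" using al(2) bl(2) rng by auto
  \<comment> \<open>The contraction uses the colours 0, 1, 2; shifting by i does not affect
    \<open>eps\<close>.\<close>
  define dec where "dec = (\<lambda>c k. if k \<in> E then i + c k else (0::nat))"
  have vs: "vsgn E A R = wprod al R" "vsgn E B R = wprod bl R" for R
  proof -
    have e: "{p \<in> samecol E A. A (fst p) \<notin> {1..m}} = {}" "{p \<in> samecol E B. B (fst p) \<notin> {1..m}} = {}"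
      using small_columns[of A] small_columns[of B] ne col_range by (metis card.empty zero_le)+
    show "vsgn E A R = wprod al R" "vsgn E B R = wprod bl R"
      unfolding vsgn_triples[OF fin al(4), of R] vsgn_triples[OF fin bl(4), of R] e by simp_all
  qed
  have wd: "wprod al (dec c) = wprod al c" "wprod bl (dec c) = wprod bl c" for c
  proof -
    have "wprod al (dec c) = wprod al (\<lambda>k. i + c k)" "wprod bl (dec c) = wprod bl (\<lambda>k. i + c k)"
      using E by (auto simp: dec_def intro: wprod_cong)
    then show "wprod al (dec c) = wprod al c" "wprod bl (dec c) = wprod bl c" by (simp_all add: wprod_shift)
  qed
  have "sum (wt E A B) (colorings E cs A B) = sum (\<lambda>c. wprod al c * wprod bl c) (E \<rightarrow>\<^sub>E {..<3})"
  proof (rule sum_transfer[where dec = dec])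
    show "finite (E \<rightarrow>\<^sub>E {..<3::nat})" using fin by (intro finite_PiE) auto
    show "\<exists>c\<in>E \<rightarrow>\<^sub>E {..<3}. dec c = R" if R: "R \<in> colorings E cs A B" for R
    proof (rule bexI[of _ "restrict (\<lambda>k. R k - i) E"])
      show "dec (restrict (\<lambda>k. R k - i) E) = R"
        using R coloring_range[OF R] by (auto simp: dec_def fun_eq_iff colorings_def)
      show "restrict (\<lambda>k. R k - i) E \<in> E \<rightarrow>\<^sub>E {..<3}" using coloring_range[OF R] by fastforce
    qed
    show "inj_on dec (E \<rightarrow>\<^sub>E {..<3})"
    proof (rule inj_onI)
      fix c d assume cd: "c \<in> E \<rightarrow>\<^sub>E {..<3::nat}" "d \<in> E \<rightarrow>\<^sub>E {..<3}" "dec c = dec d"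
      have "c k = d k" if "k \<in> E" for k using fun_cong[OF cd(3), of k] that by (simp add: dec_def)
      then show "c = d" using cd(1,2) by (metis PiE_ext)
    qed
    show "dec c \<in> colorings E cs A B" if c: "c \<in> E \<rightarrow>\<^sub>E {..<3}" "wprod al c * wprod bl c \<noteq> 0" for c
    proof -
      have mem: "dec c k \<in> cs j" if "k \<in> E" "j \<in> {1..m}" for k j
        using cs_triple[OF that(2), of "c k"] c(1) that(1) by (auto simp: dec_def)
      have "inj_on (dec c) {k \<in> E. A k = j}" for j
        using al(5)[of "dec c" j] wd(1) c(2) rng by (cases "j \<in> {1..m}") (auto simp: inj_on_def)
      moreover have "inj_on (dec c) {k \<in> E. B k = j}" for j
        using bl(5)[of "dec c" j] wd(2) c(2) rng by (cases "j \<in> {1..m}") (auto simp: inj_on_def)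
      ultimately have "colvalid E cs A (dec c)" "colvalid E cs B (dec c)"
        using colvalid_if_inj[of E "dec c" cs A] colvalid_if_inj[of E "dec c" cs B] mem rng card_fibre fin_cs by blast+
      then show ?thesis by (auto simp: colorings_def dec_def)
    qed
    show "wt E A B (dec c) = wprod al c * wprod bl c" for c by (simp add: wt_def vs wd)
  qed
  then have s: "sum (wt E A B) (colorings E cs A B) = ncub al bl" by (simp add: ncub_def E)
  have "wff al bl" using wffI al(1) bl(1) E by simp
  note cd = cubic_dvd_cases[OF this, unfolded bl(3)]
  have "4 dvd x" if "12 dvd x" for x :: int using that by presburger
  moreover have "8 dvd x" if "24 dvd x" for x :: int using that by presburger
  ultimately show ?thesis unfolding s using cd by blast
qed


lemma columns:
  assumes "C = A \<or> C = B"
  obtains al where "distinct (labs al)" "set (labs al) = {k \<in> E. C k \<in> {1..m}}" "length al = m"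
     "\<And>R. vsgn E C R = wprod al R * (\<Prod>(x, y)\<in>{p \<in> samecol E C. C (fst p) \<notin> {1..m}}. sgn (int (R y) - int (R x)))"
     "\<And>c j. wprod al c \<noteq> 0 \<Longrightarrow> j \<in> {1..m} \<Longrightarrow> inj_on c {k \<in> E. C k = j}"
proof -
  have "\<forall>j\<in>{1..m}. card {k \<in> E. C k = j} = 3" using card3 assms by blast
  from triples_of_columns[OF fin this] obtain al where al: "distinct (labs al)" "set (labs al) = {k \<in> E. C k \<in> {1..m}}" "length al = m"
     "\<And>R. (\<Prod>(x, y)\<in>{p \<in> samecol E C. C (fst p) \<in> {1..m}}. sgn (int (R y) - int (R x))) = wprod al R"
     "\<And>c j. wprod al c \<noteq> 0 \<Longrightarrow> j \<in> {1..m} \<Longrightarrow> inj_on c {k \<in> E. C k = j}" by blast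
  show thesis using that[OF al(1,2,3) vsgn_triples[OF fin al(4)] al(5)] by blast
qed

text \<open>The common part of the two cases with a shorter column: \<open>P\<close> prescribes the
  colour of the identified or added edge.\<close>

lemma transfer:
  assumes finL: "finite L"
    and enc: "\<And>R. R \<in> colorings E cs A B \<Longrightarrow> \<exists>c\<in>L \<rightarrow>\<^sub>E {..<3}. P c \<and> dec c = R"
    and inj: "\<And>c d k. c \<in> L \<rightarrow>\<^sub>E {..<3::nat} \<Longrightarrow> d \<in> L \<rightarrow>\<^sub>E {..<3} \<Longrightarrow> P c \<Longrightarrow> P d \<Longrightarrow> dec c = dec d \<Longrightarrow> k \<in> L \<Longrightarrow> c k = d k"
    and out: "\<And>c k. k \<notin> E \<Longrightarrow> dec c k = 0"
    and mem: "\<And>c k. c \<in> L \<rightarrow>\<^sub>E {..<3} \<Longrightarrow> P c \<Longrightarrow> wprod al c * wprod bl c \<noteq> 0 \<Longrightarrow> k \<in> E \<Longrightarrow> dec c k \<in> cs (A k) \<and> dec c k \<in> cs (B k)"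
    and injA: "\<And>c j. c \<in> L \<rightarrow>\<^sub>E {..<3} \<Longrightarrow> P c \<Longrightarrow> wprod al c * wprod bl c \<noteq> 0 \<Longrightarrow> inj_on (dec c) {k \<in> E. A k = j}"
    and injB: "\<And>c j. c \<in> L \<rightarrow>\<^sub>E {..<3} \<Longrightarrow> P c \<Longrightarrow> wprod al c * wprod bl c \<noteq> 0 \<Longrightarrow> inj_on (dec c) {k \<in> E. B k = j}"
    and w: "\<And>c. c \<in> L \<rightarrow>\<^sub>E {..<3} \<Longrightarrow> P c \<Longrightarrow> dec c \<in> colorings E cs A B \<Longrightarrow> wt E A B (dec c) = wprod al c * wprod bl c"
  shows "sum (wt E A B) (colorings E cs A B) = (\<Sum>c\<in>{c \<in> L \<rightarrow>\<^sub>E {..<3}. P c}. wprod al c * wprod bl c)"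
proof (rule sum_transfer[where dec = dec])
  show "finite {c \<in> L \<rightarrow>\<^sub>E {..<3::nat}. P c}" 
  proof -
    have "finite (L \<rightarrow>\<^sub>E {..<3::nat})" using finL by (intro finite_PiE) auto
    then show ?thesis by simp
  qed
  show "\<exists>c\<in>{c \<in> L \<rightarrow>\<^sub>E {..<3}. P c}. dec c = R" if R: "R \<in> colorings E cs A B" for R using enc[OF R] by blast
  show "inj_on dec {c \<in> L \<rightarrow>\<^sub>E {..<3}. P c}"
  proof (rule inj_onI)
    fix c d assume cd: "c \<in> {c \<in> L \<rightarrow>\<^sub>E {..<3::nat}. P c}" "d \<in> {c \<in> L \<rightarrow>\<^sub>E {..<3}. P c}" "dec c = dec d"
    then have "c k = d k" if "k \<in> L" for k using inj[of c d k] that by simp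
    then show "c = d" using cd(1,2) by (metis (mono_tags, lifting) PiE_ext mem_Collect_eq)
  qed
  fix c assume c: "c \<in> {c \<in> L \<rightarrow>\<^sub>E {..<3::nat}. P c}"
  show "dec c \<in> colorings E cs A B" if nz: "wprod al c * wprod bl c \<noteq> 0"
  proof -
    have "colvalid E cs A (dec c)"
      by (rule colvalid_if_inj) (use mem[of c] injA[of c] c nz card_fibre fin_cs in auto)
    moreover have "colvalid E cs B (dec c)"
      by (rule colvalid_if_inj) (use mem[of c] injB[of c] c nz card_fibre fin_cs in auto)
    ultimately show ?thesis using out by (simp add: colorings_def)
  qed
  show "wt E A B (dec c) = wprod al c * wprod bl c" if "dec c \<in> colorings E cs A B"
    using w[of c] c that by simp
qed

lemma dvd_third:
  fixes x y :: int
  assumes "x = 3 * y" shows "12 dvd x \<Longrightarrow> 4 dvd y" "24 dvd x \<Longrightarrow> 8 dvd y"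
  using assms by presburger+

text \<open>The last column has one edge on each side, of colour \<open>i\<close>; identifying these two edges gives a cubic
  graph with an edge of prescribed colour, which accounts for a third of its colourings.\<close>

lemma single_dvd:
  assumes e: "cs (Suc m) = {i}"
  shows "(2 \<le> m \<longrightarrow> 4 dvd sum (wt E A B) (colorings E cs A B)) \<and> (3 \<le> m \<longrightarrow> 8 dvd sum (wt E A B) (colorings E cs A B))"
proof -
  have c1: "card {k \<in> E. A k = Suc m} = 1" "card {k \<in> E. B k = Suc m} = 1"
    using card_fibre[of "Suc m"] e by simp_all
  then obtain x y where xy: "{k \<in> E. A k = Suc m} = {x}" "{k \<in> E. B k = Suc m} = {y}" by (meson card_1_singletonE)
  have mx: "k \<in> E \<and> A k = Suc m \<longleftrightarrow> k = x" and my: "k \<in> E \<and> B k = Suc m \<longleftrightarrow> k = y" for k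
    using eqset_imp_iff[OF xy(1), of k] eqset_imp_iff[OF xy(2), of k] by simp_all
  have xE: "x \<in> E" "A x = Suc m" and yE: "y \<in> E" "B y = Suc m" using mx[of x] my[of y] by blast+
  have rA: "A k \<in> {1..m} \<longleftrightarrow> k \<noteq> x" if "k \<in> E" for k using col_range(1)[OF that] mx[of k] that by auto
  have rB: "B k \<in> {1..m} \<longleftrightarrow> k \<noteq> y" if "k \<in> E" for k using col_range(2)[OF that] my[of k] that by auto
  obtain al where al: "distinct (labs al)" "set (labs al) = {k \<in> E. A k \<in> {1..m}}" "length al = m"
     "\<And>R. vsgn E A R = wprod al R * (\<Prod>(x, y)\<in>{p \<in> samecol E A. A (fst p) \<notin> {1..m}}. sgn (int (R y) - int (R x)))"
     "\<And>c j. wprod al c \<noteq> 0 \<Longrightarrow> j \<in> {1..m} \<Longrightarrow> inj_on c {k \<in> E. A k = j}" using columns[of A] by blast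
  obtain bl where bl: "distinct (labs bl)" "set (labs bl) = {k \<in> E. B k \<in> {1..m}}" "length bl = m"
     "\<And>R. vsgn E B R = wprod bl R * (\<Prod>(x, y)\<in>{p \<in> samecol E B. B (fst p) \<notin> {1..m}}. sgn (int (R y) - int (R x)))"
     "\<And>c j. wprod bl c \<noteq> 0 \<Longrightarrow> j \<in> {1..m} \<Longrightarrow> inj_on c {k \<in> E. B k = j}" using columns[of B] by blast
  have lab: "set (labs al) = E - {x}" "set (labs bl) = E - {y}" using al(2) bl(2) rA rB by auto
  have e0: "{p \<in> samecol E A. A (fst p) \<notin> {1..m}} = {}" "{p \<in> samecol E B. B (fst p) \<notin> {1..m}} = {}"
    using small_columns[of A] small_columns[of B] c1 col_range by (metis order_refl)+
  have vs: "vsgn E A R = wprod al R" "vsgn E B R = wprod bl R" for R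
    unfolding al(4)[of R] bl(4)[of R] e0 by simp_all
  define dec where "dec = (\<lambda>c k. if k = y then i else if k \<in> E then i + c k else (0::nat))"
  \<comment> \<open>The triples of the first side miss x and those of the second side miss y;
    renaming y to x gives both sides the same labels.\<close>
  define ren where "ren = (\<lambda>k. if k = y then x else k)"
  define al' where "al' = map (\<lambda>(a, b, c). (ren a, ren b, ren c)) al"
  \<comment> \<open>If x = y, the last column is an isolated edge and no colour has to be prescribed
    in the cubic graph.\<close>
  define P where "P = (\<lambda>c. x = y \<or> c x = (0::nat))"
  have labal': "labs al' = map ren (labs al)" by (simp add: al'_def labs_def map_concat comp_def case_prod_unfold)
  have wal': "wprod al' c = wprod al (\<lambda>k. c (ren k))" for c
    unfolding al'_def by (induction al) auto
  have wB: "wprod bl (dec c) = wprod bl c" for c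
  proof -
    have "wprod bl (dec c) = wprod bl (\<lambda>k. i + c k)" using lab by (intro wprod_cong) (auto simp: dec_def)
    then show ?thesis by (simp add: wprod_shift)
  qed
  have wA: "wprod al (dec c) = wprod al' c" if "P c" for c
  proof -
    have "wprod al (dec c) = wprod al (\<lambda>k. i + c (ren k))"
      using lab that by (intro wprod_cong) (auto simp: dec_def ren_def P_def)
    then show ?thesis by (simp add: wprod_shift wal')
  qed
  have decx: "dec c x = i" if "P c" for c using that xE by (auto simp: dec_def P_def)
  have decy: "dec c y = i" for c by (simp add: dec_def)
  have colx: "R x = i" "R y = i" if "R \<in> colorings E cs A B" for R
    using that colvalid_in[of E cs A R x] colvalid_in[of E cs B R y] xE yE e by (auto simp: colorings_def)
  have sum: "sum (wt E A B) (colorings E cs A B) = (\<Sum>c\<in>{c \<in> (E - {y}) \<rightarrow>\<^sub>E {..<3}. P c}. wprod al' c * wprod bl c)"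
  proof (rule transfer[where dec = dec])
    show "finite (E - {y})" using fin by simp
    show "dec c k = 0" if "k \<notin> E" for c k using that yE by (auto simp: dec_def)
    show "\<exists>c\<in>(E - {y}) \<rightarrow>\<^sub>E {..<3}. P c \<and> dec c = R" if R: "R \<in> colorings E cs A B" for R
    proof (intro bexI[of _ "restrict (\<lambda>k. R k - i) (E - {y})"] conjI)
      show "dec (restrict (\<lambda>k. R k - i) (E - {y})) = R"
        using R coloring_range[OF R] colx[OF R] by (auto simp: dec_def fun_eq_iff colorings_def)
      show "restrict (\<lambda>k. R k - i) (E - {y}) \<in> (E - {y}) \<rightarrow>\<^sub>E {..<3}"
      proof -
        have "R k - i < 3" if "k \<in> E" for k using coloring_range[OF R that] by linarith
        then show ?thesis by (auto simp: restrict_PiE_iff)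
      qed
      show "P (restrict (\<lambda>k. R k - i) (E - {y}))" using colx[OF R] xE by (auto simp: P_def)
    qed
    show "c k = d k" if "dec c = dec d" "k \<in> E - {y}" for c d k
      using fun_cong[OF that(1), of k] that(2) by (auto simp: dec_def)
    show "wt E A B (dec c) = wprod al' c * wprod bl c" if "P c" for c by (simp add: wt_def vs wA[OF that] wB)
    fix c assume c: "c \<in> (E - {y}) \<rightarrow>\<^sub>E {..<3}" "P c" "wprod al' c * wprod bl c \<noteq> 0"
    have rng: "dec c k \<in> cs j" if "k \<in> E" "j \<in> {1..m}" for k j
    proof (cases "k = y")
      case True then show ?thesis using cs_triple[OF that(2), of 0] by (simp add: dec_def)
    next
      case False
      then have "c k < 3" using c(1) that(1) by auto
      then show ?thesis using cs_triple[OF that(2), of "c k"] that False by (simp add: dec_def)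
    qed
    show "dec c k \<in> cs (A k) \<and> dec c k \<in> cs (B k)" if k: "k \<in> E" for k
      using rng[OF k, of "A k"] rng[OF k, of "B k"] rA[OF k] rB[OF k] decx[OF c(2)] decy[of c] xE yE e by fastforce
    show "inj_on (dec c) {k \<in> E. A k = j}" for j
    proof (cases "j \<in> {1..m}")
      case True
      show ?thesis by (rule al(5)) (use True c wA in auto)
    next
      case False
      then have "{k \<in> E. A k = j} \<subseteq> {x}" using rA by auto
      then show ?thesis by (rule inj_on_subset[rotated]) simp
    qed
    show "inj_on (dec c) {k \<in> E. B k = j}" for j
    proof (cases "j \<in> {1..m}")
      case True
      show ?thesis by (rule bl(5)) (use True c wB in auto)
    next
      case False
      then have "{k \<in> E. B k = j} \<subseteq> {y}" using rB by auto
      then show ?thesis by (rule inj_on_subset[rotated]) simp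
    qed
  qed
  have "inj_on ren (E - {x})" by (auto simp: inj_on_def ren_def)
  then have "distinct (labs al')" using al(1) lab unfolding labal' by (simp add: distinct_map)
  moreover have "set (labs al') = E - {y}"
    unfolding labal' using lab xE yE by (auto simp: ren_def image_iff)
  ultimately have wf: "wff al' bl" and labs': "set (labs al') = set (labs bl)" using wffI bl(1) lab by simp_all
  note cd = cubic_dvd_cases[OF wf, unfolded bl(3)]
  show ?thesis
  proof (cases "x = y")
    case True
    then have "sum (wt E A B) (colorings E cs A B) = ncub al' bl"
      unfolding sum ncub_def lab by (simp add: P_def)
    moreover have "4 dvd z" if "12 dvd z" for z :: int using that by presburger
    moreover have "8 dvd z" if "24 dvd z" for z :: int using that by presburger
    ultimately show ?thesis using cd by metis
  next
    case False
    then have "x \<in> set (labs bl)" using lab xE by simp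
    from ncub_fixed_color[OF this _ labs', of 0] False
    have "ncub al' bl = 3 * sum (wt E A B) (colorings E cs A B)"
      unfolding sum lab P_def by simp
    from dvd_third[OF this] cd show ?thesis by blast
  qed
qed

text \<open>A new edge \<open>\<kappa>\<close> of prescribed third colour joins the two columns of length two.\<close>

lemma pair_dvd:
  assumes e: "cs (Suc m) = {i, i + 1}"
  shows "(2 \<le> Suc m \<longrightarrow> 4 dvd sum (wt E A B) (colorings E cs A B)) \<and> (3 \<le> Suc m \<longrightarrow> 8 dvd sum (wt E A B) (colorings E cs A B))"
proof -
  have c2: "card {k \<in> E. A k = Suc m} = 2" "card {k \<in> E. B k = Suc m} = 2"
    using card_fibre[of "Suc m"] e by simp_all
  obtain xa ya where xa: "{k \<in> E. A k = Suc m} = {xa, ya}" "xa < ya" using ordered_pair[OF c2(1)] .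
  obtain xb yb where xb: "{k \<in> E. B k = Suc m} = {xb, yb}" "xb < yb" using ordered_pair[OF c2(2)] .
  have ma: "k \<in> E \<and> A k = Suc m \<longleftrightarrow> k = xa \<or> k = ya" and mb: "k \<in> E \<and> B k = Suc m \<longleftrightarrow> k = xb \<or> k = yb" for k
    using eqset_imp_iff[OF xa(1), of k] eqset_imp_iff[OF xb(1), of k] by simp_all
  have inE: "xa \<in> E" "A xa = Suc m" "ya \<in> E" "A ya = Suc m" "xb \<in> E" "B xb = Suc m" "yb \<in> E" "B yb = Suc m"
    using ma[of xa] ma[of ya] mb[of xb] mb[of yb] by blast+
  have rA: "A k \<in> {1..m} \<longleftrightarrow> k \<noteq> xa \<and> k \<noteq> ya" if "k \<in> E" for k using col_range(1)[OF that] ma[of k] that by auto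
  have rB: "B k \<in> {1..m} \<longleftrightarrow> k \<noteq> xb \<and> k \<noteq> yb" if "k \<in> E" for k using col_range(2)[OF that] mb[of k] that by auto
  obtain al where al: "distinct (labs al)" "set (labs al) = {k \<in> E. A k \<in> {1..m}}" "length al = m"
     "\<And>R. vsgn E A R = wprod al R * (\<Prod>(x, y)\<in>{p \<in> samecol E A. A (fst p) \<notin> {1..m}}. sgn (int (R y) - int (R x)))"
     "\<And>c j. wprod al c \<noteq> 0 \<Longrightarrow> j \<in> {1..m} \<Longrightarrow> inj_on c {k \<in> E. A k = j}" using columns[of A] by blast
  obtain bl where bl: "distinct (labs bl)" "set (labs bl) = {k \<in> E. B k \<in> {1..m}}" "length bl = m"
     "\<And>R. vsgn E B R = wprod bl R * (\<Prod>(x, y)\<in>{p \<in> samecol E B. B (fst p) \<notin> {1..m}}. sgn (int (R y) - int (R x)))"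
     "\<And>c j. wprod bl c \<noteq> 0 \<Longrightarrow> j \<in> {1..m} \<Longrightarrow> inj_on c {k \<in> E. B k = j}" using columns[of B] by blast
  have lab: "set (labs al) = E - {xa, ya}" "set (labs bl) = E - {xb, yb}" using al(2) bl(2) rA rB by auto
  have e0: "{p \<in> samecol E A. A (fst p) \<notin> {1..m}} = {(xa, ya)}" "{p \<in> samecol E B. B (fst p) \<notin> {1..m}} = {(xb, yb)}"
  proof -
    have "p \<in> samecol E A \<and> A (fst p) \<notin> {1..m} \<longleftrightarrow> p = (xa, ya)" for p
      using ma[of "fst p"] ma[of "snd p"] rA[of "fst p"] xa(2) inE by (cases p) (auto simp: samecol_def)
    then show "{p \<in> samecol E A. A (fst p) \<notin> {1..m}} = {(xa, ya)}" by auto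
    have "p \<in> samecol E B \<and> B (fst p) \<notin> {1..m} \<longleftrightarrow> p = (xb, yb)" for p
      using mb[of "fst p"] mb[of "snd p"] rB[of "fst p"] xb(2) inE by (cases p) (auto simp: samecol_def)
    then show "{p \<in> samecol E B. B (fst p) \<notin> {1..m}} = {(xb, yb)}" by auto
  qed
  have vs: "vsgn E A R = wprod al R * sgn (int (R ya) - int (R xa))" "vsgn E B R = wprod bl R * sgn (int (R yb) - int (R xb))" for R
    unfolding al(4)[of R] bl(4)[of R] e0 by simp_all
  obtain \<kappa> where \<kappa>: "\<kappa> \<notin> E" using ex_new_if_finite[OF _ fin] by auto
  define al' bl' where "al' = (xa, ya, \<kappa>) # al" and "bl' = (xb, yb, \<kappa>) # bl"
  define dec where "dec = (\<lambda>c k. if k \<in> E then i + c k else (0::nat))"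
  define P where "P = (\<lambda>c. c \<kappa> = (2::nat))"
  have wB: "wprod bl (dec c) = wprod bl c" and wA: "wprod al (dec c) = wprod al c" for c
  proof -
    have "wprod bl (dec c) = wprod bl (\<lambda>k. i + c k)" "wprod al (dec c) = wprod al (\<lambda>k. i + c k)"
      by (rule wprod_cong; use lab in \<open>simp add: dec_def\<close>)+
    then show "wprod bl (dec c) = wprod bl c" "wprod al (dec c) = wprod al c" by (simp_all add: wprod_shift)
  qed
  have colx: "R k \<in> {i, i + 1}" if "R \<in> colorings E cs A B" "k \<in> {xa, ya, xb, yb}" for R k
    using that colvalid_in[of E cs A R k] colvalid_in[of E cs B R k] inE e by (auto simp: colorings_def)
  \<comment> \<open>With colour 2 on the added edge, \<open>eps\<close> at the new vertex is the
    sign of the two edges of the short column, and it is nonzero only if these have the colours 0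
    and 1.\<close>
  have eps2: "eps a b 2 = sgn (int b - int a)" if "a < 2" "b < 2" for a b using that by (simp add: eps_def)
  have eps2': "a < 2" "b < 2" "a \<noteq> b" if "eps a b 2 \<noteq> 0" "a < 3" "b < 3" for a b
    using that by (auto simp: eps_def less_Suc_eq numeral_3_eq_3)
  have sum: "sum (wt E A B) (colorings E cs A B) = (\<Sum>c\<in>{c \<in> insert \<kappa> E \<rightarrow>\<^sub>E {..<3}. P c}. wprod al' c * wprod bl' c)"
  proof (rule transfer[where dec = dec])
    show "finite (insert \<kappa> E)" using fin by simp
    show "dec c k = 0" if "k \<notin> E" for c k using that by (auto simp: dec_def)
    show "\<exists>c\<in>insert \<kappa> E \<rightarrow>\<^sub>E {..<3}. P c \<and> dec c = R" if R: "R \<in> colorings E cs A B" for R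
    proof (intro bexI[of _ "restrict (\<lambda>k. if k = \<kappa> then 2 else R k - i) (insert \<kappa> E)"] conjI)
      show "dec (restrict (\<lambda>k. if k = \<kappa> then 2 else R k - i) (insert \<kappa> E)) = R"
        using R coloring_range[OF R] \<kappa> by (auto simp: dec_def fun_eq_iff colorings_def)
      show "restrict (\<lambda>k. if k = \<kappa> then 2 else R k - i) (insert \<kappa> E) \<in> insert \<kappa> E \<rightarrow>\<^sub>E {..<3}"
      proof -
        have "R k - i < 3" if "k \<in> E" for k using coloring_range[OF R that] by linarith
        then show ?thesis by (auto simp: restrict_PiE_iff)
      qed
      show "P (restrict (\<lambda>k. if k = \<kappa> then 2 else R k - i) (insert \<kappa> E))" by (simp add: P_def)
    qed
    show "c k = d k" if "dec c = dec d" "k \<in> insert \<kappa> E" "P c" "P d" for c d k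
      using fun_cong[OF that(1), of k] that by (auto simp: dec_def P_def)
    show "wt E A B (dec c) = wprod al' c * wprod bl' c" if "P c" "dec c \<in> colorings E cs A B" for c
    proof -
      have "c k < 2" if "k \<in> {xa, ya, xb, yb}" for k
        using colx[OF \<open>dec c \<in> colorings E cs A B\<close> that] that inE by (auto simp: dec_def)
      moreover have "dec c xa = i + c xa" "dec c ya = i + c ya" "dec c xb = i + c xb" "dec c yb = i + c yb"
        using inE by (simp_all add: dec_def)
      ultimately show ?thesis using that(1) eps2
        by (simp add: wt_def vs wA wB al'_def bl'_def P_def algebra_simps)
    qed
    fix c assume c: "c \<in> insert \<kappa> E \<rightarrow>\<^sub>E {..<3}" "P c" "wprod al' c * wprod bl' c \<noteq> 0"
    have c3: "c k < 3" if "k \<in> E" for k using c(1) that by auto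
    have nz: "wprod al c \<noteq> 0" "wprod bl c \<noteq> 0" "eps (c xa) (c ya) 2 \<noteq> 0" "eps (c xb) (c yb) 2 \<noteq> 0"
      using c(2,3) by (auto simp: al'_def bl'_def P_def)
    note small = eps2'[OF nz(3) c3[OF inE(1)] c3[OF inE(3)]] eps2'[OF nz(4) c3[OF inE(5)] c3[OF inE(7)]]
    have rng: "dec c k \<in> cs j" if "k \<in> E" "j \<in> {1..m}" for k j
      using cs_triple[OF that(2) c3[OF that(1)]] that(1) by (simp add: dec_def)
    have ext: "dec c k \<in> cs (Suc m)" if "k \<in> {xa, ya, xb, yb}" for k
    proof -
      have "c k < 2" "k \<in> E" using small inE that by auto
      then show ?thesis unfolding e dec_def by auto
    qed
    show "dec c k \<in> cs (A k) \<and> dec c k \<in> cs (B k)" if k: "k \<in> E" for k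
      using rng[OF k, of "A k"] rng[OF k, of "B k"] rA[OF k] rB[OF k] ext[of k] inE by fastforce
    show "inj_on (dec c) {k \<in> E. A k = j}" for j
    proof (cases "j \<in> {1..m}")
      case True
      show ?thesis by (rule al(5)) (use True nz wA in auto)
    next
      case False
      then have "{k \<in> E. A k = j} \<subseteq> {xa, ya}" using rA by auto
      moreover have "inj_on (dec c) {xa, ya}" using small inE by (auto simp: dec_def)
      ultimately show ?thesis by (metis inj_on_subset)
    qed
    show "inj_on (dec c) {k \<in> E. B k = j}" for j
    proof (cases "j \<in> {1..m}")
      case True
      show ?thesis by (rule bl(5)) (use True nz wB in auto)
    next
      case False
      then have "{k \<in> E. B k = j} \<subseteq> {xb, yb}" using rB by auto
      moreover have "inj_on (dec c) {xb, yb}" using small inE by (auto simp: dec_def)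
      ultimately show ?thesis by (metis inj_on_subset)
    qed
  qed
  have "distinct (labs al')" "distinct (labs bl')" using al(1) bl(1) lab \<kappa> xa(2) xb(2) inE by (auto simp: al'_def bl'_def)
  moreover have l': "set (labs al') = insert \<kappa> E" "set (labs bl') = insert \<kappa> E" using lab inE by (auto simp: al'_def bl'_def)
  ultimately have wf: "wff al' bl'" using wffI by simp
  \<comment> \<open>The short column has become a vertex of degree 3, so the bounds refer to
    \<open>Suc m\<close>.\<close>
  have len: "length bl' = Suc m" using bl(3) by (simp add: bl'_def)
  note cd = cubic_dvd_cases[OF wf, unfolded len]
  have "ncub al' bl' = 3 * sum (wt E A B) (colorings E cs A B)"
    unfolding sum P_def using ncub_fixed_color[of \<kappa> bl' 2 al'] l' by simp
  from dvd_third[OF this] cd show ?thesis by blast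
qed

end

section \<open>Sums over fibres: conditions (2), (4) and (5)\<close>

section \<open>Blocks of rows\<close>

text \<open>Pairs with an edge outside \<open>E'\<close> contribute a factor depending on
  \<open>R0\<close> only, so on a fibre the sign is that of the subgraph up to a constant.\<close>

lemma vsgn_fibre:
  assumes fin: "finite E" and sub: "E' \<subseteq> E"
    and eq: "\<And>x y. x \<in> E \<Longrightarrow> y \<in> E \<Longrightarrow> \<not> (x \<in> E' \<and> y \<in> E') \<Longrightarrow>
      sgn (int (R y) - int (R x)) = sgn (int (R0 y) - int (R0 x))"
  shows "vsgn E A R = vsgn E' A R * (\<Prod>(x, y)\<in>samecol E A - samecol E' A. sgn (int (R0 y) - int (R0 x)))"
proof -
  have s: "samecol E' A \<subseteq> samecol E A" using sub by (auto simp: samecol_def)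
  have "vsgn E A R = (\<Prod>(x, y)\<in>samecol E A - samecol E' A. sgn (int (R y) - int (R x))) * vsgn E' A R"
    unfolding vsgn_def by (rule prod.subset_diff[OF s]) (use fin in simp)
  also have "(\<Prod>(x, y)\<in>samecol E A - samecol E' A. sgn (int (R y) - int (R x))) =
     (\<Prod>(x, y)\<in>samecol E A - samecol E' A. sgn (int (R0 y) - int (R0 x)))"
    by (rule prod.cong[OF refl]) (auto simp: samecol_def intro: eq)
  finally show ?thesis by simp
qed

lemma vsgn_restrict: "(\<And>k. k \<in> E \<Longrightarrow> R k = R' k) \<Longrightarrow> vsgn E A R = vsgn E A R'"
  unfolding vsgn_def by (rule prod.cong[OF refl]) (auto simp: samecol_def)

context
  fixes n :: nat and lam :: "nat \<Rightarrow> nat" and A B :: "nat \<Rightarrow> nat"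
  assumes part: "is_partition n lam"
begin

abbreviation "cols \<equiv> colorings {1..n} (cset lam) A B"

lemma finite_cols: "finite cols"
  using finite_colorings finite_cset[OF part] by blast

lemma cset0: "0 \<notin> cset lam j" by (simp add: cset_iff)

lemma triple_fibre:
  assumes i: "1 \<le> i" and le: "lam i \<le> lam (i + 2) + 1" and R0: "R0 \<in> cols"
  defines "S \<equiv> sum (wt {1..n} A B) {R \<in> cols. erase {i, i + 1, i + 2} R = erase {i, i + 1, i + 2} R0}"
  shows "(2 \<le> lam (i + 1) \<longrightarrow> 4 dvd S) \<and> (3 \<le> lam (i + 1) \<longrightarrow> 8 dvd S)"
proof -
  define T where "T = {i, i + 1, i + 2}"
  define E' where "E' = {k \<in> {1..n}. R0 k \<in> T}"
  define cs' where "cs' = (\<lambda>j. cset lam j \<inter> T)"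
  have T0: "0 \<notin> T" using i by (auto simp: T_def)
  note fb = fibre_bij[OF R0 cset0 T0, folded E'_def cs'_def]
  let ?Y = "{R \<in> cols. erase T R = erase T R0}"
  let ?res = "\<lambda>R k. if k \<in> E' then R k else 0"
  define \<kappa> where "\<kappa> = (\<lambda>C. \<Prod>(x, y)\<in>samecol {1..n} C - samecol E' C. sgn (int (R0 y) - int (R0 x)))"
  have w: "wt {1..n} A B R = (\<kappa> A * \<kappa> B) * wt E' A B (?res R)" if R: "R \<in> ?Y" for R
  proof -
    have inT: "R k \<in> T \<longleftrightarrow> k \<in> E'" if "k \<in> {1..n}" for k
      using fibre_in[OF R0 cset0 T0] R that unfolding E'_def by blast
    have outT: "R k = R0 k" if "k \<notin> E'" for k
      using fibre_out[OF R0 cset0 T0] R that unfolding E'_def by blast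
    have seq: "sgn (int (R y) - int (R x)) = sgn (int (R0 y) - int (R0 x))"
      if "x \<in> {1..n}" "y \<in> {1..n}" "\<not> (x \<in> E' \<and> y \<in> E')" for x y
    proof -
      \<comment> \<open>\<open>T\<close> consists of consecutive rows, so a colour outside
        \<open>T\<close> is smaller than all of its elements or larger than all of them.\<close>
      have T: "a \<in> T \<Longrightarrow> b \<in> T \<Longrightarrow> c \<notin> T \<Longrightarrow> sgn (int a - int c) = sgn (int b - int c) \<and> sgn (int c - int a) = sgn (int c - int b)" for a b c
        by (auto simp: T_def sgn_if)
      have R0T: "R0 k \<in> T \<longleftrightarrow> k \<in> E'" if "k \<in> {1..n}" for k using that by (simp add: E'_def)
      show ?thesis
      proof (cases "x \<in> E'")
        case True
        then have "y \<notin> E'" using that by blast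
        then show ?thesis using T[of "R x" "R0 x" "R0 y"] True inT[OF that(1)] R0T[OF that(1)] R0T[OF that(2)] outT by simp
      next
        case False
        show ?thesis
        proof (cases "y \<in> E'")
          case True
          then show ?thesis using T[of "R y" "R0 y" "R0 x"] False inT[OF that(2)] R0T[OF that(1)] R0T[OF that(2)] outT by simp
        next
          case False': False
          then show ?thesis using False outT by simp
        qed
      qed
    qed
    have sub: "E' \<subseteq> {1..n}" by (auto simp: E'_def)
    have "vsgn {1..n} C R = vsgn E' C (?res R) * \<kappa> C" for C
    proof -
      have "vsgn {1..n} C R = vsgn E' C R * \<kappa> C"
        unfolding \<kappa>_def by (rule vsgn_fibre[OF finite_atLeastAtMost sub seq])
      moreover have "vsgn E' C R = vsgn E' C (?res R)" by (rule vsgn_restrict) simp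
      ultimately show ?thesis by simp
    qed
    then show ?thesis by (simp add: wt_def algebra_simps)
  qed
  have "S = (\<Sum>R\<in>?Y. (\<kappa> A * \<kappa> B) * wt E' A B (?res R))"
    unfolding S_def T_def[symmetric] by (rule sum.cong[OF refl]) (rule w)
  also have "\<dots> = (\<kappa> A * \<kappa> B) * (\<Sum>R\<in>?Y. wt E' A B (?res R))" by (simp add: sum_distrib_left)
  also have "(\<Sum>R\<in>?Y. wt E' A B (?res R)) = sum (wt E' A B) (colorings E' cs' A B)"
    by (rule sum.reindex_bij_betw[OF fb])
  finally have S: "S = (\<kappa> A * \<kappa> B) * sum (wt E' A B) (colorings E' cs' A B)" .
  define m where "m = lam (i + 2)"
  have l: "lam (i + 2) \<le> lam (i + 1)" "lam (i + 1) \<le> lam i"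
    using antitone[OF part, of "i + 1" "i + 2"] antitone[OF part, of i "i + 1"] i by simp_all
  have R0': "?res R0 \<in> colorings E' cs' A B" using bij_betwE[OF fb] R0 by blast
  interpret three_rows E' cs' A B i m "?res R0"
  proof
    show "finite E'" by (simp add: E'_def)
    show "?res R0 \<in> colorings E' cs' A B" by (rule R0')
    show "cs' j = {i, i + 1, i + 2}" if "1 \<le> j" "j \<le> m" for j
      using that l i by (auto simp: cs'_def T_def cset_iff m_def)
    show "cs' j = {}" if "j = 0 \<or> j > Suc m" for j
      using that l le by (auto simp: cs'_def T_def cset_iff m_def)
    show "cs' (Suc m) \<in> {{}, {i}, {i, i + 1}}"
      using l le i by (cases "lam i = Suc m"; cases "lam (i + 1) = Suc m") (auto simp: cs'_def T_def cset_iff m_def)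
  qed
  let ?\<Sigma> = "sum (wt E' A B) (colorings E' cs' A B)"
  \<comment> \<open>If row i + 1 is longer than row i + 2, the short column counts as a vertex as
    well, so in every case the number of vertices on a side is \<open>lam (i + 1)\<close>.\<close>
  have "(2 \<le> lam (i + 1) \<longrightarrow> 4 dvd ?\<Sigma>) \<and> (3 \<le> lam (i + 1) \<longrightarrow> 8 dvd ?\<Sigma>)"
  proof (cases "lam (i + 1) = Suc m")
    case True
    then have "lam i = Suc m" using l le by (simp add: m_def)
    then have "cs' (Suc m) = {i, i + 1}" using True i by (auto simp: cs'_def T_def cset_iff m_def)
    from pair_dvd[OF this] True show ?thesis by simp
  next
    case False
    then have m: "lam (i + 1) = m" using l le by (simp add: m_def)
    have "cs' (Suc m) = {} \<or> cs' (Suc m) = {i}"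
      using l le i m by (cases "lam i = Suc m") (auto simp: cs'_def T_def cset_iff m_def)
    then show ?thesis using none_dvd single_dvd unfolding m by blast
  qed
  then show ?thesis unfolding S by (simp add: dvd_mult)
qed

lemma dvd8_triple:
  assumes "1 \<le> i" "lam i \<le> lam (i + 2) + 1" "lam (i + 1) \<ge> 3"
  shows "8 dvd sum (wt {1..n} A B) cols"
proof -
  let ?e = "erase {i, i + 1, i + 2}"
  have "sum (wt {1..n} A B) cols = (\<Sum>c\<in>?e ` cols. \<Sum>R\<in>{R \<in> cols. ?e R = c}. wt {1..n} A B R)"
    by (rule sum.image_gen[OF finite_cols])
  also have "8 dvd \<dots>"
    by (rule dvd_sum) (use triple_fibre[OF assms(1,2)] assms(3) in auto)
  finally show ?thesis .
qed

text \<open>Each fibre sum is a multiple of 4. Swapping the rows j and j + 1 permutes the fibres and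
  preserves their sums, and it fixes none of them because the colour j survives the erasure; this
  gives another factor 2.\<close>

lemma dvd8_triple_pair:
  assumes i: "1 \<le> i" "lam i \<le> lam (i + 2) + 1" "lam (i + 1) \<ge> 2"
    and j: "1 \<le> j" "lam j = lam (j + 1)" "lam j > 0" and disj: "{i, i + 1, i + 2} \<inter> {j, j + 1} = {}"
  shows "8 dvd sum (wt {1..n} A B) cols"
proof -
  define T where "T = {i, i + 1, i + 2}"
  let ?e = "erase T"
  define p where "p = transpose j (j + 1)"
  define g where "g = (\<lambda>c. \<Sum>R\<in>{R \<in> cols. ?e R = c}. wt {1..n} A B R)"
  have pT: "p a \<in> T \<longleftrightarrow> a \<in> T" "p 0 = 0" for a using disj j by (auto simp: p_def T_def transpose_def)
  have pin: "inj p" "\<And>k. p ` cset lam k = cset lam k" and pp: "p (p a) = a" for a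
    unfolding p_def using j by (auto simp: transpose_cset)
  have pc: "p \<circ> R \<in> cols" if "R \<in> cols" for R using colorings_recolor[OF that pin(1) pT(2) pin(2)] .
  have pw: "wt {1..n} A B (p \<circ> R) = wt {1..n} A B R" if "R \<in> cols" for R
    using wt_recolor[OF finite_atLeastAtMost, of 1 n "cset lam" A R B p] that pin by (auto simp: colorings_def)
  have pe: "?e (p \<circ> R) = p \<circ> ?e R" for R using pT by (auto simp: erase_def fun_eq_iff)
  have inv: "p \<circ> (p \<circ> R) = R" for R using pp by (simp add: fun_eq_iff)
  have g4: "4 dvd g c" if "c \<in> ?e ` cols" for c
    unfolding g_def using triple_fibre[OF i(1,2)] i(3) that unfolding T_def by auto
  have gp: "g (p \<circ> c) = g c" for c
  proof -
    have "bij_betw (comp p) {R \<in> cols. ?e R = c} {R \<in> cols. ?e R = p \<circ> c}"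
    proof (rule bij_betw_byWitness[where f' = "comp p"])
      show "comp p ` {R \<in> cols. ?e R = c} \<subseteq> {R \<in> cols. ?e R = p \<circ> c}"
        using pc by (auto simp: pe)
      show "comp p ` {R \<in> cols. ?e R = p \<circ> c} \<subseteq> {R \<in> cols. ?e R = c}"
        using pc by (auto simp: pe inv)
    qed (simp_all add: inv)
    then have "g (p \<circ> c) = (\<Sum>R\<in>{R \<in> cols. ?e R = c}. wt {1..n} A B (p \<circ> R))"
      unfolding g_def by (rule sum.reindex_bij_betw[symmetric])
    also have "\<dots> = g c" unfolding g_def by (rule sum.cong[OF refl], rule pw) blast
    finally show ?thesis .
  qed
  have "2 dvd (\<Sum>c\<in>?e ` cols. g c div 4)"
  proof (rule involution_dvd2[where f = "comp p"])
    show "finite (?e ` cols)" using finite_cols by simp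
    fix c assume "c \<in> ?e ` cols"
    then obtain R where R: "R \<in> cols" "c = ?e R" by blast
    show "p \<circ> c \<in> ?e ` cols" using R pc[OF R(1)] pe by (metis imageI)
    show "p \<circ> (p \<circ> c) = c" by (rule inv)
    show "p \<circ> c \<noteq> c"
    proof
      assume eq: "p \<circ> c = c"
      have "j \<in> cset lam 1" using j by (simp add: cset_iff)
      then obtain k where k: "R k = j" using R(1) colvalid_ex unfolding colorings_def by blast
      have "j \<notin> T" using disj by (auto simp: T_def)
      then have "c k = j" using k R(2) by (simp add: erase_def)
      then show False using fun_cong[OF eq, of k] by (simp add: p_def)
    qed
    show "g (p \<circ> c) div 4 = g c div 4" using gp by simp
  qed
  then have "4 * 2 dvd 4 * (\<Sum>c\<in>?e ` cols. g c div 4)" by (rule mult_dvd_mono[OF dvd_refl])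
  also have "4 * (\<Sum>c\<in>?e ` cols. g c div 4) = (\<Sum>c\<in>?e ` cols. g c)"
    unfolding sum_distrib_left by (rule sum.cong[OF refl]) (use g4 in simp)
  also have "\<dots> = sum (wt {1..n} A B) cols" unfolding g_def by (rule sum.image_gen[OF finite_cols, symmetric])
  finally show ?thesis by simp
qed

text \<open>The count is unsigned: rows of length m + 1 may lie between the four rows, so
  \<open>T\<close> need not be an interval and signs need not reduce to the subgraph. In the
  subgraph the columns 1, ..., m have degree 4 and the columns m + 1, m + 2 have degree 2; the
  colours i, i + 1 form the first type.\<close>

lemma card_fibre4:
  assumes R0: "R0 \<in> cols" and i: "1 \<le> i" "1 \<le> j" "lam i = lam (i + 1)" "lam j = m" "lam (j + 1) = m" "lam i = m + 2" and m: "m \<ge> 2"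
  shows "8 dvd card {R \<in> cols. erase {i, i + 1, j, j + 1} R = erase {i, i + 1, j, j + 1} R0}"
proof -
  define T where "T = {i, i + 1, j, j + 1}"
  define E' where "E' = {k \<in> {1..n}. R0 k \<in> T}"
  define cs' where "cs' = (\<lambda>j. cset lam j \<inter> T)"
  have T0: "0 \<notin> T" using i by (auto simp: T_def)
  note fb = fibre_bij[OF R0 cset0 T0, folded E'_def cs'_def]
  have ne: "a \<noteq> b" if "lam a = m + 2" "lam b = m" for a b using that by auto
  have "lam (i + 1) = m + 2" using i(3,6) by simp
  then have "i \<noteq> j" "i \<noteq> j + 1" "i + 1 \<noteq> j" using ne i(4,5,6) by blast+
  then have dist: "distinct [i, i + 1, j, j + 1]" by simp
  have csf: "cs' a = T" if "a \<in> {1..m}" for a using that i by (auto simp: cs'_def T_def cset_iff)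
  have cse: "cs' a = {i, i + 1}" if "a \<in> {m + 1, m + 2}" for a using that i by (auto simp: cs'_def T_def cset_iff)
  have cs0: "cs' a = {}" if "a \<notin> {1..m + 2}" for a using that i by (auto simp: cs'_def T_def cset_iff)
  have cT: "card T = 4" using dist by (auto simp: T_def)
  have fincs: "finite (cs' a)" for a by (simp add: cs'_def T_def)
  have "(\<lambda>k. if k \<in> E' then R0 k else 0) \<in> colorings E' cs' A B" using bij_betwE[OF fb] R0 by blast
  then obtain S0 where S0: "S0 \<in> colorings E' cs' A B" by blast
  have finE: "finite E'" by (simp add: E'_def)
  define F where "F = (\<lambda>C a. {k \<in> E'. C k = (a :: nat)})"
  have cF: "card (F C a) = card (cs' a)" if "C = A \<or> C = B" for C a
    using S0 that bij_betw_same_card unfolding F_def colorings_def colvalid_def by blast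
  have cF4: "card (F C a) = 4" if "C = A \<or> C = B" "a \<in> {1..m}" for C a using cF[OF that(1)] csf[OF that(2)] cT by simp
  have cF2: "card (F C a) = 2" if "C = A \<or> C = B" "a \<in> {m + 1, m + 2}" for C a using cF[OF that(1)] cse[OF that(2)] by simp
  have rng: "C k \<in> {1..m + 2}" if "C = A \<or> C = B" "k \<in> E'" for C k
  proof -
    have "S0 k \<in> cs' (C k)" using S0 that colvalid_in unfolding colorings_def by blast
    then show ?thesis using cs0 by blast
  qed
  define P where "P = (\<lambda>C. F C ` {1..m + 2})"
  have side: "side E' (P C)" if C: "C = A \<or> C = B" for C
    unfolding side_def
  proof (intro conjI ballI impI)
    show "\<Union> (P C) = E'" using rng[OF C] by (auto simp: P_def F_def)
    show "X \<inter> Y = {}" if "X \<in> P C" "Y \<in> P C" "X \<noteq> Y" for X Y using that by (auto simp: P_def F_def)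
    show "card X = 2 \<or> card X = 4" if X: "X \<in> P C" for X
    proof -
      obtain a where a: "a \<in> {1..m + 2}" "X = F C a" using X unfolding P_def by blast
      then have "a \<in> {1..m} \<or> a \<in> {m + 1, m + 2}" by auto
      then show ?thesis using a cF4[OF C] cF2[OF C] by blast
    qed
  qed
  have nqC: "m \<le> card (quads (P C))" if C: "C = A \<or> C = B" for C
  proof -
    have "inj_on (F C) {1..m}"
    proof (rule inj_onI)
      fix a b assume ab: "a \<in> {1..m}" "b \<in> {1..m}" "F C a = F C b"
      have "F C a \<noteq> {}" using cF4[OF C ab(1)] by force
      then show "a = b" using ab(3) by (auto simp: F_def)
    qed
    then have "card (F C ` {1..m}) = m" by (simp add: card_image)
    moreover have "F C ` {1..m} \<subseteq> quads (P C)" using cF4[OF C] by (auto simp: quads_def P_def)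
    moreover have "finite (quads (P C))" by (simp add: quads_def P_def)
    ultimately show ?thesis by (metis card_mono)
  qed
  \<comment> \<open>The two sides provide 2m vertices of degree 4, and m is at least 2.\<close>
  have num_quads: "num_quads (P A) (P B) \<ge> 3"
    using m nqC[OF disjI1[OF refl]] nqC[OF disjI2[OF refl]] unfolding num_quads_def by linarith
  have "card (F A (m + 1)) = 2" "card (F A (m + 2)) = 2" by (rule cF2; simp)+
  then have "F A (m + 1) \<noteq> {}" "F A (m + 2) \<noteq> {}" by (intro notI, simp)+
  \<comment> \<open>One edge from each short column of the first side; giving these two the first
    type turns out to force it on all short columns.\<close>
  then obtain e f where e: "e \<in> F A (m + 1)" and f: "f \<in> F A (m + 2)" by blast
  have ef: "e \<in> E'" "f \<in> E'" using e f by (auto simp: F_def)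
  define \<phi> where "\<phi> = (\<lambda>a. if a = i then 0 else if a = i + 1 then 1 else if a = j then 2 else 3 :: nat)"
  define \<psi> where "\<psi> = (\<lambda>a :: nat. if a = 0 then i else if a = 1 then i + 1 else if a = 2 then j else j + 1)"
  have \<phi>\<psi>: "\<psi> (\<phi> a) = a" "\<phi> a < 4" "\<phi> a < 2 \<longleftrightarrow> a \<in> {i, i + 1}" if "a \<in> T" for a
    using that by (auto simp: T_def \<phi>_def \<psi>_def)
  have \<psi>\<phi>: "\<phi> (\<psi> b) = b" "\<psi> b \<in> T" if "b < 4" for b
    using that dist by (auto simp: less4 T_def \<phi>_def \<psi>_def)
  have \<psi>2: "\<psi> b \<in> {i, i + 1}" if "b < 2" for b using that by (auto simp: \<psi>_def)
  have redcard: "card {k \<in> F C a. c k < 2} = 2" if c: "c \<in> val E' (P A) (P B)" and C: "C = A \<or> C = B" and a: "a \<in> {1..m}" for c C a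
  proof -
    have FP: "F C a \<in> P A \<union> P B" using C a by (auto simp: P_def)
    have inj: "inj_on c (F C a)" using val_good[OF c FP] by (simp add: good_def)
    have "c ` F C a \<subseteq> {..<4}" using val_less4[OF c] by (auto simp: F_def)
    moreover have "card (c ` F C a) = card {..<4::nat}" using inj cF4[OF C a] by (simp add: card_image)
    ultimately have "c ` F C a = {..<4}" by (simp add: card_subset_eq)
    then have "bij_betw c (F C a) {..<4}" using inj by (simp add: bij_betw_def)
    from bij_betw_filter[OF this, of "{..<2}"] have "card {k \<in> F C a. c k < 2} = card ({..<4} \<inter> {..<2::nat})"
      using bij_betw_same_card by fastforce
    also have "{..<4} \<inter> {..<2::nat} = {..<2}" by auto
    finally show ?thesis by simp
  qed
  \<comment> \<open>The edges of the first type can be counted from either side, two for each column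
    of degree 4. So if both short columns of \<open>A\<close> are of the first type throughout, the
    same holds for those of \<open>B\<close>.\<close>
  have red: "card {k \<in> E'. c k < 2} = 2 * m + card {k \<in> F C (m + 1). c k < 2} + card {k \<in> F C (m + 2). c k < 2}"
    if c: "c \<in> val E' (P A) (P B)" and C: "C = A \<or> C = B" for c :: "nat \<Rightarrow> nat" and C
  proof -
    have "{k \<in> E'. c k < 2} = (\<Union>a\<in>{1..m + 2}. {k \<in> F C a. c k < 2})" using rng[OF C] by (auto simp: F_def)
    also have "card \<dots> = (\<Sum>a\<in>{1..m + 2}. card {k \<in> F C a. c k < 2})"
      by (rule card_UN_disjoint) (use finE in \<open>auto simp: F_def\<close>)
    also have "{1..m + 2} = {1..m} \<union> {m + 1, m + 2}" by auto
    also have "(\<Sum>a\<in>{1..m} \<union> {m + 1, m + 2}. card {k \<in> F C a. c k < 2}) =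
       (\<Sum>a\<in>{1..m}. card {k \<in> F C a. c k < 2}) + (\<Sum>a\<in>{m + 1, m + 2}. card {k \<in> F C a. c k < 2})"
      by (rule sum.union_disjoint) auto
    also have "(\<Sum>a\<in>{1..m}. card {k \<in> F C a. c k < 2}) = (\<Sum>a\<in>{1..m}. 2)"
      by (rule sum.cong[OF refl]) (rule redcard[OF c C])
    finally show ?thesis by simp
  qed
  have le2: "card {k \<in> F C a. c k < 2} \<le> 2" if "C = A \<or> C = B" "a \<in> {m + 1, m + 2}" for C a and c :: "nat \<Rightarrow> nat"
  proof -
    have "card {k \<in> F C a. c k < 2} \<le> card (F C a)" using finE by (intro card_mono) (auto simp: F_def)
    then show ?thesis using cF2[OF that] by simp
  qed
  have eq2: "(\<forall>k\<in>F C a. c k < 2) \<longleftrightarrow> card {k \<in> F C a. c k < 2} = 2" if C: "C = A \<or> C = B" "a \<in> {m + 1, m + 2}" for C a and c :: "nat \<Rightarrow> nat"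
  proof
    assume "\<forall>k\<in>F C a. c k < 2"
    then have "{k \<in> F C a. c k < 2} = F C a" by blast
    then show "card {k \<in> F C a. c k < 2} = 2" using cF2[OF C] by simp
  next
    assume "card {k \<in> F C a. c k < 2} = 2"
    moreover have "finite (F C a)" using finE by (simp add: F_def)
    ultimately have "{k \<in> F C a. c k < 2} = F C a" using cF2[OF C] by (intro card_subset_eq) auto
    then show "\<forall>k\<in>F C a. c k < 2" by blast
  qed
  have ext: "c k < 2" if c: "c \<in> val E' (P A) (P B)" "c e < 2" "c f < 2" and C: "C = A \<or> C = B" and k: "k \<in> E'" "C k \<in> {m + 1, m + 2}" for c C k
  proof -
    have red2: "\<forall>k\<in>F A a. c k < 2" if "g \<in> F A a" "c g < 2" "a \<in> {m + 1, m + 2}" for g a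
    proof
      fix k assume k: "k \<in> F A a"
      have FP: "F A a \<in> P A \<union> P B" using that(3) by (auto simp: P_def)
      show "c k < 2" using val_good[OF c(1) FP] cF2[of A a] that k unfolding good_def by blast
    qed
    have "card {k \<in> F A (m + 1). c k < 2} = 2" "card {k \<in> F A (m + 2). c k < 2} = 2"
      using red2[OF e c(2)] red2[OF f c(3)] eq2[of A] by blast+
    then have "card {k \<in> F B (m + 1). c k < 2} = 2 \<and> card {k \<in> F B (m + 2). c k < 2} = 2"
      using red[OF c(1), of A] red[OF c(1), of B] le2[of B "m + 1" c] le2[of B "m + 2" c] by simp
    then have "\<forall>k\<in>F C a. c k < 2" if "a \<in> {m + 1, m + 2}" for a
      using C that eq2[of B] red2[OF e c(2)] red2[OF f c(3)] by blast
    then show ?thesis using k by (auto simp: F_def)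
  qed
  have "bij_betw (\<lambda>R. restrict (\<phi> \<circ> R) E') (colorings E' cs' A B) {c \<in> val E' (P A) (P B). c e < 2 \<and> c f < 2}"
  proof (rule bij_betw_byWitness[where f' = "\<lambda>c k. if k \<in> E' then \<psi> (c k) else 0"])
    have inT: "R k \<in> T" if "R \<in> colorings E' cs' A B" "k \<in> E'" for R k
      using that colvalid_in[of E' cs' A R k] by (auto simp: colorings_def cs'_def)
    show "\<forall>R\<in>colorings E' cs' A B. (\<lambda>k. if k \<in> E' then \<psi> (restrict (\<phi> \<circ> R) E' k) else 0) = R"
      using inT \<phi>\<psi>(1) by (auto simp: fun_eq_iff colorings_def)
    show "\<forall>c\<in>{c \<in> val E' (P A) (P B). c e < 2 \<and> c f < 2}. restrict (\<phi> \<circ> (\<lambda>k. if k \<in> E' then \<psi> (c k) else 0)) E' = c"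
      using val_less4 \<psi>\<phi>(1) by (fastforce simp: fun_eq_iff val_def PiE_iff extensional_def)
    show "(\<lambda>R. restrict (\<phi> \<circ> R) E') ` colorings E' cs' A B \<subseteq> {c \<in> val E' (P A) (P B). c e < 2 \<and> c f < 2}"
    proof (rule image_subsetI)
      fix R assume R: "R \<in> colorings E' cs' A B"
      let ?c = "restrict (\<phi> \<circ> R) E'"
      have exR: "R k \<in> {i, i + 1}" if C: "C = A \<or> C = B" and "k \<in> F C a" "a \<in> {m + 1, m + 2}" for C a k
      proof -
        have "R k \<in> cs' (C k)" using R that colvalid_in unfolding colorings_def F_def by blast
        then show ?thesis using cse[of a] that by (simp add: F_def)
      qed
      have less2: "?c k < 2" if C: "C = A \<or> C = B" "k \<in> F C a" "a \<in> {m + 1, m + 2}" for C a k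
        using exR[OF C] \<phi>\<psi>(3)[OF inT[OF R]] C(2) by (simp add: F_def)
      have "good ?c X" if X: "X \<in> P A \<union> P B" for X
      proof -
        obtain C a where Ca: "C = A \<or> C = B" "a \<in> {1..m + 2}" "X = F C a" using X unfolding P_def by blast
        have "inj_on R (F C a)" using R Ca(1) unfolding colorings_def colvalid_def bij_betw_def F_def by blast
        then have "inj_on ?c X" unfolding Ca(3) using inT[OF R] \<phi>\<psi>(1)
          unfolding inj_on_def F_def by (metis (no_types, lifting) comp_apply mem_Collect_eq restrict_apply)
        moreover have "?c x < 2" if "card X = 2" "x \<in> X" for x
        proof -
          have "a \<in> {m + 1, m + 2}" using cF4[OF Ca(1), of a] Ca that(1) by fastforce
          then show ?thesis using less2[OF Ca(1), of x a] Ca(3) that(2) by blast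
        qed
        ultimately show ?thesis by (simp add: good_def)
      qed
      moreover have "?c \<in> E' \<rightarrow>\<^sub>E {..<4}" using inT[OF R] \<phi>\<psi>(2) by (auto simp: restrict_PiE_iff)
      moreover have "?c e < 2" "?c f < 2" using less2[of A] e f by blast+
      ultimately show "?c \<in> {c \<in> val E' (P A) (P B). c e < 2 \<and> c f < 2}" by (simp add: val_def)
    qed
    show "(\<lambda>c k. if k \<in> E' then \<psi> (c k) else 0) ` {c \<in> val E' (P A) (P B). c e < 2 \<and> c f < 2} \<subseteq> colorings E' cs' A B"
    proof (rule image_subsetI)
      fix c assume "c \<in> {c \<in> val E' (P A) (P B). c e < 2 \<and> c f < 2}"
      then have c: "c \<in> val E' (P A) (P B)" "c e < 2" "c f < 2" by auto
      let ?R = "\<lambda>k. if k \<in> E' then \<psi> (c k) else 0"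
      have cv: "colvalid E' cs' C ?R" if C: "C = A \<or> C = B" for C
      proof (rule colvalid_if_inj)
        show "card {k \<in> E'. C k = a} = card (cs' a)" for a using cF[OF C] by (simp add: F_def)
        show "finite (cs' a)" for a by (rule fincs)
        show "?R k \<in> cs' (C k)" if k: "k \<in> E'" for k
        proof (cases "C k \<in> {1..m}")
          case True
          then show ?thesis using csf[OF True] \<psi>\<phi>(2)[OF val_less4[OF c(1) k]] k by simp
        next
          case False
          then have Ck: "C k \<in> {m + 1, m + 2}" using rng[OF C k] by auto
          then show ?thesis using cse[OF Ck] \<psi>2[OF ext[OF c C k Ck]] k by simp
        qed
        show "inj_on ?R {k \<in> E'. C k = a}" for a
        proof (cases "a \<in> {1..m + 2}")
          case True
          then have "F C a \<in> P A \<union> P B" using C by (auto simp: P_def)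
          then have "inj_on c (F C a)" using val_good[OF c(1)] by (simp add: good_def)
          then show ?thesis using val_less4[OF c(1)] \<psi>\<phi>(1) unfolding inj_on_def F_def
            by (metis (no_types, lifting) mem_Collect_eq)
        next
          case False
          then have "{k \<in> E'. C k = a} = {}" using rng[OF C] by blast
          then show ?thesis by (simp only: inj_on_empty)
        qed
      qed
      show "?R \<in> colorings E' cs' A B" using cv[of A] cv[of B] by (simp add: colorings_def)
    qed
  qed
  then have "card (colorings E' cs' A B) = samec E' (P A) (P B) e f"
    unfolding samec_def by (rule bij_betw_same_card)
  moreover have "card {R \<in> cols. erase T R = erase T R0} = card (colorings E' cs' A B)"
    using fb by (rule bij_betw_same_card)
  ultimately show ?thesis using same_dvd8[OF finE side side num_quads ef] unfolding T_def by simp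
qed

text \<open>The colourings of sign -1 form free orbits under two commuting swaps, so the sum is congruent to the number
  of colourings modulo 8.\<close>

lemma dvd8_two_pairs:
  assumes i: "1 \<le> i" "1 \<le> j" "lam i = lam (i + 1)" "lam (i + 1) = lam j + 2" "lam j + 2 = lam (j + 1) + 2" "lam (j + 1) + 2 \<ge> 4"
  shows "8 dvd sum (wt {1..n} A B) cols"
proof -
  define T where "T = {i, i + 1, j, j + 1}"
  define F G where "F = transpose i (i + 1)" and "G = transpose j (j + 1)"
  let ?e = "erase T"
  have "card cols = (\<Sum>c\<in>?e ` cols. \<Sum>R\<in>{R \<in> cols. ?e R = c}. 1)"
    unfolding card_eq_sum by (rule sum.image_gen[OF finite_cols])
  also have "\<dots> = (\<Sum>c\<in>?e ` cols. card {R \<in> cols. ?e R = c})" by (simp only: card_eq_sum)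
  also have "8 dvd \<dots>"
  proof (rule dvd_sum)
    fix c assume "c \<in> ?e ` cols"
    then show "8 dvd card {R \<in> cols. ?e R = c}"
      using card_fibre4[of _ i j "lam j"] i unfolding T_def by auto
  qed
  finally have c8: "8 dvd card cols" .
  have dist: "i \<noteq> j" "i \<noteq> j + 1" "j \<noteq> i + 1" using i by auto
  have V: "F i = i + 1" "F j = j" "G j = j + 1" "G i = i" "F 0 = 0" "G 0 = 0"
    using dist i by (auto simp: F_def G_def transpose_def)
  have inj: "inj F" "inj G" by (simp_all add: F_def G_def)
  have pres: "F ` cset lam a = cset lam a" "G ` cset lam a = cset lam a" for a
    using i by (auto simp: F_def G_def transpose_cset)
  have inv: "F (F a) = a" "G (G a) = a" "G (F a) = F (G a)" for a
    using dist by (auto simp: F_def G_def transpose_def)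
  define N where "N = {R \<in> cols. wt {1..n} A B R = -1}"
  have w: "wt {1..n} A B R = 1 \<or> wt {1..n} A B R = -1" if "R \<in> cols" for R
    using that wt_pm[OF finite_atLeastAtMost] unfolding colorings_def by blast
  have mem: "p \<circ> R \<in> N" if "R \<in> N" "inj p" "p 0 = 0" "\<And>a. p ` cset lam a = cset lam a" for p R
    using that colorings_recolor[of R _ _ A B p] wt_recolor[OF finite_atLeastAtMost, of 1 n "cset lam" A R B p]
    by (auto simp: N_def colorings_def)
  have "4 dvd sum (\<lambda>_. 1::int) N"
  proof (rule involution_dvd4[where f = "comp F" and g = "comp G"])
    show "finite N" using finite_cols by (simp add: N_def)
    fix R assume R: "R \<in> N"
    show "F \<circ> R \<in> N" "G \<circ> R \<in> N" using mem[OF R] inj V pres by blast+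
    show "F \<circ> (F \<circ> R) = R" "G \<circ> (F \<circ> R) = F \<circ> (G \<circ> R)" using inv by (auto simp: fun_eq_iff)
    show "G \<circ> (G \<circ> R) \<in> {R, F \<circ> R}" using inv by (auto simp: fun_eq_iff)
    have "i \<in> cset lam 1" "j \<in> cset lam 1" using i by (auto simp: cset_iff)
    moreover have vA: "colvalid {1..n} (cset lam) A R" using R by (simp add: N_def colorings_def)
    ultimately obtain k l where kl: "R k = i" "R l = j" using colvalid_ex[OF vA] by blast
    then have "(F \<circ> R) k \<noteq> R k" "(G \<circ> R) l \<noteq> R l" "(G \<circ> R) l \<noteq> (F \<circ> R) l" using V by auto
    then have "F \<circ> R \<noteq> R" "G \<circ> R \<noteq> R" "G \<circ> R \<noteq> F \<circ> R" by metis+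
    then show "F \<circ> R \<noteq> R" "G \<circ> R \<notin> {R, F \<circ> R}" by simp_all
  qed auto
  then have N4: "4 dvd int (card N)" by simp
  have "sum (wt {1..n} A B) cols = (\<Sum>R\<in>cols. 1 - 2 * (if R \<in> N then 1 else 0))"
    by (rule sum.cong[OF refl]) (use w in \<open>auto simp: N_def\<close>)
  also have "\<dots> = int (card cols) - 2 * int (card N)"
  proof -
    have "N \<subseteq> cols" by (auto simp: N_def)
    then have "(\<Sum>R\<in>cols. if R \<in> N then 1 else 0 :: int) = int (card N)"
      using finite_cols by (simp add: sum.If_cases Int_absorb1)
    then show ?thesis by (simp add: sum_subtractf sum_distrib_left[symmetric])
  qed
  finally have s: "sum (wt {1..n} A B) cols = int (card cols) - 2 * int (card N)" .
  have "int 8 dvd int (card cols)" using c8 by (simp only: int_dvd_int_iff)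
  moreover have "8 dvd x - 2 * y" if "int 8 dvd x" "4 dvd y" for x y :: int using that by presburger
  ultimately show ?thesis unfolding s using N4 by blast
qed

end

section \<open>Pairs of tableaux for which the form is computed exactly\<close>

section \<open>Antidiagonal tableaux\<close>

text \<open>Two involutions of \<open>{1..m}\<close> moving points by at most one, whose union is the path \<open>1, ..., m\<close>.\<close>

definition zig1 :: "nat \<Rightarrow> nat \<Rightarrow> nat" where
  "zig1 m j = (if odd j then if j < m then j + 1 else j else j - 1)"
definition zig2 :: "nat \<Rightarrow> nat \<Rightarrow> nat" where
  "zig2 m j = (if odd j then if 1 < j then j - 1 else j else if j < m then j + 1 else j)"

lemma zig_range:
  assumes "1 \<le> j" "j \<le> m"
  shows "1 \<le> zig1 m j" "zig1 m j \<le> m" "1 \<le> zig2 m j" "zig2 m j \<le> m"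
    "zig1 m j \<le> j + 1" "j \<le> zig1 m j + 1" "zig2 m j \<le> j + 1" "j \<le> zig2 m j + 1"
proof -
  have "even j \<Longrightarrow> j \<ge> 2" using assms by presburger
  then show "1 \<le> zig1 m j" "zig1 m j \<le> m" "1 \<le> zig2 m j" "zig2 m j \<le> m"
    "zig1 m j \<le> j + 1" "j \<le> zig1 m j + 1" "zig2 m j \<le> j + 1" "j \<le> zig2 m j + 1"
    using assms by (auto simp: zig1_def zig2_def)
qed

lemma zig_invol:
  assumes "1 \<le> j" "j \<le> m"
  shows "zig1 m (zig1 m j) = j" "zig2 m (zig2 m j) = j"
proof -
  have "even j \<Longrightarrow> j \<ge> 2" using assms by presburger
  then show "zig1 m (zig1 m j) = j" "zig2 m (zig2 m j) = j"
    using assms by (auto simp: zig1_def zig2_def)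
qed

text \<open>If the sets differed, a bijection from \<open>V - U\<close> to \<open>U - V\<close>
  would strictly increase the weight, against the equal totals.\<close>

lemma eq_if_larger_weight:
  fixes W :: "'a \<Rightarrow> nat"
  assumes fin: "finite U" "finite V" and c: "card U = card V" and s: "sum W V = sum W U"
    and less: "\<And>u v. u \<in> U \<Longrightarrow> v \<in> V - U \<Longrightarrow> W v < W u"
  shows "V = U"
proof (rule ccontr)
  assume "V \<noteq> U"
  have c': "card (V - U) = card (U - V)"
    using card_Diff_subset_Int[of V U] card_Diff_subset_Int[of U V] fin c by (simp add: Int_commute)
  have ne: "V - U \<noteq> {}"
  proof
    assume "V - U = {}"
    then have "V \<subseteq> U" by blast
    then show False using card_subset_eq[OF fin(1)] c \<open>V \<noteq> U\<close> by simp
  qed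
  obtain f where f: "bij_betw f (V - U) (U - V)" using finite_same_card_bij[OF _ _ c'] fin by auto
  have "sum W (V - U) < (\<Sum>v\<in>V - U. W (f v))"
    by (rule sum_strict_mono) (use fin ne less bij_betwE[OF f] in auto)
  also have "\<dots> = sum W (U - V)" by (rule sum.reindex_bij_betw[OF f])
  finally have "sum W (V - U) + sum W (V \<inter> U) < sum W (U - V) + sum W (V \<inter> U)" by simp
  moreover have "sum W (V - U) + sum W (V \<inter> U) = sum W V" "sum W (U - V) + sum W (V \<inter> U) = sum W U"
    using fin by (subst sum.union_disjoint[symmetric]; (auto intro!: arg_cong[where f = "sum W"])?)+
  ultimately show False using s by simp
qed

text \<open>\<open>Z\<close> holds the upper rows of the equal pairs to be joined into cycles;
  \<open>Suc r \<notin> Z\<close> keeps the pairs disjoint.\<close>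

locale zigzag =
  fixes n :: nat and lam :: "nat \<Rightarrow> nat" and t :: "nat \<times> nat \<Rightarrow> nat" and Z :: "nat set"
  assumes part: "is_partition n lam" and t: "tableau lam n t"
    and Z: "\<And>r. r \<in> Z \<Longrightarrow> 1 \<le> r" "\<And>r. r \<in> Z \<Longrightarrow> lam r = lam (Suc r)"
      "\<And>r. r \<in> Z \<Longrightarrow> 2 \<le> lam r" "\<And>r. r \<in> Z \<Longrightarrow> Suc r \<notin> Z"
begin

text \<open>With identities, two equal rows would form double edges. \<open>zig1\<close> on the
  upper row and \<open>zig2\<close> on the lower one string all edges of the pair into a single
  cycle.\<close>

definition pi :: "nat \<Rightarrow> nat \<Rightarrow> nat" where
  "pi i j = (if i \<in> Z then zig1 (lam i) j else if i - 1 \<in> Z then zig2 (lam i) j else j)"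

text \<open>The largest displacement by \<open>pi\<close>, hence the tolerance in the weights of the
  boxes of a row.\<close>

definition zz :: "nat \<Rightarrow> nat" where
  "zz i = (if i \<in> Z \<or> i - 1 \<in> Z then 1 else 0)"

lemma pi_facts:
  assumes "1 \<le> j" "j \<le> lam i"
  shows "1 \<le> pi i j" "pi i j \<le> lam i" "pi i (pi i j) = j" "pi i j \<le> j + zz i" "j \<le> pi i j + zz i"
  using zig_range[OF assms] zig_invol[OF assms] assms by (auto simp: pi_def zz_def)

text \<open>Chosen so that the label in box (i, j) of \<open>t\<close> sits in row i and column lam
  i + 1 - pi i j of \<open>s\<close>. Rows are kept, so \<open>t\<close> and \<open>s\<close> have
  the same tabloid \<open>R0\<close>, which is therefore a colouring.\<close>

definition \<beta> :: "nat \<times> nat \<Rightarrow> nat \<times> nat" where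
  "\<beta> = (\<lambda>(i, j). (i, pi i (lam i + 1 - j)))"

definition s :: "nat \<times> nat \<Rightarrow> nat" where "s = t \<circ> \<beta>"
abbreviation "A \<equiv> col_of lam t"
abbreviation "B \<equiv> col_of lam s"
abbreviation "Y \<equiv> young lam"
abbreviation "X \<equiv> colorings {1..n} (cset lam) A B"
abbreviation "R0 \<equiv> tabloid lam n t"

lemma in_young: "(i, j) \<in> Y \<longleftrightarrow> 1 \<le> i \<and> 1 \<le> j \<and> j \<le> lam i" by (simp add: young_def)

lemma s_tableau: "tableau lam n s"
proof -
  have "bij_betw \<beta> Y Y"
  proof (rule bij_betw_byWitness[where f' = "\<lambda>(i, j). (i, lam i + 1 - pi i j)"])
    show "\<forall>b\<in>Y. (\<lambda>(i, j). (i, lam i + 1 - pi i j)) (\<beta> b) = b"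
    proof clarify
      fix i j assume "(i, j) \<in> Y"
      then have ij: "1 \<le> j" "j \<le> lam i" by (auto simp: in_young)
      then have "pi i (pi i (lam i + 1 - j)) = lam i + 1 - j" by (intro pi_facts) auto
      then show "(case \<beta> (i, j) of (i, j) \<Rightarrow> (i, lam i + 1 - pi i j)) = (i, j)" using ij by (simp add: \<beta>_def)
    qed
    show "\<forall>b\<in>Y. \<beta> ((\<lambda>(i, j). (i, lam i + 1 - pi i j)) b) = b"
    proof clarify
      fix i j assume "(i, j) \<in> Y"
      then have ij: "1 \<le> j" "j \<le> lam i" by (auto simp: in_young)
      have "lam i + 1 - (lam i + 1 - pi i j) = pi i j" "pi i (pi i j) = j" using pi_facts[OF ij] by auto
      then show "\<beta> (i, lam i + 1 - pi i j) = (i, j)" by (simp add: \<beta>_def)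
    qed
    show "\<beta> ` Y \<subseteq> Y"
    proof clarify
      fix i j i' j' assume "(i', j') = \<beta> (i, j)" "(i, j) \<in> Y"
      moreover from this have "1 \<le> lam i + 1 - j" "lam i + 1 - j \<le> lam i" by (auto simp: in_young)
      ultimately show "(i', j') \<in> Y" using pi_facts(1,2)[of "lam i + 1 - j" i] by (auto simp: \<beta>_def in_young)
    qed
    show "(\<lambda>(i, j). (i, lam i + 1 - pi i j)) ` Y \<subseteq> Y"
    proof clarify
      fix i j assume "(i, j) \<in> Y"
      then show "(i, lam i + 1 - pi i j) \<in> Y" using pi_facts(1,2)[of j i] by (auto simp: in_young)
    qed
  qed
  then show ?thesis using t unfolding tableau_def s_def by (rule bij_betw_trans)
qed

lemma A_t: "(i, j) \<in> Y \<Longrightarrow> A (t (i, j)) = j" by (rule col_of_tab[OF t])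

lemma B_t: assumes "(i, j) \<in> Y" shows "B (t (i, j)) = lam i + 1 - pi i j"
proof -
  have ij: "1 \<le> i" "1 \<le> j" "j \<le> lam i" using assms by (auto simp: in_young)
  have p: "1 \<le> pi i j" "pi i j \<le> lam i" "pi i (pi i j) = j" using pi_facts ij by auto
  then have "(i, lam i + 1 - pi i j) \<in> Y" using ij by (auto simp: in_young)
  from col_of_tab[OF s_tableau this] p show ?thesis by (simp add: \<beta>_def s_def)
qed

lemma t_in: "b \<in> Y \<Longrightarrow> t b \<in> {1..n}" by (rule tab_in[OF t])

lemma finite_X: "finite X"
  using finite_colorings finite_cset[OF part] by blast

lemma R0_t: "(i, j) \<in> Y \<Longrightarrow> R0 (t (i, j)) = i" by (rule tabloid_tab[OF t])

lemma X_ext: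
  assumes "R \<in> X" "R' \<in> X" "\<And>i j. (i, j) \<in> Y \<Longrightarrow> R (t (i, j)) = R' (t (i, j))"
  shows "R = R'"
proof
  fix k show "R k = R' k"
  proof (cases "k \<in> {1..n}")
    case True
    then obtain i j where "(i, j) \<in> Y" "t (i, j) = k" using tab_ex[OF t] by blast
    then show ?thesis using assms(3) by blast
  qed (use assms(1,2) in \<open>simp add: colorings_def\<close>)
qed

lemma color_in:
  assumes "R \<in> X" "(i, j) \<in> Y" shows "(R (t (i, j)), j) \<in> Y" "(R (t (i, j)), B (t (i, j))) \<in> Y"
proof -
  have v: "colvalid {1..n} (cset lam) A R" "colvalid {1..n} (cset lam) B R" using assms(1) by (auto simp: colorings_def)
  show "(R (t (i, j)), j) \<in> Y" using colvalid_in[OF v(1) t_in[OF assms(2)]] A_t[OF assms(2)] by (simp add: cset_def)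
  show "(R (t (i, j)), B (t (i, j))) \<in> Y" using colvalid_in[OF v(2) t_in[OF assms(2)]] by (simp add: cset_def)
qed

lemma color_inj:
  assumes "R \<in> X" "b \<in> Y" "b' \<in> Y" "R (t b) = R (t b')" "A (t b) = A (t b') \<or> B (t b) = B (t b')"
  shows "b = b'"
proof -
  have v: "colvalid {1..n} (cset lam) A R" "colvalid {1..n} (cset lam) B R" using assms(1) by (auto simp: colorings_def)
  have "t b = t b'"
    using colvalid_inj[OF v(1) t_in[OF assms(2)] t_in[OF assms(3)]] colvalid_inj[OF v(2) t_in[OF assms(2)] t_in[OF assms(3)]] assms(4,5) by blast
  then show ?thesis using tab_inj[OF t assms(2,3)] by simp
qed

lemma bij_colors:
  assumes R: "R \<in> X" and C: "C = A \<or> C = B"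
  shows "bij_betw (\<lambda>b. (R (t b), C (t b))) Y Y"
proof -
  have "inj_on (\<lambda>b. (R (t b), C (t b))) Y"
    by (rule inj_onI) (use color_inj[OF R] C in auto)
  moreover have "(\<lambda>b. (R (t b), C (t b))) ` Y \<subseteq> Y"
    using color_in[OF R] A_t C by auto
  ultimately show ?thesis using endo_inj_surj[OF finite_young[OF part]] by (simp add: bij_betw_def)
qed

lemma R0_X: "R0 \<in> X"
proof -
  have "colvalid {1..n} (cset lam) A R0" using tabloid_id_valid[OF t] .
  moreover have "tabloid lam n s = R0"
  proof
    fix k show "tabloid lam n s k = R0 k"
    proof (cases "k \<in> {1..n}")
      case True
      then obtain i j where ij: "(i, j) \<in> Y" "s (i, j) = k" using tab_ex[OF s_tableau] by blast
      have "\<beta> (i, j) \<in> Y" using ij(1) pi_facts(1,2)[of "lam i + 1 - j" i] by (auto simp: \<beta>_def in_young)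
      then have "R0 k = i" using ij R0_t by (auto simp: \<beta>_def s_def)
      then show ?thesis using tabloid_tab[OF s_tableau ij(1)] ij(2) by simp
    qed (metis tabloid_outside)
  qed
  then have "colvalid {1..n} (cset lam) B R0" using tabloid_id_valid[OF s_tableau] by simp
  ultimately show ?thesis using tabloid_outside by (auto simp: colorings_def)
qed

text \<open>The weight of a box is the sum of its two column numbers. Its total over the boxes coloured with the
  rows of length at least \<open>m\<close> does not depend on the colouring, and boxes in longer rows are heavier.\<close>

lemma threshold:
  assumes R: "R \<in> X"
    and sep: "\<And>i i'. 1 \<le> i \<Longrightarrow> 1 \<le> i' \<Longrightarrow> m \<le> lam i \<Longrightarrow> lam i' < m \<Longrightarrow> 0 < lam i' \<Longrightarrow> lam i' + zz i' + zz i < lam i"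
    and b: "(i, j) \<in> Y"
  shows "m \<le> lam (R (t (i, j))) \<longleftrightarrow> m \<le> lam i"
proof -
  let ?U = "{b \<in> Y. m \<le> lam (fst b)}" and ?W = "\<lambda>b. A (t b) + B (t b)"
  let ?V = "\<lambda>R. {b \<in> Y. m \<le> lam (R (t b))}"
  have finY: "finite Y" using finite_young[OF part] .
  have vb: "bij_betw (\<lambda>b. (R (t b), C (t b))) (?V R) ?U" if "R \<in> X" "C = A \<or> C = B" for R C
  proof -
    have "bij_betw (\<lambda>b. (R (t b), C (t b))) {b \<in> Y. (R (t b), C (t b)) \<in> ?U} (Y \<inter> ?U)"
      by (rule bij_betw_filter[OF bij_colors[OF that]])
    moreover have "{b \<in> Y. (R (t b), C (t b)) \<in> ?U} = ?V R" using bij_betwE[OF bij_colors[OF that]] by auto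
    moreover have "Y \<inter> ?U = ?U" by blast
    ultimately show ?thesis by simp
  qed
  \<comment> \<open>Colour and column map the boxes coloured by long rows bijectively onto the boxes
    of long rows, once with \<open>A\<close> and once with \<open>B\<close>; so both column sums are
    independent of \<open>R\<close>.\<close>
  have sV: "sum ?W (?V R) = sum snd ?U + sum snd ?U" if "R \<in> X" for R
    using sum.reindex_bij_betw[OF vb[OF that disjI1[OF refl]], of snd] sum.reindex_bij_betw[OF vb[OF that disjI2[OF refl]], of snd]
    by (simp add: sum.distrib)
  have V0: "?V R0 = ?U" using R0_t by auto
  have "?V R = ?U"
  proof (rule eq_if_larger_weight[where W = ?W])
    show "finite ?U" "finite (?V R)" using finY by simp_all
    show "card ?U = card (?V R)" using bij_betw_same_card[OF vb[OF R disjI1[OF refl]]] by simp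
    show "sum ?W (?V R) = sum ?W ?U" using sV[OF R] sV[OF R0_X] unfolding V0 by simp
    fix u v assume "u \<in> ?U" "v \<in> ?V R - ?U"
    then obtain i j i' j' where ij: "u = (i, j)" "v = (i', j')" "(i, j) \<in> Y" "(i', j') \<in> Y" "m \<le> lam i" "lam i' < m"
      by (cases u; cases v) auto
    have "lam i' + zz i' + zz i < lam i" using ij by (intro sep) (auto simp: in_young)
    moreover have "1 \<le> j" "j \<le> lam i" "1 \<le> j'" "j' \<le> lam i'" using ij by (auto simp: in_young)
    ultimately show "?W v < ?W u"
      using ij A_t B_t pi_facts[of j i] pi_facts[of j' i'] by auto
  qed
  from eqset_imp_iff[OF this, of "(i, j)"] show ?thesis using b by simp
qed

text \<open>Prescribing the colours of \<open>R0\<close> on more and more edges splits off known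
  factors, until \<open>R0\<close> is the only colouring left.\<close>

definition fixing :: "nat set \<Rightarrow> (nat \<Rightarrow> nat) set" where
  "fixing K = {R \<in> X. \<forall>k\<in>K. R k = R0 k}"

abbreviation "\<Sigma> K \<equiv> sum (wt {1..n} A B) (fixing K)"

text \<open>Swapping the equal rows r and r + 1 preserves weights and exchanges the colourings that
  give \<open>k0\<close> the colour r with those that give it r + 1.\<close>

lemma zig_step:
  assumes r: "r \<ge> 1" "lam r = lam (Suc r)" and k0: "R0 k0 = r" "\<And>R. R \<in> fixing K \<Longrightarrow> R k0 = r \<or> R k0 = Suc r"
    and K: "\<And>k. k \<in> K \<Longrightarrow> R0 k \<noteq> r \<and> R0 k \<noteq> Suc r"
  shows "\<Sigma> K = 2 * \<Sigma> (insert k0 K)"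
proof -
  define p where "p = transpose r (Suc r)"
  have pin: "inj p" "p ` cset lam k = cset lam k" "p 0 = 0" for k
    unfolding p_def using r by (simp, intro transpose_cset, simp_all add: transpose_def)
  have pX: "p \<circ> R \<in> fixing K" if "R \<in> fixing K" for R
    using that colorings_recolor[of R _ _ A B p] pin K by (auto simp: fixing_def p_def transpose_def)
  have pw: "wt {1..n} A B (p \<circ> R) = wt {1..n} A B R" if "R \<in> fixing K" for R
    using wt_recolor[OF finite_atLeastAtMost, of 1 n "cset lam" A R B p] that pin by (auto simp: fixing_def colorings_def)
  have inv: "p \<circ> (p \<circ> R) = R" for R by (simp add: p_def fun_eq_iff)
  let ?N = "fixing K - fixing (insert k0 K)"
  have bij: "bij_betw (comp p) (fixing (insert k0 K)) ?N"
  proof (rule bij_betw_byWitness[where f' = "comp p"])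
    show "comp p ` fixing (insert k0 K) \<subseteq> ?N"
    proof (rule image_subsetI)
      fix R assume "R \<in> fixing (insert k0 K)"
      then have R: "R \<in> fixing K" "R k0 = r" using k0(1) by (auto simp: fixing_def)
      then have "(p \<circ> R) k0 \<noteq> R0 k0" by (simp add: p_def k0(1))
      then show "p \<circ> R \<in> ?N" using pX[OF R(1)] by (auto simp: fixing_def)
    qed
    show "comp p ` ?N \<subseteq> fixing (insert k0 K)"
    proof (rule image_subsetI)
      fix R assume R: "R \<in> ?N"
      then have "R k0 = Suc r" using k0 by (auto simp: fixing_def)
      then have "(p \<circ> R) k0 = R0 k0" by (simp add: p_def k0(1))
      then show "p \<circ> R \<in> fixing (insert k0 K)" using pX[of R] R by (auto simp: fixing_def)
    qed
  qed (simp_all add: inv)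
  have fin: "finite (fixing K)" using finite_X by (simp add: fixing_def)
  have sub: "fixing (insert k0 K) \<subseteq> fixing K" by (auto simp: fixing_def)
  have "\<Sigma> K = sum (wt {1..n} A B) ?N + \<Sigma> (insert k0 K)"
    by (rule sum.subset_diff[OF sub fin])
  also have "sum (wt {1..n} A B) ?N = (\<Sum>R\<in>fixing (insert k0 K). wt {1..n} A B (p \<circ> R))"
    by (rule sum.reindex_bij_betw[OF bij, symmetric])
  also have "\<dots> = \<Sigma> (insert k0 K)" by (rule sum.cong[OF refl]) (use pw sub in blast)
  finally show ?thesis by simp
qed

text \<open>\<open>C\<close> is a bundle of parallel edges. Every colouring arises in exactly one
  way from one that agrees with \<open>R0\<close> on \<open>C\<close> by permuting the labels of
  \<open>C\<close>, and \<open>wt_relabel\<close> shows that the weight does not change.\<close>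

lemma class_step:
  assumes C: "C \<subseteq> {1..n}" "C \<inter> K = {}" and inj: "inj_on R0 C"
    and A: "\<And>x y. x \<in> C \<Longrightarrow> y \<in> C \<Longrightarrow> A x = A y" and B: "\<And>x y. x \<in> C \<Longrightarrow> y \<in> C \<Longrightarrow> B x = B y"
    and img: "\<And>R x. R \<in> fixing K \<Longrightarrow> x \<in> C \<Longrightarrow> R x \<in> R0 ` C"
  shows "\<Sigma> K = fact (card C) * \<Sigma> (K \<union> C)"
proof -
  have finC: "finite C" using C(1) finite_subset by blast
  have rel: "R \<circ> \<sigma> \<in> fixing K" if R: "R \<in> fixing K" and s: "\<sigma> permutes C" for R \<sigma>
  proof -
    have sE: "\<sigma> permutes {1..n}" using s C(1) by (rule permutes_subset)
    have AB: "A (\<sigma> x) = A x" "B (\<sigma> x) = B x" for x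
      using A[of "\<sigma> x" x] B[of "\<sigma> x" x] permutes_in_image[OF s, of x] permutes_not_in[OF s, of x] by (cases "x \<in> C"; simp)+
    have cv: "colvalid {1..n} (cset lam) D (R \<circ> \<sigma>)"
      if v: "colvalid {1..n} (cset lam) D R" and D: "\<And>x. D (\<sigma> x) = D x" for D
      unfolding colvalid_def
    proof
      fix j
      have "bij_betw \<sigma> {k \<in> {1..n}. D k = j} {k \<in> {1..n}. D k = j}"
        using bij_betw_filter[OF permutes_imp_bij[OF sE], of "{k. D k = j}"] D by (simp add: Int_def)
      then show "bij_betw (R \<circ> \<sigma>) {k \<in> {1..n}. D k = j} (cset lam j)"
        using v unfolding colvalid_def by (blast intro: bij_betw_trans)
    qed
    have "R \<circ> \<sigma> \<in> X" using R cv[of A] cv[of B] AB permutes_not_in[OF sE]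
      by (auto simp: fixing_def colorings_def)
    moreover have "(R \<circ> \<sigma>) k = R k" if "k \<in> K" for k
    proof -
      have "k \<notin> C" using that C(2) by blast
      then show ?thesis using permutes_not_in[OF s] by simp
    qed
    ultimately show ?thesis using R by (auto simp: fixing_def)
  qed
  have w: "wt {1..n} A B (R \<circ> \<sigma>) = wt {1..n} A B R" if "\<sigma> permutes C" for R \<sigma>
  proof (rule wt_relabel)
    show "\<sigma> permutes {1..n}" using that C(1) by (rule permutes_subset)
    show "\<forall>x\<in>{1..n}. A (\<sigma> x) = A x" "\<forall>x\<in>{1..n}. B (\<sigma> x) = B x"
      using A B permutes_in_image[OF that] permutes_not_in[OF that] by metis+
  qed simp
  have injC: "inj_on R C" if "R \<in> fixing K" for R
  proof (rule inj_onI)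
    fix x y assume xy: "x \<in> C" "y \<in> C" "R x = R y"
    have "colvalid {1..n} (cset lam) A R" using that by (simp add: fixing_def colorings_def)
    from colvalid_inj[OF this _ _ A[OF xy(1,2)] xy(3)] show "x = y" using xy C(1) by blast
  qed
  have bij: "bij_betw (\<lambda>(\<sigma>, R). R \<circ> \<sigma>) ({\<sigma>. \<sigma> permutes C} \<times> fixing (K \<union> C)) (fixing K)"
    unfolding bij_betw_def
  proof
    show "inj_on (\<lambda>(\<sigma>, R). R \<circ> \<sigma>) ({\<sigma>. \<sigma> permutes C} \<times> fixing (K \<union> C))"
    proof (rule inj_onI, clarify)
      fix \<sigma> \<sigma>' R R' assume a: "\<sigma> permutes C" "\<sigma>' permutes C" "R \<in> fixing (K \<union> C)" "R' \<in> fixing (K \<union> C)" "R \<circ> \<sigma> = R' \<circ> \<sigma>'"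
      have "\<sigma> k = \<sigma>' k" for k
      proof (cases "k \<in> C")
        case True
        then have "\<sigma> k \<in> C" "\<sigma>' k \<in> C" using a(1,2) permutes_in_image by metis+
        moreover from this have "R0 (\<sigma> k) = R0 (\<sigma>' k)" using fun_cong[OF a(5), of k] a(3,4) by (auto simp: fixing_def)
        ultimately show ?thesis using inj by (metis inj_onD)
      qed (use a(1,2) permutes_not_in in metis)
      then have e: "\<sigma> = \<sigma>'" by blast
      have "surj \<sigma>'" using a(2) permutes_surj by blast
      then have "R = R'" using a(5) unfolding e by (metis comp_apply surjD ext)
      then show "\<sigma> = \<sigma>' \<and> R = R'" using e by blast
    qed
    show "(\<lambda>(\<sigma>, R). R \<circ> \<sigma>) ` ({\<sigma>. \<sigma> permutes C} \<times> fixing (K \<union> C)) = fixing K"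
    proof
      have "fixing (K \<union> C) \<subseteq> fixing K" by (auto simp: fixing_def)
      then show "(\<lambda>(\<sigma>, R). R \<circ> \<sigma>) ` ({\<sigma>. \<sigma> permutes C} \<times> fixing (K \<union> C)) \<subseteq> fixing K" using rel by auto
      show "fixing K \<subseteq> (\<lambda>(\<sigma>, R). R \<circ> \<sigma>) ` ({\<sigma>. \<sigma> permutes C} \<times> fixing (K \<union> C))"
      proof
        fix R assume R: "R \<in> fixing K"
        have "R ` C \<subseteq> R0 ` C" using img[OF R] by blast
        moreover have "card (R ` C) = card (R0 ` C)" using injC[OF R] inj by (simp add: card_image)
        ultimately have RC: "R ` C = R0 ` C" using finC by (simp add: card_subset_eq)
        define \<tau> where "\<tau> = (\<lambda>k. if k \<in> C then inv_into C R (R0 k) else k)"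
        have t1: "R (\<tau> k) = R0 k" "\<tau> k \<in> C" if "k \<in> C" for k
          using that RC f_inv_into_f[of "R0 k" R C] inv_into_into[of "R0 k" R C] by (auto simp: \<tau>_def)
        have "inj_on \<tau> C" using t1(1) inj unfolding inj_on_def by metis
        moreover have "\<tau> ` C \<subseteq> C" using t1(2) by blast
        ultimately have "bij_betw \<tau> C C" using endo_inj_surj[OF finC] by (simp add: bij_betw_def)
        then have tp: "\<tau> permutes C" by (rule bij_imp_permutes) (simp add: \<tau>_def)
        have "R \<circ> \<tau> \<in> fixing (K \<union> C)" using rel[OF R tp] t1(1) by (auto simp: fixing_def)
        moreover have "inv \<tau> permutes C" using permutes_inv[OF tp] .
        moreover have "R = (R \<circ> \<tau>) \<circ> inv \<tau>" using permutes_surj[OF tp] by (simp add: comp_assoc surj_iff)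
        ultimately show "R \<in> (\<lambda>(\<sigma>, R). R \<circ> \<sigma>) ` ({\<sigma>. \<sigma> permutes C} \<times> fixing (K \<union> C))"
          by (intro image_eqI[of _ _ "(inv \<tau>, R \<circ> \<tau>)"]) simp_all
      qed
    qed
  qed
  have "\<Sigma> K = (\<Sum>(\<sigma>, R)\<in>{\<sigma>. \<sigma> permutes C} \<times> fixing (K \<union> C). wt {1..n} A B (R \<circ> \<sigma>))"
    using sum.reindex_bij_betw[OF bij, of "wt {1..n} A B"] by (simp add: case_prod_unfold)
  also have "\<dots> = (\<Sum>\<sigma>\<in>{\<sigma>. \<sigma> permutes C}. \<Sum>R\<in>fixing (K \<union> C). wt {1..n} A B (R \<circ> \<sigma>))"
    by (simp add: sum.cartesian_product)
  also have "\<dots> = (\<Sum>\<sigma>\<in>{\<sigma>. \<sigma> permutes C}. \<Sigma> (K \<union> C))"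
    by (rule sum.cong[OF refl], rule sum.cong[OF refl], rule w) simp
  also have "\<dots> = fact (card C) * \<Sigma> (K \<union> C)" by (simp add: card_permutations[OF refl finC])
  finally show ?thesis .
qed

lemma fixing_single:
  assumes "\<And>R i j. R \<in> fixing K \<Longrightarrow> (i, j) \<in> Y \<Longrightarrow> R (t (i, j)) = i"
  shows "\<Sigma> K = 1 \<or> \<Sigma> K = -1"
proof -
  have "fixing K = {R0}"
  proof
    show "fixing K \<subseteq> {R0}" using X_ext[OF _ R0_X] assms R0_t by (auto simp: fixing_def)
    show "{R0} \<subseteq> fixing K" using R0_X by (auto simp: fixing_def)
  qed
  moreover have "wt {1..n} A B R0 = 1 \<or> wt {1..n} A B R0 = -1"
    using wt_pm[OF finite_atLeastAtMost] R0_X unfolding colorings_def by blast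
  ultimately show ?thesis by simp
qed

lemma fixing_empty: "fixing {} = X" by (simp add: fixing_def)

end

context zigzag
begin

text \<open>The boxes (r, zig1 j) and (r + 1, zig2 j) meet in a column of \<open>B\<close>, while
  (r, zig2 j) and (r + 1, zig2 j) meet in a column of \<open>A\<close>. With only two colours
  available, row r has equal colours at zig1 j and zig2 j. This links 1 with 2 and j - 1 with j + 1,
  so the first colour determines the whole cycle.\<close>

lemma zig_rows:
  assumes R: "R \<in> X" and r: "r \<in> Z" and rows: "\<And>j i. i \<in> {r, Suc r} \<Longrightarrow> 1 \<le> j \<Longrightarrow> j \<le> lam r \<Longrightarrow> R (t (i, j)) \<in> {r, Suc r}"
    and first: "R (t (r, 1)) = r" and j: "1 \<le> j" "j \<le> lam r"
  shows "R (t (r, j)) = r" "R (t (Suc r, j)) = Suc r"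
proof -
  let ?m = "lam r"
  have r1: "1 \<le> r" "lam (Suc r) = ?m" "Suc r \<notin> Z" using Z[OF r] by auto
  have Y: "(r, j) \<in> Y" "(Suc r, j) \<in> Y" if "1 \<le> j" "j \<le> ?m" for j using that r1 by (auto simp: in_young)
  have AB: "R (t (r, j)) \<noteq> R (t (Suc r, j))" if "1 \<le> j" "j \<le> ?m" for j
    using color_inj[OF R Y[OF that]] A_t Y[OF that] by auto
  have step: "R (t (r, zig1 ?m j)) = R (t (r, zig2 ?m j))" if j: "1 \<le> j" "j \<le> ?m" for j
  proof -
    note z = zig_range[OF j] zig_invol[OF j]
    have "B (t (r, zig1 ?m j)) = ?m + 1 - j" "B (t (Suc r, zig2 ?m j)) = ?m + 1 - j"
      using B_t[OF Y(1)[OF z(1,2)]] B_t[OF Y(2)[OF z(3,4)]] z r r1 by (simp_all add: pi_def)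
    then have "R (t (r, zig1 ?m j)) \<noteq> R (t (Suc r, zig2 ?m j))"
      using color_inj[OF R Y(1)[OF z(1,2)] Y(2)[OF z(3,4)]] by auto
    then show ?thesis
      using AB[OF z(3,4)] rows[of r, OF _ z(1,2)] rows[of r, OF _ z(3,4)] rows[of "Suc r", OF _ z(3,4)] by auto
  qed
  have all: "1 \<le> j \<Longrightarrow> j \<le> ?m \<Longrightarrow> R (t (r, j)) = r" for j
  proof (induction j rule: less_induct)
    case (less j)
    consider "j = 1" | "j = 2" | "j \<ge> 3" using less.prems by linarith
    then show ?case
    proof cases
      case 1 then show ?thesis using first by simp
    next
      case 2
      then have "R (t (r, zig1 ?m 1)) = R (t (r, zig2 ?m 1))" using less.prems by (intro step) auto
      then show ?thesis using 2 less.prems first by (simp add: zig1_def zig2_def numeral_2_eq_2)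
    next
      case 3
      then obtain k where k: "j = Suc k" "2 \<le> k" by (cases j) auto
      then have km: "1 \<le> k" "k \<le> ?m" "k < ?m" using less.prems by auto
      have "R (t (r, k - 1)) = r" using less.IH[of "k - 1"] k km by auto
      then show ?thesis using step[OF km(1,2)] km k by (cases "odd k") (simp_all add: zig1_def zig2_def)
    qed
  qed
  show 1: "R (t (r, j)) = r" using all j .
  show "R (t (Suc r, j)) = Suc r" using AB[OF j] 1 rows[of "Suc r", OF _ j] by auto
qed

text \<open>Colourings preserve row lengths by \<open>threshold\<close>. Each cycle contributes a
  factor 2. The rows of the one other repeated length m form m bundles of parallel edges, one for
  each column, and each bundle contributes a factorial. If there is no such length, m = 0 makes the
  last factor a zeroth power.\<close>

lemma antidiagonal_sum:
  assumes finZ: "finite Z"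
    and sep: "\<And>i i'. 1 \<le> i \<Longrightarrow> 1 \<le> i' \<Longrightarrow> lam i' < lam i \<Longrightarrow> 0 < lam i' \<Longrightarrow> lam i' + zz i' + zz i < lam i"
    and zrows: "\<And>r i. r \<in> Z \<Longrightarrow> 1 \<le> i \<Longrightarrow> lam i = lam r \<Longrightarrow> i = r \<or> i = Suc r"
    and rest: "\<And>i. 1 \<le> i \<Longrightarrow> 0 < lam i \<Longrightarrow>
      (\<forall>i'\<ge>1. lam i' = lam i \<longrightarrow> i' = i) \<or> lam i = m \<or> i \<in> Z \<or> i - 1 \<in> Z"
    and mZ: "\<And>r. r \<in> Z \<Longrightarrow> lam r \<noteq> m"
  shows "\<bar>sum (wt {1..n} A B) X\<bar> = 2 ^ card Z * fact (card {i. 1 \<le> i \<and> lam i = m}) ^ m"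
proof -
  have rowlen: "lam (R (t (i, j))) = lam i" if R: "R \<in> X" and ij: "(i, j) \<in> Y" for R i j
  proof -
    have th: "k \<le> lam (R (t (i, j))) \<longleftrightarrow> k \<le> lam i" for k
      by (rule threshold[OF R _ ij]) (use sep in force)
    show ?thesis using th[of "lam i"] th[of "lam (R (t (i, j)))"] by simp
  qed
  have pos: "1 \<le> R (t (i, j))" if "R \<in> X" "(i, j) \<in> Y" for R i j
    using color_in(1)[OF that] by (simp add: in_young)
  have zr: "R (t (i, j)) \<in> {r, Suc r}" if "R \<in> X" "r \<in> Z" "i \<in> {r, Suc r}" "1 \<le> j" "j \<le> lam r" for R r i j
  proof -
    have "(i, j) \<in> Y" "lam i = lam r" using Z(1,2)[OF that(2)] that by (auto simp: in_young)
    then show ?thesis using zrows[OF that(2) pos[OF that(1)]] rowlen[OF that(1)] by auto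
  qed
  define KZ where "KZ = (\<lambda>Z'. (\<lambda>r. t (r, 1)) ` Z')"
  have zY: "(r, 1) \<in> Y" if "r \<in> Z" for r using Z(1,3)[OF that] by (auto simp: in_young)
  have 1: "\<Sigma> {} = 2 ^ card Z' * \<Sigma> (KZ Z')" if "finite Z'" "Z' \<subseteq> Z" for Z'
    using that
  proof (induction Z')
    case empty then show ?case by (simp add: KZ_def)
  next
    case (insert r Z')
    have r: "r \<in> Z" using insert.prems by blast
    have "\<Sigma> (KZ Z') = 2 * \<Sigma> (insert (t (r, 1)) (KZ Z'))"
    proof (rule zig_step)
      show "1 \<le> r" "lam r = lam (Suc r)" using Z r by auto
      show "R0 (t (r, 1)) = r" using R0_t zY[OF r] .
      show "R (t (r, 1)) = r \<or> R (t (r, 1)) = Suc r" if "R \<in> fixing (KZ Z')" for R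
        using zr[of R r r 1] that r Z(3)[OF r] by (auto simp: fixing_def)
      fix k assume "k \<in> KZ Z'"
      then obtain r' where r': "r' \<in> Z'" "k = t (r', 1)" by (auto simp: KZ_def)
      then have "r' \<in> Z" "R0 k = r'" using insert.prems R0_t zY by auto
      then show "R0 k \<noteq> r \<and> R0 k \<noteq> Suc r" using Z(4)[OF r] r' insert.hyps by auto
    qed
    then show ?case using insert by (simp add: KZ_def)
  qed
  define I where "I = {i. 1 \<le> i \<and> lam i = m}"
  define K where "K = (\<lambda>j0. KZ Z \<union> (\<lambda>(i, j). t (i, j)) ` (I \<times> {1..j0}))"
  have pim: "pi i j = j" if "i \<in> I" for i j
  proof -
    have "i \<notin> Z" using mZ that by (auto simp: I_def)
    moreover have "i - 1 \<notin> Z"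
    proof
      assume a: "i - 1 \<in> Z"
      then have "lam (i - 1) = lam i" using Z(2)[OF a] that by (simp add: I_def)
      then show False using mZ[OF a] that by (simp add: I_def)
    qed
    ultimately show ?thesis by (simp add: pi_def)
  qed
  have 2: "\<Sigma> (KZ Z) = fact (card I) ^ j0 * \<Sigma> (K j0)" if "j0 \<le> m" for j0
    using that
  proof (induction j0)
    case 0 then show ?case by (simp add: K_def)
  next
    case (Suc j0)
    define C where "C = (\<lambda>i. t (i, Suc j0)) ` I"
    have IY: "(i, Suc j0) \<in> Y" if "i \<in> I" for i using that Suc.prems by (auto simp: I_def in_young)
    have injt: "inj_on (\<lambda>i. t (i, Suc j0)) I" using tab_inj[OF t IY IY] by (auto simp: inj_on_def)
    have "\<Sigma> (K j0) = fact (card C) * \<Sigma> (K j0 \<union> C)"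
    proof (rule class_step)
      show "C \<subseteq> {1..n}" using t_in[OF IY] unfolding C_def by blast
      show "C \<inter> K j0 = {}"
      proof -
        have "t (i, Suc j0) \<noteq> t (r, 1)" if "i \<in> I" "r \<in> Z" for i r
          using tab_inj[OF t IY[OF that(1)] zY[OF that(2)]] mZ[OF that(2)] that(1) by (auto simp: I_def)
        moreover have "t (i, Suc j0) \<noteq> t (i', j)" if "i \<in> I" "i' \<in> I" "j \<in> {1..j0}" for i i' j
        proof -
          have "(i', j) \<in> Y" using that Suc.prems by (auto simp: I_def in_young)
          then show ?thesis using tab_inj[OF t IY[OF that(1)]] that(3) by fastforce
        qed
        ultimately have no: "t (i, Suc j0) \<notin> K j0" if "i \<in> I" for i
          using that unfolding K_def KZ_def by (auto dest: not_sym)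
        then show ?thesis unfolding C_def by blast
      qed
      show "inj_on R0 C" unfolding C_def using R0_t[OF IY] by (auto simp: inj_on_def)
      show "A x = A y" if "x \<in> C" "y \<in> C" for x y using that A_t[OF IY] by (auto simp: C_def)
      show "B x = B y" if "x \<in> C" "y \<in> C" for x y using that B_t[OF IY] pim by (auto simp: C_def I_def)
      fix R x assume R: "R \<in> fixing (K j0)" and x: "x \<in> C"
      then obtain i where i: "i \<in> I" "x = t (i, Suc j0)" by (auto simp: C_def)
      have RX: "R \<in> X" using R by (simp add: fixing_def)
      have "R x \<in> I" using rowlen[OF RX IY[OF i(1)]] pos[OF RX IY[OF i(1)]] i by (simp add: I_def)
      then have "R0 (t (R x, Suc j0)) = R x" "t (R x, Suc j0) \<in> C" using R0_t[OF IY] by (auto simp: C_def)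
      then show "R x \<in> R0 ` C" by (metis imageI)
    qed
    moreover have "card C = card I" unfolding C_def by (rule card_image[OF injt])
    moreover have "K j0 \<union> C = K (Suc j0)"
    proof -
      have "I \<times> {1..Suc j0} = I \<times> {1..j0} \<union> (\<lambda>i. (i, Suc j0)) ` I" by (auto simp: atLeastAtMostSuc_conv)
      then show ?thesis by (simp add: K_def C_def image_Un image_image Un_assoc)
    qed
    ultimately show ?case using Suc by (simp add: algebra_simps)
  qed
  have 3: "\<Sigma> (K m) = 1 \<or> \<Sigma> (K m) = -1"
  proof (rule fixing_single)
    fix R i j assume R: "R \<in> fixing (K m)" and ij: "(i, j) \<in> Y"
    have RX: "R \<in> X" using R by (simp add: fixing_def)
    have i: "1 \<le> i" "1 \<le> j" "j \<le> lam i" using ij by (auto simp: in_young)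
    have zig: "R (t (r, j)) = r" "R (t (Suc r, j)) = Suc r" if r: "r \<in> Z" and j: "1 \<le> j" "j \<le> lam r" for r j
    proof -
      have "t (r, 1) \<in> K m" using r by (simp add: K_def KZ_def)
      then have f: "R (t (r, 1)) = r" using R R0_t[OF zY[OF r]] by (simp add: fixing_def)
      show "R (t (r, j)) = r" "R (t (Suc r, j)) = Suc r" using zig_rows[OF RX r zr[OF RX r] f j] by auto
    qed
    have "0 < lam i" using i by simp
    from rest[OF i(1) this] show "R (t (i, j)) = i"
    proof (elim disjE)
      assume "\<forall>i'\<ge>1. lam i' = lam i \<longrightarrow> i' = i"
      then show ?thesis using rowlen[OF RX ij] pos[OF RX ij] by blast
    next
      assume "lam i = m"
      then have "t (i, j) \<in> K m" using i by (force simp: K_def I_def)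
      then show ?thesis using R R0_t[OF ij] by (simp add: fixing_def)
    next
      assume "i \<in> Z" then show ?thesis using zig(1) i by blast
    next
      assume a: "i - 1 \<in> Z"
      then have "Suc (i - 1) = i" "lam (i - 1) = lam i" using Z(2)[OF a] i by auto
      then show ?thesis using zig(2)[OF a i(2)] i by simp
    qed
  qed
  have "\<Sigma> {} = 2 ^ card Z * (fact (card I) ^ m * \<Sigma> (K m))" using 1[OF finZ order_refl] 2[OF order_refl] by simp
  then show ?thesis using 3 unfolding fixing_empty I_def by (auto simp: abs_mult)
qed

text \<open>The lengths 2 and 1 are too close for the weights of a joined pair, so
  \<open>threshold\<close> is used for lengths from 3 on only. The rows at the end are treated by
  hand: 12 = 2 * 3!, from the colour of the box (r, 2) and from a bundle of three edges.\<close>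

lemma two_two_one_one_sum:
  assumes Zr: "Z = {r}" and l: "lam r = 2" "lam (r + 2) = 1" "lam (r + 3) = 1" "lam (r + 4) = 0"
    and uniq: "\<And>i i'. 1 \<le> i \<Longrightarrow> i < r \<Longrightarrow> 1 \<le> i' \<Longrightarrow> lam i' = lam i \<Longrightarrow> i' = i"
    and big: "\<And>i. 1 \<le> i \<Longrightarrow> i < r \<Longrightarrow> 4 \<le> lam i"
  shows "\<bar>sum (wt {1..n} A B) X\<bar> = 12"
proof -
  have r1: "1 \<le> r" "lam (r + 1) = 2" using Z(1,2)[of r] Zr l by auto
  have low: "lam i \<le> 2" if "r \<le> i" for i using antitone[OF part r1(1) that] l by simp
  have low1: "lam i \<le> 1" if "r + 2 \<le> i" for i using antitone[OF part, of "r + 2" i] that l by simp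
  have low0: "lam i = 0" if "r + 4 \<le> i" for i using antitone[OF part, of "r + 4" i] that l by simp
  have th: "k \<le> lam (R (t (i, j))) \<longleftrightarrow> k \<le> lam i" if R: "R \<in> X" and ij: "(i, j) \<in> Y" and k: "3 \<le> k" for R i j k
  proof (rule threshold[OF R _ ij])
    fix a b assume ab: "1 \<le> a" "1 \<le> b" "k \<le> lam a" "lam b < k" "0 < lam b"
    have ar: "a < r" using low[of a] ab k by force
    then have z: "zz a = 0" unfolding zz_def unfolding Zr by auto
    show "lam b + zz b + zz a < lam a"
    proof (cases "zz b = 0")
      case True then show ?thesis using z ab by simp
    next
      case False
      then have "b \<in> Z \<or> b - 1 \<in> Z" by (auto simp: zz_def split: if_splits)
      then have "zz b = 1" "r \<le> b" unfolding zz_def unfolding Zr by auto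
      then show ?thesis using z low[of b] big[OF ab(1) ar] by simp
    qed
  qed
  have high: "R (t (i, j)) = i" if R: "R \<in> X" and ij: "(i, j) \<in> Y" and ir: "i < r" for R i j
  proof -
    have i1: "1 \<le> i" "1 \<le> R (t (i, j))" using ij color_in(1)[OF R ij] by (auto simp: in_young)
    have b: "3 \<le> lam i" using big[OF i1(1) ir] by simp
    then have g: "lam i \<le> lam (R (t (i, j)))" using th[OF R ij b] by simp
    then have "lam (R (t (i, j))) \<le> lam i" using th[OF R ij, of "lam (R (t (i, j)))"] b by simp
    then show ?thesis using uniq[OF i1(1) ir i1(2)] g by simp
  qed
  have ge: "r \<le> R (t (i, j))" if R: "R \<in> X" and ij: "(i, j) \<in> Y" and ir: "r \<le> i" for R i j
  proof (rule ccontr)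
    assume *: "\<not> ?thesis"
    have "1 \<le> R (t (i, j))" using color_in(1)[OF R ij] by (auto simp: in_young)
    then have "3 \<le> lam (R (t (i, j)))" using big[of "R (t (i, j))"] * by simp
    then show False using th[OF R ij order_refl] low[OF ir] by simp
  qed
  have Y: "(r, 1) \<in> Y" "(r, 2) \<in> Y" "(r + 1, 1) \<in> Y" "(r + 1, 2) \<in> Y" "(r + 2, 1) \<in> Y" "(r + 3, 1) \<in> Y"
    using l r1 by (auto simp: in_young)
  have Bv: "B (t (r, 1)) = 1" "B (t (r, 2)) = 2" "B (t (r + 1, 1)) = 2" "B (t (r + 2, 1)) = 1" "B (t (r + 3, 1)) = 1"
  proof -
    have p: "pi r 1 = 2" "pi r 2 = 1" "pi (r + 1) 1 = 1" "pi (r + 2) 1 = 1" "pi (r + 3) 1 = 1"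
      unfolding pi_def unfolding Zr using l r1 by (auto simp: zig1_def zig2_def)
    show "B (t (r, 1)) = 1" "B (t (r, 2)) = 2" "B (t (r + 1, 1)) = 2" "B (t (r + 2, 1)) = 1" "B (t (r + 3, 1)) = 1"
      unfolding B_t[OF Y(1)] B_t[OF Y(2)] B_t[OF Y(3)] B_t[OF Y(5)] B_t[OF Y(6)] p l r1(2) by simp_all
  qed
  have two: "k = r \<or> k = r + 1" if "r \<le> k" "(k, 2) \<in> Y" for k
  proof -
    have "2 \<le> lam k" using that by (simp add: in_young)
    then have "\<not> r + 2 \<le> k" using low1[of k] by force
    then show ?thesis using that by linarith
  qed
  have s1: "\<Sigma> {} = 2 * \<Sigma> {t (r, 2)}"
  proof (rule zig_step)
    show "1 \<le> r" "lam r = lam (Suc r)" using r1 l by auto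
    show "R0 (t (r, 2)) = r" by (rule R0_t[OF Y(2)])
    show "R (t (r, 2)) = r \<or> R (t (r, 2)) = Suc r" if "R \<in> fixing {}" for R
      using that two[OF ge[of R, OF _ Y(2)]] color_in(1)[of R, OF _ Y(2)] by (auto simp: fixing_def)
  qed simp
  have det: "R (t (r, 2)) = r" "R (t (r + 1, 2)) = r + 1" "R (t (r + 1, 1)) = r + 1" if R: "R \<in> fixing {t (r, 2)}" for R
  proof -
    have RX: "R \<in> X" using R by (simp add: fixing_def)
    show r2: "R (t (r, 2)) = r" using R R0_t[OF Y(2)] by (simp add: fixing_def)
    have "R (t (r + 1, 2)) \<noteq> r" using color_inj[OF RX Y(4) Y(2)] r2 A_t[OF Y(4)] A_t[OF Y(2)] by auto
    then show "R (t (r + 1, 2)) = r + 1" using two[OF ge[OF RX Y(4)] color_in(1)[OF RX Y(4)]] by simp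
    have "R (t (r + 1, 1)) \<noteq> r" using color_inj[OF RX Y(3) Y(2)] r2 Bv by auto
    then show "R (t (r + 1, 1)) = r + 1" using two[OF ge[OF RX Y(3)]] color_in(2)[OF RX Y(3)] Bv by simp
  qed
  \<comment> \<open>The zigzag puts the label of (r, 1) into column 1 of \<open>s\<close>, where it
    is parallel to the labels of the two rows of length 1.\<close>
  define C where "C = {t (r, 1), t (r + 2, 1), t (r + 3, 1)}"
  have R0C: "R0 ` C = {r, r + 2, r + 3}" using R0_t[OF Y(1)] R0_t[OF Y(5)] R0_t[OF Y(6)] by (simp add: C_def)
  have cC: "card C = 3"
  proof -
    have "t (r, 1) \<noteq> t (r + 2, 1)" "t (r, 1) \<noteq> t (r + 3, 1)" "t (r + 2, 1) \<noteq> t (r + 3, 1)"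
      using tab_inj[OF t Y(1) Y(5)] tab_inj[OF t Y(1) Y(6)] tab_inj[OF t Y(5) Y(6)] by auto
    then show ?thesis by (simp add: C_def)
  qed
  have s2: "\<Sigma> {t (r, 2)} = fact (card C) * \<Sigma> ({t (r, 2)} \<union> C)"
  proof (rule class_step)
    show "C \<subseteq> {1..n}" using t_in Y unfolding C_def by blast
    show "C \<inter> {t (r, 2)} = {}"
      using tab_inj[OF t Y(1) Y(2)] tab_inj[OF t Y(5) Y(2)] tab_inj[OF t Y(6) Y(2)] by (auto simp: C_def)
    show "inj_on R0 C" by (rule eq_card_imp_inj_on) (use R0C cC in \<open>auto simp: C_def\<close>)
    show "A x = A y" if "x \<in> C" "y \<in> C" for x y using that A_t[OF Y(1)] A_t[OF Y(5)] A_t[OF Y(6)] by (auto simp: C_def)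
    show "B x = B y" if "x \<in> C" "y \<in> C" for x y using that Bv by (auto simp: C_def)
    fix R x assume R: "R \<in> fixing {t (r, 2)}" and x: "x \<in> C"
    have RX: "R \<in> X" using R by (simp add: fixing_def)
    obtain i where i: "x = t (i, 1)" "(i, 1) \<in> Y" "r \<le> i" "i \<noteq> r + 1" using x Y by (auto simp: C_def)
    have a: "r \<le> R x" "0 < lam (R x)" using ge[OF RX i(2,3)] color_in(1)[OF RX i(2)] i(1) by (auto simp: in_young)
    have "R x \<noteq> r + 1"
      using color_inj[OF RX i(2) Y(3)] det(3)[OF R] A_t[OF i(2)] A_t[OF Y(3)] i by auto
    moreover have "\<not> r + 4 \<le> R x" using low0[of "R x"] a by auto
    ultimately have "R x = r \<or> R x = r + 2 \<or> R x = r + 3" using a(1) by linarith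
    then show "R x \<in> R0 ` C" unfolding R0C by blast
  qed
  have s3: "\<Sigma> ({t (r, 2)} \<union> C) = 1 \<or> \<Sigma> ({t (r, 2)} \<union> C) = -1"
  proof (rule fixing_single)
    fix R i j assume R: "R \<in> fixing ({t (r, 2)} \<union> C)" and ij: "(i, j) \<in> Y"
    have R': "R \<in> fixing {t (r, 2)}" "R \<in> X" using R by (auto simp: fixing_def)
    have C: "R (t (r, 1)) = r" "R (t (r + 2, 1)) = r + 2" "R (t (r + 3, 1)) = r + 3"
      using R R0_t[OF Y(1)] R0_t[OF Y(5)] R0_t[OF Y(6)] by (auto simp: fixing_def C_def)
    show "R (t (i, j)) = i"
    proof (cases "i < r")
      case True then show ?thesis using high[OF R'(2) ij] by blast
    next
      case False
      have j: "1 \<le> j" "j \<le> lam i" "0 < lam i" using ij by (auto simp: in_young)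
      then have "\<not> r + 4 \<le> i" using low0[of i] by auto
      then consider "i = r" | "i = r + 1" | "i = r + 2" | "i = r + 3" using False by linarith
      then show ?thesis
      proof cases
        case 1
        then have "j = 1 \<or> j = 2" using j l by auto
        then show ?thesis using 1 C det[OF R'(1)] by auto
      next
        case 2
        then have "j = 1 \<or> j = 2" using j r1 by auto
        then show ?thesis using 2 det[OF R'(1)] by auto
      next
        case 3 then show ?thesis using j l C by (cases "j = 1") auto
      next
        case 4 then show ?thesis using j l C by (cases "j = 1") auto
      qed
    qed
  qed
  have "\<Sigma> {} = 12 * \<Sigma> ({t (r, 2)} \<union> C)" using s1 s2 cC by (simp add: fact_numeral)
  then show ?thesis using s3 unfolding fixing_empty by auto
qed

end

section \<open>Case analysis on the repeated row lengths\<close>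

section \<open>Partitions satisfying none of the conditions\<close>

context
  fixes n :: nat and lam :: "nat \<Rightarrow> nat"
  assumes part: "is_partition n lam"
begin

definition repeated :: "nat \<Rightarrow> bool" where
  "repeated i \<longleftrightarrow> 1 \<le> i \<and> lam i = lam (i + 1) \<and> 0 < lam i"

definition some_form_not_dvd8 :: bool where
  "some_form_not_dvd8 \<longleftrightarrow> (\<exists>s t. tableau lam n s \<and> tableau lam n t \<and>
    \<not> 8 dvd (\<Sum>R\<in>colorings {1..n} (cset lam) (col_of lam s) (col_of lam t).
      wt {1..n} (col_of lam s) (col_of lam t) R))"

lemma tableau_ex: "\<exists>t. tableau lam n t"
proof -
  have "card (young lam) = n" using part by (simp add: is_partition_def)
  then show ?thesis
    unfolding tableau_def using finite_same_card_bij[OF finite_young[OF part], of "{1..n}"] by auto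
qed

lemma equal_rows:
  assumes "1 \<le> i" "i < i'" "lam i = lam i'" "0 < lam i" "i \<le> k" "k < i'"
  shows "repeated k" "lam k = lam i"
proof -
  have "lam k \<le> lam i" "lam i' \<le> lam (k + 1)" "lam (k + 1) \<le> lam k"
    using antitone[OF part, of i k] antitone[OF part, of "k + 1" i'] antitone[OF part, of k "k + 1"] assms by auto
  then show "repeated k" "lam k = lam i" using assms by (auto simp: repeated_def)
qed

lemma unique_or_repeated:
  assumes "1 \<le> i" "0 < lam i"
  shows "(\<forall>i'\<ge>1. lam i' = lam i \<longrightarrow> i' = i) \<or> repeated i \<or> repeated (i - 1) \<and> lam (i - 1) = lam i"
proof (cases "\<forall>i'\<ge>1. lam i' = lam i \<longrightarrow> i' = i")
  case False
  then obtain i' where i': "i' \<ge> 1" "lam i' = lam i" "i' \<noteq> i" by blast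
  show ?thesis
  proof (cases "i < i'")
    case True
    then have "repeated i" using equal_rows(1)[of i i' i] i' assms by simp
    then show ?thesis by blast
  next
    case False
    then have "i' < i" using i'(3) by simp
    then have "repeated (i - 1)" "lam (i - 1) = lam i" using equal_rows[of i' i "i - 1"] i' assms by auto
    then show ?thesis by blast
  qed
qed blast

lemma rows_block:
  assumes "1 \<le> a" "a \<le> b" "\<And>i. a \<le> i \<Longrightarrow> i \<le> b \<Longrightarrow> lam i = m" "0 < m" "\<not> repeated (a - 1)" "\<not> repeated b"
  shows "{i. 1 \<le> i \<and> lam i = m} = {a..b}"
proof
  show "{a..b} \<subseteq> {i. 1 \<le> i \<and> lam i = m}" using assms by auto
  show "{i. 1 \<le> i \<and> lam i = m} \<subseteq> {a..b}"
  proof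
    fix i assume "i \<in> {i. 1 \<le> i \<and> lam i = m}"
    then have i: "1 \<le> i" "lam i = m" by auto
    have ab: "lam a = m" "lam b = m" using assms(2,3) by auto
    have "\<not> i < a"
    proof
      assume "i < a"
      moreover from this have "i \<le> a - 1" "a - 1 < a" by linarith+
      ultimately show False using equal_rows(1)[of i a "a - 1"] i ab assms(4,5) by auto
    qed
    moreover have "\<not> b < i" using equal_rows(1)[of b i b] i ab assms by auto
    ultimately show "i \<in> {a..b}" by simp
  qed
qed

text \<open>\<open>gap2\<close> and \<open>gap3\<close> are the separation needed by the weights:
  one extra unit for each of the two lengths that belongs to a joined pair.\<close>

lemma some_form_not_dvd8_antidiagonal:
  assumes finZ: "finite Z" and Z: "\<And>r. r \<in> Z \<Longrightarrow> 1 \<le> r \<and> lam r = lam (r + 1) \<and> 2 \<le> lam r"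
    and zrows: "\<And>r i. r \<in> Z \<Longrightarrow> 1 \<le> i \<Longrightarrow> lam i = lam r \<Longrightarrow> i = r \<or> i = r + 1"
    and gap2: "\<And>r i. r \<in> Z \<Longrightarrow> 1 \<le> i \<Longrightarrow> lam i \<noteq> lam r \<Longrightarrow> lam r + 2 \<le> lam i \<or> lam i + 2 \<le> lam r"
    and gap3: "\<And>r q. r \<in> Z \<Longrightarrow> q \<in> Z \<Longrightarrow> lam q < lam r \<Longrightarrow> lam q + 3 \<le> lam r"
    and rest: "\<And>i. 1 \<le> i \<Longrightarrow> 0 < lam i \<Longrightarrow>
      (\<forall>i'\<ge>1. lam i' = lam i \<longrightarrow> i' = i) \<or> lam i = m \<or> i \<in> Z \<or> i - 1 \<in> Z"
    and mZ: "\<And>r. r \<in> Z \<Longrightarrow> lam r \<noteq> m"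
    and v: "\<not> 8 dvd (2 ^ card Z * fact (card {i. 1 \<le> i \<and> lam i = m}) ^ m :: int)"
  shows some_form_not_dvd8
proof -
  obtain t where t: "tableau lam n t" using tableau_ex by blast
  interpret zigzag n lam t Z
  proof (rule zigzag.intro[OF part t])
    show "1 \<le> r" "lam r = lam (Suc r)" "2 \<le> lam r" if "r \<in> Z" for r using Z[OF that] by auto
    show "Suc r \<notin> Z" if r: "r \<in> Z" for r
    proof
      assume "Suc r \<in> Z"
      then have "lam (r + 2) = lam r" using Z[of "Suc r"] Z[OF r] by simp
      then show False using zrows[OF r, of "r + 2"] by simp
    qed
  qed
  have zz0: "zz i = 0 \<or> (zz i = 1 \<and> (\<exists>r\<in>Z. lam i = lam r))" if "1 \<le> i" for i
  proof -
    have "lam i = lam (i - 1)" if a: "i - 1 \<in> Z" using Z[OF a] \<open>1 \<le> i\<close> by simp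
    then show ?thesis by (auto simp: zz_def)
  qed
  have "\<bar>sum (wt {1..n} A B) X\<bar> = 2 ^ card Z * fact (card {i. 1 \<le> i \<and> lam i = m}) ^ m"
  proof (rule antidiagonal_sum[OF finZ])
    fix i i' assume i: "1 \<le> i" "1 \<le> i'" "lam i' < lam i" "0 < lam i'"
    show "lam i' + zz i' + zz i < lam i"
      using zz0[OF i(1)]
    proof
      assume a: "zz i = 0"
      show ?thesis using zz0[OF i(2)]
      proof
        assume "zz i' = 0" then show ?thesis using a i by simp
      next
        assume "zz i' = 1 \<and> (\<exists>r\<in>Z. lam i' = lam r)"
        then obtain r where r: "r \<in> Z" "lam i' = lam r" "zz i' = 1" by blast
        then show ?thesis using gap2[OF r(1) i(1)] a i by auto
      qed
    next
      assume "zz i = 1 \<and> (\<exists>r\<in>Z. lam i = lam r)"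
      then obtain r where r: "r \<in> Z" "lam i = lam r" "zz i = 1" by blast
      show ?thesis using zz0[OF i(2)]
      proof
        assume "zz i' = 0" then show ?thesis using gap2[OF r(1) i(2)] r i by auto
      next
        assume "zz i' = 1 \<and> (\<exists>r\<in>Z. lam i' = lam r)"
        then obtain q where q: "q \<in> Z" "lam i' = lam q" "zz i' = 1" by blast
        then show ?thesis using gap3[OF r(1) q(1)] r i by auto
      qed
    qed
  qed (use zrows rest mZ in auto)
  then have "\<not> 8 dvd sum (wt {1..n} A B) X" using v by (metis dvd_abs_iff)
  then show ?thesis unfolding some_form_not_dvd8_def using t s_tableau by blast
qed

lemma some_form_not_dvd8_two_two_one_one:
  assumes r: "1 \<le> r" "lam r = 2" "lam (r + 1) = 2" "lam (r + 2) = 1" "lam (r + 3) = 1" "lam (r + 4) = 0"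
    and uniq: "\<And>i i'. 1 \<le> i \<Longrightarrow> i < r \<Longrightarrow> 1 \<le> i' \<Longrightarrow> lam i' = lam i \<Longrightarrow> i' = i"
    and big: "\<And>i. 1 \<le> i \<Longrightarrow> i < r \<Longrightarrow> 4 \<le> lam i"
  shows some_form_not_dvd8
proof -
  obtain t where t: "tableau lam n t" using tableau_ex by blast
  interpret zigzag n lam t "{r}"
    by (rule zigzag.intro[OF part t]) (use r in auto)
  have "\<bar>sum (wt {1..n} A B) X\<bar> = 12"
    using two_two_one_one_sum[OF refl r(2,4,5,6) uniq big] .
  moreover have "\<not> 8 dvd (12 :: int)" by simp
  ultimately have "\<not> 8 dvd sum (wt {1..n} A B) X" by (metis dvd_abs_iff)
  then show ?thesis unfolding some_form_not_dvd8_def using t s_tableau by blast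
qed

text \<open>The shapes that remain have the values 1, 2, 4, 6, 12 and 36 up to sign, none of them
  divisible by 8.\<close>

lemma some_form_not_dvd8_if_none:
  assumes N1: "\<not> triply_2_singular lam"
    and N2: "\<And>i j. 1 \<le> i \<Longrightarrow> repeated j \<Longrightarrow> {i, i + 1, i + 2} \<inter> {j, j + 1} = {} \<Longrightarrow> 2 \<le> lam (i + 1) \<Longrightarrow> lam (i + 2) + 2 \<le> lam i"
    and N3: "\<And>i. 1 \<le> i \<Longrightarrow> lam i = lam (i + 3) \<Longrightarrow> lam i = 0"
    and N4: "\<And>i j. repeated i \<Longrightarrow> repeated j \<Longrightarrow> 2 \<le> lam j \<Longrightarrow> lam i \<noteq> lam j + 2"
    and N5: "\<And>i. 1 \<le> i \<Longrightarrow> 3 \<le> lam (i + 1) \<Longrightarrow> lam (i + 2) + 2 \<le> lam i"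
  shows some_form_not_dvd8
proof (cases "\<exists>i. repeated i")
  case False
  show ?thesis
    by (rule some_form_not_dvd8_antidiagonal[where Z = "{}" and m = 0]) (use False unique_or_repeated in auto)
next
  case True
  define r where "r = (LEAST i. repeated i)"
  have r: "repeated r" unfolding r_def using True by (rule LeastI_ex)
  have least: "r \<le> i" if "repeated i" for i unfolding r_def using that by (rule Least_le)
  have r1: "1 \<le> r" "lam (r + 1) = lam r" "0 < lam r" using r by (auto simp: repeated_def)
  have nr: "\<not> repeated i" if "i < r" for i using least[of i] that by auto
  have mono: "lam j \<le> lam i" if "1 \<le> i" "i \<le> j" for i j using antitone[OF part that] .
  show ?thesis
  proof (cases "repeated (r + 1)")
    \<comment> \<open>Three equal rows: their length is at most 2 and nothing else is repeated, so
      the value is 6 or 36.\<close>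
    case r': True
    then have e: "lam (r + 2) = lam r" using r1 by (simp add: repeated_def)
    have m2: "lam r \<le> 2" using N5[of r] r1 e by linarith
    have n2: "\<not> repeated (r + 2)"
    proof
      assume "repeated (r + 2)"
      then have "lam r = lam (r + 3)" using e by (simp add: repeated_def numeral_3_eq_3 numeral_2_eq_2)
      then show False using N3[of r] r1 by simp
    qed
    have only: "i = r \<or> i = r + 1" if i: "repeated i" for i
    proof (rule ccontr)
      assume "\<not> ?thesis"
      then have ge: "r + 3 \<le> i" using least[OF i] n2 i by (cases "i = r + 2") auto
      have "\<not> 2 \<le> lam r" using N2[of r i] i ge r1 e by auto
      then have "lam r = 1" using r1 by simp
      moreover have "0 < lam i" "lam i \<le> lam (r + 3)" using i mono[of "r + 3" i] ge by (auto simp: repeated_def)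
      ultimately have "lam (r + 3) = lam r" using mono[of r "r + 3"] r1 by simp
      then show False using N3[of r] r1 by simp
    qed
    have rows: "{i. 1 \<le> i \<and> lam i = lam r} = {r..r + 2}"
    proof (rule rows_block)
      show "lam i = lam r" if "r \<le> i" "i \<le> r + 2" for i
      proof -
        have "i = r \<or> i = r + 1 \<or> i = r + 2" using that by linarith
        then show ?thesis using r1 e by auto
      qed
    qed (use r1 n2 nr[of "r - 1"] in auto)
    have card: "card {i. 1 \<le> i \<and> lam i = lam r} = 3" unfolding rows by simp
    show ?thesis
    proof (rule some_form_not_dvd8_antidiagonal[where Z = "{}" and m = "lam r"])
      fix i assume i: "1 \<le> i" "0 < lam i"
      show "(\<forall>i'\<ge>1. lam i' = lam i \<longrightarrow> i' = i) \<or> lam i = lam r \<or> i \<in> {} \<or> i - 1 \<in> {}"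
        using unique_or_repeated[OF i] only[of i] only[of "i - 1"] r1 by auto
    next
      have "lam r = 1 \<or> lam r = 2" using m2 r1 by linarith
      then show "\<not> 8 dvd (2 ^ card {} * fact (card {i. 1 \<le> i \<and> lam i = lam r}) ^ lam r :: int)"
        unfolding card by (auto simp: fact_numeral)
    qed auto
  next
    case r': False
    have l2: "lam (r + 2) < lam r" using r' mono[of "r + 1" "r + 2"] r1 by (auto simp: repeated_def le_less)
    have rows: "{i. 1 \<le> i \<and> lam i = lam r} = {r..r + 1}"
    proof (rule rows_block)
      show "lam i = lam r" if "r \<le> i" "i \<le> r + 1" for i
      proof -
        have "i = r \<or> i = r + 1" using that by linarith
        then show ?thesis using r1 by auto
      qed
    qed (use r1 r' nr[of "r - 1"] in auto)
    have rrows: "i = r \<or> i = r + 1" if "1 \<le> i" "lam i = lam r" for i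
    proof -
      have "i \<in> {r..r + 1}" using that unfolding rows[symmetric] by simp
      then show ?thesis by auto
    qed
    have gapr: "lam r + 2 \<le> lam i \<or> lam i + 2 \<le> lam r"
      if up: "2 \<le> r \<Longrightarrow> lam r + 2 \<le> lam (r - 1)" and dn: "lam (r + 2) + 2 \<le> lam r" and i: "1 \<le> i" "lam i \<noteq> lam r" for i
    proof (cases "i < r")
      case True
      then have "lam (r - 1) \<le> lam i" using mono[of i "r - 1"] i by auto
      then show ?thesis using up True i by linarith
    next
      case False
      then have "i \<noteq> r \<and> i \<noteq> r + 1" using i(2) r1 by auto
      then have "r + 2 \<le> i" using False by linarith
      then show ?thesis using mono[of "r + 2" i] dn by simp
    qed
    show ?thesis
    proof (cases "\<exists>i. repeated i \<and> i \<noteq> r")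
      case False
      then have only: "i = r" if "repeated i" for i using that by blast
      have rest: "(\<forall>i'\<ge>1. lam i' = lam i \<longrightarrow> i' = i) \<or> i = r \<or> (i - 1 = r \<and> lam i = lam r)" if "1 \<le> i" "0 < lam i" for i
        using unique_or_repeated[OF that] only[of i] only[of "i - 1"] by auto
      show ?thesis
      \<comment> \<open>Unjoined, the pair gives 2 ^ lam r, which is small enough up to length 2. A
        longer pair has to be joined, and \<open>N5\<close> provides the gaps for that.\<close>
      proof (cases "lam r \<le> 2")
        case True
        then have m: "lam r = 1 \<or> lam r = 2" using r1 by linarith
        show ?thesis
        proof (rule some_form_not_dvd8_antidiagonal[where Z = "{}" and m = "lam r"])
          show "(\<forall>i'\<ge>1. lam i' = lam i \<longrightarrow> i' = i) \<or> lam i = lam r \<or> i \<in> {} \<or> i - 1 \<in> {}"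
            if "1 \<le> i" "0 < lam i" for i using rest[OF that] by auto
          show "\<not> 8 dvd (2 ^ card {} * fact (card {i. 1 \<le> i \<and> lam i = lam r}) ^ lam r :: int)"
            unfolding rows using m by auto
        qed auto
      next
        case False
        have up: "lam r + 2 \<le> lam (r - 1)" if "2 \<le> r" using N5[of "r - 1"] that False r1 by simp
        have dn: "lam (r + 2) + 2 \<le> lam r" using N5[of r] r1 False by simp
        show ?thesis
          by (rule some_form_not_dvd8_antidiagonal[where Z = "{r}" and m = 0])
            (use r1 False rrows gapr[OF up dn] rest in auto)
      qed
    next
      case True
      define q where "q = (LEAST i. repeated i \<and> i \<noteq> r)"
      have q: "repeated q" "q \<noteq> r" using LeastI_ex[OF True] unfolding q_def by auto
      have leastq: "q \<le> i" if "repeated i" "i \<noteq> r" for i unfolding q_def using that by (intro Least_le) auto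
      have q2: "r + 2 \<le> q" using least[OF q(1)] q(2) r' q(1) by (cases "q = r + 1") auto
      have q1: "lam (q + 1) = lam q" "0 < lam q" "lam q \<le> lam (r + 2)"
        using q mono[of "r + 2" q] q2 by (auto simp: repeated_def)
      have mm: "2 \<le> lam r" using l2 q1 by linarith
      have only: "i = r \<or> i = q \<or> i = q + 1" if i: "repeated i" for i
      proof (rule ccontr)
        assume a: "\<not> ?thesis"
        then have "q + 2 \<le> i" using leastq[OF i] by auto
        then have "triply_2_singular lam" unfolding triply_2_singular_def
          using r q i q2 by (intro exI[of _ r] exI[of _ q] exI[of _ i]) (auto simp: repeated_def)
        then show False using N1 by blast
      qed
      have qn: "\<not> repeated (q + 2)" using only[of "q + 2"] q2 by auto
      have qp: "\<not> repeated (q - 1)" using only[of "q - 1"] q2 r' by (cases "q - 1 = r") auto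
      show ?thesis
      proof (cases "lam r \<le> lam (r + 2) + 1")
        case c: True
        \<comment> \<open>The gap below the first pair is too small for joining it. Condition (2)
          forces the second pair to follow at once and condition (5) forces length 2, so the
          partition ends in 2, 2, 1, 1.\<close>
        have qe: "q = r + 2"
        proof (rule ccontr)
          assume "q \<noteq> r + 2"
          then have "{r, r + 1, r + 2} \<inter> {q, q + 1} = {}" using q2 by auto
          then show False using N2[of r q] q r1 mm c by simp
        qed
        have m2: "lam r = 2" using N5[of r] r1 c mm by linarith
        have l: "lam (r + 2) = 1" "lam (r + 3) = 1"
          using l2 q1 m2 qe by (auto simp: numeral_3_eq_3 numeral_2_eq_2)
        have n3: "\<not> repeated (r + 3)" using N2[of r "r + 3"] r1 mm c by auto
        then have l4: "lam (r + 4) = 0"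
        proof -
          have "lam (r + 4) \<le> 1" using mono[of "r + 3" "r + 4"] l by simp
          moreover have "lam (r + 4) \<noteq> 1" using n3 l r1 by (auto simp: repeated_def numeral_eq_Suc)
          ultimately show ?thesis by simp
        qed
        show ?thesis
        proof (rule some_form_not_dvd8_two_two_one_one[OF r1(1) m2 _ l l4])
          show "lam (r + 1) = 2" using r1 m2 by simp
          show "i' = i" if i: "1 \<le> i" "i < r" "1 \<le> i'" "lam i' = lam i" for i i'
          proof -
            have "0 < lam i" using mono[of i r] i r1 by simp
            then show ?thesis using unique_or_repeated[of i] nr[of i] nr[of "i - 1"] i by auto
          qed
          show "4 \<le> lam i" if i: "1 \<le> i" "i < r" for i
          proof -
            have "{r - 1, r - 1 + 1, r - 1 + 2} \<inter> {q, q + 1} = {}" using qe i by auto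
            then have "lam (r - 1 + 2) + 2 \<le> lam (r - 1)" using N2[of "r - 1" q] q i m2 by simp
            then have "4 \<le> lam (r - 1)" using i r1 m2 by simp
            moreover have "i \<le> r - 1" using i by linarith
            ultimately show ?thesis using mono[of i "r - 1"] i by simp
          qed
        qed
      next
        case False
        then have dn: "lam (r + 2) + 2 \<le> lam r" by simp
        have up: "lam r + 2 \<le> lam (r - 1)" if "2 \<le> r"
        proof -
          have "{r - 1, r - 1 + 1, r - 1 + 2} \<inter> {q, q + 1} = {}" using q2 that by auto
          then have "lam (r - 1 + 2) + 2 \<le> lam (r - 1)" using N2[of "r - 1" q] q that mm by simp
          then show ?thesis using that r1 by simp
        qed
        have rq: "lam q + 2 \<le> lam r" using q1 dn by simp
        have rest: "(\<forall>i'\<ge>1. lam i' = lam i \<longrightarrow> i' = i) \<or> i = r \<or> i - 1 = r \<or> (lam i = lam q \<and> (repeated (q + 1) \<or> i = q \<or> i - 1 = q))"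
          if i: "1 \<le> i" "0 < lam i" for i
          using unique_or_repeated[OF i]
        proof (elim disjE)
          assume s: "repeated i"
          then have "lam (q + 1) = lam i" if "i = q + 1" using that by simp
          then show ?thesis using only[OF s] s q1 by auto
        next
          assume s: "repeated (i - 1) \<and> lam (i - 1) = lam i"
          then have "lam i = lam (q + 1)" if "i - 1 = q + 1" using that by simp
          moreover have "lam i = lam q" if "i - 1 = q" using that s by simp
          ultimately show ?thesis using only[of "i - 1"] s q1 by auto
        qed blast
        show ?thesis
        proof (cases "lam q = 1")
          case k: True
          \<comment> \<open>The last of the rows of length 1, of which there are two or three; the
            value is 2 * 2! or 2 * 3!.\<close>
          obtain b where b: "b = (if repeated (q + 1) then q + 2 else q + 1)" by blast
          have e: "lam (q + 2) = 1" if "repeated (q + 1)" using that q1 k by (simp add: repeated_def)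
          have rows1: "{i. 1 \<le> i \<and> lam i = 1} = {q..b}"
          proof (rule rows_block)
            show "lam i = 1" if "q \<le> i" "i \<le> b" for i
            proof -
              have "i = q \<or> i = q + 1 \<or> (i = q + 2 \<and> repeated (q + 1))" using that b by (auto split: if_splits)
              then show ?thesis using q1 k e by auto
            qed
          qed (use q2 qp qn b in auto)
          have cb: "card {i. 1 \<le> i \<and> lam i = 1} = 2 \<or> card {i. 1 \<le> i \<and> lam i = 1} = 3"
            unfolding rows1 b by auto
          show ?thesis
          proof (rule some_form_not_dvd8_antidiagonal[where Z = "{r}" and m = 1])
            show "\<not> 8 dvd (2 ^ card {r} * fact (card {i. 1 \<le> i \<and> lam i = 1}) ^ 1 :: int)"
              using cb by (elim disjE) (simp_all add: fact_numeral)
            show "(\<forall>i'\<ge>1. lam i' = lam i \<longrightarrow> i' = i) \<or> lam i = 1 \<or> i \<in> {r} \<or> i - 1 \<in> {r}"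
              if "1 \<le> i" "0 < lam i" for i using rest[OF that] k by auto
          qed (use r1 mm rrows gapr[OF up dn] in auto)
        next
          case False
          then have k: "2 \<le> lam q" using q1 by simp
          have disj: "{q, q + 1, q + 2} \<inter> {r, r + 1} = {}" using q2 by auto
          have dnq: "lam (q + 2) + 2 \<le> lam q" using N2[OF _ r disj] q1 k q2 by simp
          have nq1: "\<not> repeated (q + 1)" using dnq q1 by (auto simp: repeated_def)
          have upq: "lam q + 2 \<le> lam (q - 1)"
          proof (cases "q = r + 2")
            case True then show ?thesis using rq r1 by simp
          next
            case False
            then have "{q - 1, q - 1 + 1, q - 1 + 2} \<inter> {r, r + 1} = {}" using q2 by auto
            then have "lam (q - 1 + 2) + 2 \<le> lam (q - 1)" using N2[of "q - 1" r] r q2 k by simp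
            moreover have "q - 1 + 2 = q + 1" using q2 by simp
            ultimately show ?thesis using q1 by simp
          qed
          have rowsq: "{i. 1 \<le> i \<and> lam i = lam q} = {q..q + 1}"
          proof (rule rows_block)
            show "lam i = lam q" if "q \<le> i" "i \<le> q + 1" for i
            proof -
              have "i = q \<or> i = q + 1" using that by linarith
              then show ?thesis using q1 by auto
            qed
          qed (use q2 q1 qp nq1 in auto)
          have qrows: "i = q \<or> i = q + 1" if "1 \<le> i" "lam i = lam q" for i
          proof -
            have "i \<in> {q..q + 1}" using that unfolding rowsq[symmetric] by simp
            then show ?thesis by auto
          qed
          have gapq: "lam q + 2 \<le> lam i \<or> lam i + 2 \<le> lam q" if i: "1 \<le> i" "lam i \<noteq> lam q" for i
          proof (cases "i < q")
            case True
            then have "lam (q - 1) \<le> lam i" using mono[of i "q - 1"] i by auto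
            then show ?thesis using upq by linarith
          next
            case False
            then have "i \<noteq> q \<and> i \<noteq> q + 1" using i(2) q1 by auto
            then have "q + 2 \<le> i" using False by linarith
            then show ?thesis using mono[of "q + 2" i] dnq by simp
          qed
          \<comment> \<open>Two joined pairs at distance exactly 2 would be condition (4).\<close>
          have g3: "lam q + 3 \<le> lam r" using N4[OF r q(1) k] rq by linarith
          have c2: "card {r, q} = 2" using q(2) by auto
          show ?thesis
          proof (rule some_form_not_dvd8_antidiagonal[where Z = "{r, q}" and m = 0])
            show "(\<forall>i'\<ge>1. lam i' = lam i \<longrightarrow> i' = i) \<or> lam i = 0 \<or> i \<in> {r, q} \<or> i - 1 \<in> {r, q}"
              if "1 \<le> i" "0 < lam i" for i using rest[OF that] nq1 by auto
            show "1 \<le> a \<and> lam a = lam (a + 1) \<and> 2 \<le> lam a" if "a \<in> {r, q}" for a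
              using that r1 q1 q2 mm k by auto
            show "i = a \<or> i = a + 1" if "a \<in> {r, q}" "1 \<le> i" "lam i = lam a" for a i
              using that rrows[of i] qrows[of i] by auto
            show "lam a + 2 \<le> lam i \<or> lam i + 2 \<le> lam a" if "a \<in> {r, q}" "1 \<le> i" "lam i \<noteq> lam a" for a i
              using that gapr[OF up dn, of i] gapq[of i] by auto
            show "lam b + 3 \<le> lam a" if "a \<in> {r, q}" "b \<in> {r, q}" "lam b < lam a" for a b
              using that g3 by auto
            show "lam a \<noteq> 0" if "a \<in> {r, q}" for a using that r1 q1 by auto
            show "\<not> 8 dvd (2 ^ card {r, q} * fact (card {i. 1 \<le> i \<and> lam i = 0}) ^ 0 :: int)"
              unfolding c2 by simp
          qed simp
        qed
      qed
    qed
  qed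
qed

end

theorem mainTheorem8:
  fixes n :: nat and lam :: "nat \<Rightarrow> nat"
  assumes "is_partition n lam"
  shows "3 \<le> schaper_nu 2 lam n \<longleftrightarrow>
    triply_2_singular lam \<or>
    (\<exists>i j. 1 \<le> i \<and> 1 \<le> j \<and> {i, i+1, i+2} \<inter> {j, j+1} = {} \<and>
        lam i \<le> lam (i+2) + 1 \<and> lam (i+1) \<ge> 2 \<and> lam j = lam (j+1) \<and> lam j > 0) \<or>
    (\<exists>i. 1 \<le> i \<and> lam i = lam (i+3) \<and> lam i > 0) \<or>
    (\<exists>i j. 1 \<le> i \<and> 1 \<le> j \<and> lam i = lam (i+1) \<and> lam (i+1) = lam j + 2 \<and>
        lam j + 2 = lam (j+1) + 2 \<and> lam (j+1) + 2 \<ge> 4) \<or>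
    (\<exists>i. 1 \<le> i \<and> lam i \<le> lam (i+2) + 1 \<and> lam (i+1) \<ge> 3)"
proof -
  let ?S = "\<lambda>s t. \<Sum>R\<in>colorings {1..n} (cset lam) (col_of lam s) (col_of lam t).
    wt {1..n} (col_of lam s) (col_of lam t) R"
  have nu: "3 \<le> schaper_nu 2 lam n \<longleftrightarrow> (\<forall>s t. tableau lam n s \<and> tableau lam n t \<longrightarrow> 8 dvd ?S s t)"
    using schaper_ge_iff[OF assms, of 3] by simp
  show ?thesis (is "?l \<longleftrightarrow> ?c1 \<or> ?c2 \<or> ?c3 \<or> ?c4 \<or> ?c5")
  proof
    assume "?c1 \<or> ?c2 \<or> ?c3 \<or> ?c4 \<or> ?c5"
    then have "8 dvd ?S s t" for s t
    proof (elim disjE)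
      assume ?c1
      then show ?thesis by (rule dvd8_triply_singular[OF assms])
    next
      assume ?c2
      then show ?thesis using dvd8_triple_pair[OF assms] by blast
    next
      assume ?c3
      then show ?thesis using dvd8_four_equal[OF assms] by blast
    next
      assume ?c4
      then show ?thesis using dvd8_two_pairs[OF assms] by blast
    next
      assume ?c5
      then show ?thesis using dvd8_triple[OF assms] by blast
    qed
    then show ?l unfolding nu by blast
  next
    assume ?l
    then have "\<not> some_form_not_dvd8 n lam" unfolding nu some_form_not_dvd8_def[OF assms] by blast
    then show "?c1 \<or> ?c2 \<or> ?c3 \<or> ?c4 \<or> ?c5"
    proof (rule contrapos_np)
      assume no: "\<not> (?c1 \<or> ?c2 \<or> ?c3 \<or> ?c4 \<or> ?c5)"
      have n: "\<not> ?c1" "\<not> ?c2" "\<not> ?c3" "\<not> ?c4" "\<not> ?c5" using no by simp_all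
      show "some_form_not_dvd8 n lam"
      proof (rule some_form_not_dvd8_if_none[OF assms])
        show "\<not> triply_2_singular lam" by (rule n(1))
        show "lam (i + 2) + 2 \<le> lam i"
          if "1 \<le> i" "repeated lam j" "{i, i + 1, i + 2} \<inter> {j, j + 1} = {}" "2 \<le> lam (i + 1)" for i j
        proof (rule ccontr)
          assume "\<not> ?thesis"
          then have "lam i \<le> lam (i + 2) + 1" by simp
          then have ?c2 using that unfolding repeated_def[OF assms] by (intro exI[of _ i] exI[of _ j]) simp
          then show False using n(2) by (rule notE[rotated])
        qed
        show "lam i = 0" if "1 \<le> i" "lam i = lam (i + 3)" for i
        proof (rule ccontr)
          assume "lam i \<noteq> 0"
          then have ?c3 using that by (intro exI[of _ i]) simp
          then show False using n(3) by (rule notE[rotated])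
        qed
        show "lam i \<noteq> lam j + 2" if "repeated lam i" "repeated lam j" "2 \<le> lam j" for i j
        proof
          assume "lam i = lam j + 2"
          then have ?c4 using that unfolding repeated_def[OF assms] by (intro exI[of _ i] exI[of _ j]) simp
          then show False using n(4) by (rule notE[rotated])
        qed
        show "lam (i + 2) + 2 \<le> lam i" if "1 \<le> i" "3 \<le> lam (i + 1)" for i
        proof (rule ccontr)
          assume "\<not> ?thesis"
          then have "lam i \<le> lam (i + 2) + 1" by simp
          then have ?c5 using that by (intro exI[of _ i]) simp
          then show False using n(5) by (rule notE[rotated])
        qed
      qed
    qed
  qed
qed

end
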